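(* There exists a universal constant $M>0$ such that for every $Z\ge 0$ and every $V \geq Z + M\max(Z^{2/3},1)$, the variational problem $$E_Z(V)=\inf\{\mathfrak{E}_Z(\Omega) : \Omega\subset\mathbb{R}^3 \text{ measurable},\ |\Omega|=V\}$$ has no minimizer.
   Context: For a measurable set $\Omega\subset\mathbb{R}^3$ of finite volume and $Z\ge 0$, define $$\mathfrak{E}_Z(\Omega)=|\partial\Omega|+\frac12\iint_{\Omega\times\Omega}\frac{dx\,dy}{|x-y|}-\int_\Omega\frac{Z}{|x|}\,dx,$$ where $|\partial\Omega|$ denotes the (De Giorgi) perimeter of $\Omega$ and $|\Omega|$ its Lebesgue measure. $E_Z(V)$ denotes the infimum of $\mathfrak{E}_Z$ over sets of volume $V$; a minimizer is a set $\Omega$ with $|\Omega|=V$ and $\mathfrak{E}_Z(\Omega)=E_Z(V)$. *)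

theory Defs
  imports "HOL-Analysis.Analysis"
begin

type_synonym R3 = "real ^ 3"

definition C1c_field :: "(R3 \<Rightarrow> R3) \<Rightarrow> bool" where
  "C1c_field \<phi> \<longleftrightarrow>
     (\<forall>x. \<phi> differentiable (at x)) \<and>
     (\<forall>i j. continuous_on UNIV (\<lambda>x. (frechet_derivative \<phi> (at x) (axis j 1)) $ i)) \<and>
     compact (closure {x. \<phi> x \<noteq> 0})"

definition divergence :: "(R3 \<Rightarrow> R3) \<Rightarrow> R3 \<Rightarrow> real" where
  "divergence \<phi> x = (\<Sum>i\<in>UNIV. (frechet_derivative \<phi> (at x) (axis i 1)) $ i)"

definition perimeter :: "R3 set \<Rightarrow> ereal" where
  "perimeter \<Omega> = (SUP \<phi> \<in> {\<phi>. C1c_field \<phi> \<and> (\<forall>x. norm (\<phi> x) \<le> 1)}.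
      ereal (LINT x:\<Omega>|lebesgue. divergence \<phi> x))"

text \<open>Energy functional; the Coulomb and attraction terms are finite for sets of finite volume.\<close>
definition energy :: "real \<Rightarrow> R3 set \<Rightarrow> ereal" where
  "energy Z \<Omega> =
     perimeter \<Omega>
     + enn2ereal (\<integral>\<^sup>+ x. \<integral>\<^sup>+ y. ennreal (indicator \<Omega> x * indicator \<Omega> y / norm (x - y)) \<partial>lebesgue \<partial>lebesgue) / 2
     - ereal Z * enn2ereal (\<integral>\<^sup>+ x. ennreal (indicator \<Omega> x / norm x) \<partial>lebesgue)"

definition E_Z :: "real \<Rightarrow> real \<Rightarrow> ereal" where
  "E_Z Z V = (INF \<Omega> \<in> {\<Omega>. \<Omega> \<in> sets lebesgue \<and> emeasure lebesgue \<Omega> = ennreal V}. energy Z \<Omega>)"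

definition is_minimizer :: "real \<Rightarrow> real \<Rightarrow> R3 set \<Rightarrow> bool" where
  "is_minimizer Z V \<Omega> \<longleftrightarrow>
     \<Omega> \<in> sets lebesgue \<and> emeasure lebesgue \<Omega> = ennreal V \<and> energy Z \<Omega> = E_Z Z V"

end

theory Submission
  imports Defs "HOL-Probability.Distributions"
begin

text \<open>
  A minimizer \<open>\<Omega>\<close> may be cut along any plane and one of the two pieces moved to infinity, so the Coulomb
  energy between the pieces is at most the attraction of the moved piece by the nucleus plus a multiple
  of the area of the cut. Let \<open>B\<close> be the ball of volume \<open>Z\<close> and radius \<open>R\<close>. By Newton's theorem the charge
  of \<open>\<Omega>\<close> in \<open>B\<close> screens the nucleus outside \<open>B\<close> up to the volume \<open>h\<close> of the hole \<open>B - \<Omega>\<close>, hence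
  integrating over all planes that miss \<open>B\<close>, in finitely many directions, bounds the square of the volume
  of \<open>\<Omega>\<close> outside a ball of radius \<open>100 R\<close> by a multiple of \<open>4 + h\<close> times its volume outside \<open>B\<close>.
  It remains to see that, if \<open>Q = V - Z\<close> is large compared with \<open>R\<^sup>2\<close>, then \<open>h\<close> is a small fraction of \<open>Q\<close>
  and most of \<open>Q\<close> lies far away. Both follow from comparing \<open>\<Omega>\<close> with \<open>B\<close> plus distant unit-size droplets:
  as the Coulomb kernel is positive definite, the excess energy of \<open>\<Omega>\<close>, which is of order \<open>Q\<close>, controls
  both the hole and the charge near \<open>B\<close>.
\<close>

text \<open>What shapes the proof is that the final inequality, of the form |N'|^2 <= C (4 + h) |N|,
  is quadratic in Q on both sides: N' and N are the parts of \<Omega> outside radius 100 R and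
  outside B, and |N| = Q + h. It bounds Q only if h is a small fixed fraction of Q and |N'| a
  definite one. Hole: the net potential of the nucleus and the oppositely charged ball grows at
  least quadratically with the depth below the surface of B, so volume missing at depth d or more
  costs at least 2 pi d^2 per unit, while shallower holes fit into a shell of volume of order R^2 d.
  Hence h <= C (R^2 d + Q / d^2), and one fixes a large constant d before requiring Q >= C' R^2.
  This fixes both the exponent 2/3 of Z and the constant M. Nearby charge: a net charge q within
  distance of order R of the origin has Coulomb energy at least of order q^2 / R, so q^2 <= C R Q,
  which is far below Q^2.\<close>

subsection \<open>The Coulomb potential of a ball\<close>

lemma emeasure_cball_R3:
  "r \<ge> 0 \<Longrightarrow> emeasure lborel (cball (c::R3) r) = ennreal (4/3 * pi * r^3)"
  by (subst emeasure_cball) (simp_all add: eval_unit_ball_vol)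

text \<open>A disc of squared radius t has area pi * t, which is linear in t. The squared norm
  therefore has a constant density, and this replaces polar coordinates in the plane.\<close>

lemma distr_norm_square_R2:
  "distr lborel borel (\<lambda>p::real\<times>real. (norm p)\<^sup>2) = density lborel (\<lambda>w. ennreal pi * indicator {0..} w)"
  (is "?M = ?N")
proof (rule measure_eqI_generator_eq)
  let ?E = "range (\<lambda>a::real. {..a})"
  show "Int_stable ?E"
    by (auto simp: Int_stable_def intro!: image_eqI[where x="min _ _"])
  show "?E \<subseteq> Pow UNIV" by simp
  show "sets ?M = sigma_sets UNIV ?E" "sets ?N = sigma_sets UNIV ?E"
    by (simp_all add: borel_eq_atMost)
  let ?A = "\<lambda>n::nat. {..real n}"
  show "range ?A \<subseteq> ?E" by auto
  show "(\<Union>i. ?A i) = UNIV" by (auto simp: real_arch_simple)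
  have M: "emeasure ?M {..t} = ennreal (pi * max 0 t)" for t
  proof (cases "t \<ge> 0")
    case True
    have "norm p \<le> sqrt t \<longleftrightarrow> sqrt ((norm p)\<^sup>2) \<le> sqrt t" for p :: "real\<times>real" by simp
    then have "(\<lambda>p::real\<times>real. (norm p)\<^sup>2) -` {..t} = cball 0 (sqrt t)"
      by (auto simp: real_sqrt_le_iff simp del: real_sqrt_abs)
    then have "emeasure ?M {..t} = emeasure lborel (cball (0::real\<times>real) (sqrt t))"
      by (subst emeasure_distr) auto
    also have "\<dots> = ennreal (pi * t)"
      using True by (subst emeasure_cball) (simp_all add: eval_unit_ball_vol)
    finally show ?thesis using True by (simp add: max_def)
  next
    case False
    then have "(\<lambda>p::real\<times>real. (norm p)\<^sup>2) -` {..t} = {}"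
      using order_trans[OF zero_le_power2] by fastforce
    with False show ?thesis
      by (subst emeasure_distr) (auto simp: max_def)
  qed
  have N: "emeasure ?N {..t} = ennreal (pi * max 0 t)" for t
  proof -
    have "emeasure ?N {..t} = (\<integral>\<^sup>+w. ennreal pi * indicator {0..max 0 t} w * indicator {..t} w \<partial>lborel)"
      by (subst emeasure_density) (auto intro!: nn_integral_cong split: split_indicator)
    also have "\<dots> = (\<integral>\<^sup>+w. ennreal pi * (if t < 0 then 0 else indicator {0..max 0 t} w) \<partial>lborel)"
      by (auto intro!: nn_integral_cong split: split_indicator)
    also have "\<dots> = ennreal (pi * max 0 t)"
      by (cases "t < 0") (auto simp: nn_integral_cmult ennreal_mult max_def)
    finally show ?thesis .
  qed
  show "emeasure ?M X = emeasure ?N X" if "X \<in> ?E" for X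
    using that M N by auto
  show "emeasure ?M (?A i) \<noteq> \<infinity>" for i
    by (simp add: M)
qed

lemma nn_integral_R2_radial:
  assumes [measurable]: "G \<in> borel_measurable borel"
  shows "(\<integral>\<^sup>+(p::real\<times>real). G ((norm p)\<^sup>2) \<partial>lborel) = ennreal pi * (\<integral>\<^sup>+w. indicator {0..} w * G w \<partial>lborel)"
proof -
  have "(\<integral>\<^sup>+(p::real\<times>real). G ((norm p)\<^sup>2) \<partial>lborel) = (\<integral>\<^sup>+w. G w \<partial>distr lborel borel (\<lambda>p::real\<times>real. (norm p)\<^sup>2))"
    by (simp add: nn_integral_distr)
  also have "\<dots> = ennreal pi * (\<integral>\<^sup>+w. indicator {0..} w * G w \<partial>lborel)"
    unfolding distr_norm_square_R2
    by (subst nn_integral_density) (simp_all add: nn_integral_cmult mult.assoc)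
  finally show ?thesis .
qed

lemma cball_borel [measurable]: "cball (c::'a::metric_space) r \<in> sets borel"
  by (intro borel_closed closed_cball)

text \<open>Serves to slice a ball centred at the origin into discs orthogonal to the third
  axis.\<close>

definition cyl :: "(real\<times>real)\<times>real \<Rightarrow> R3" where
  "cyl q = fst (fst q) *\<^sub>R axis 1 1 + snd (fst q) *\<^sub>R axis 2 1 + snd q *\<^sub>R axis 3 1"

lemma cyl_nth [simp]:
  "cyl q $ 1 = fst (fst q)" "cyl q $ 2 = snd (fst q)" "cyl q $ 3 = snd q"
  by (simp_all add: cyl_def axis_def)

lemma cyl_measurable [measurable]: "cyl \<in> borel_measurable borel"
  unfolding cyl_def by (intro borel_measurable_continuous_onI continuous_intros)

lemma norm_cyl: "(norm (cyl ((a,b),c)))\<^sup>2 = (norm (a,b))\<^sup>2 + c\<^sup>2"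
  by (simp add: norm_vec_def L2_set_def sum_3 norm_Pair sum_nonneg)

lemma Basis_R3: "(Basis :: R3 set) = {axis 1 1, axis 2 1, axis 3 1}"
proof -
  have U: "(UNIV :: 3 set) = {1,2,3}" using exhaust_3 by auto
  show ?thesis by (auto simp: Basis_vec_def U)
qed

lemma axis_R3_neq: "(axis 1 1 :: R3) \<noteq> axis 2 1" "(axis 1 1 :: R3) \<noteq> axis 3 1" "(axis 2 1 :: R3) \<noteq> axis 3 1"
  by (auto simp: axis_eq_axis)

lemma lborel_cyl: "(lborel :: R3 measure) = distr lborel borel cyl"
proof (rule lborel_eqI)
  fix l u :: R3 assume le: "\<And>b. b \<in> Basis \<Longrightarrow> l \<bullet> b \<le> u \<bullet> b"
  from le[of "axis 1 1"] le[of "axis 2 1"] le[of "axis 3 1"]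
  have le': "l $ 1 \<le> u $ 1" "l $ 2 \<le> u $ 2" "l $ 3 \<le> u $ 3"
    by (auto simp: Basis_R3 inner_axis)
  have "cyl -` box l u = box ((l$1,l$2),l$3) ((u$1,u$2),u$3)"
    by (auto simp: box_def Basis_R3 inner_axis Basis_prod_def)
  then have "emeasure (distr lborel borel cyl) (box l u)
      = emeasure lborel (box ((l$1,l$2),l$3) ((u$1,u$2),u$3))"
    by (simp add: emeasure_distr)
  also have "\<dots> = (\<Prod>b\<in>Basis. (((u$1,u$2),u$3) - ((l$1,l$2),l$3)) \<bullet> b)"
    using le' by (intro emeasure_lborel_box) (auto simp: Basis_prod_def)
  also have "\<dots> = (\<Prod>b\<in>Basis. (u - l) \<bullet> b)"
    using axis_R3_neq by (simp add: Basis_prod_def Basis_R3 inner_axis prod.union_disjoint prod.reindex inj_on_def inner_simps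
      image_image Int_def image_iff mult_ac)
  finally show "emeasure (distr lborel borel cyl) (box l u) = (\<Prod>b\<in>Basis. (u - l) \<bullet> b)" .
qed simp

lemma nn_integral_cyl:
  assumes [measurable]: "f \<in> borel_measurable borel"
  shows "(\<integral>\<^sup>+(x::R3). f x \<partial>lborel) = (\<integral>\<^sup>+z. \<integral>\<^sup>+p. f (cyl (p, z)) \<partial>lborel \<partial>lborel)"
proof -
  have "(\<integral>\<^sup>+(x::R3). f x \<partial>lborel) = (\<integral>\<^sup>+q. f (cyl q) \<partial>(lborel \<Otimes>\<^sub>M lborel))"
    by (subst lborel_cyl, subst nn_integral_distr) (simp_all add: lborel_prod)
  also have "\<dots> = (\<integral>\<^sup>+z. \<integral>\<^sup>+p. f (cyl (p, z)) \<partial>lborel \<partial>lborel)"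
    by (subst lborel_pair.nn_integral_snd[symmetric]) (simp_all add: lborel_prod)
  finally show ?thesis .
qed

lemma lborel_distr_orthogonal:
  fixes f :: "real^'n::{finite,wellorder} \<Rightarrow> real^'n::_"
  assumes f: "orthogonal_transformation f"
  shows "distr lborel borel f = lborel"
proof (rule lborel_eqI[symmetric])
  have fm [measurable]: "f \<in> borel_measurable borel"
    using f by (intro borel_measurable_continuous_onI linear_continuous_on)
      (metis orthogonal_transformation_linear linear_conv_bounded_linear)
  fix l u :: "real^'n::{finite,wellorder}" assume le: "\<And>b. b \<in> Basis \<Longrightarrow> l \<bullet> b \<le> u \<bullet> b"
  have g: "orthogonal_transformation (inv f)" using f by (rule orthogonal_transformation_inv)
  have im: "f -` box l u = inv f ` box l u"
    using orthogonal_transformation_bij[OF f] by (simp add: bij_vimage_eq_inv_image)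
  have bl: "box l u \<in> lmeasurable" by simp
  have "inv f ` box l u \<in> lmeasurable" "measure lebesgue (inv f ` box l u) = measure lebesgue (box l u)"
    using measure_orthogonal_image[OF g bl] measurable_orthogonal_image[OF g bl] by auto
  then have "emeasure lebesgue (inv f ` box l u) = emeasure lebesgue (box l u)"
    using bl by (simp add: emeasure_eq_measure2)
  moreover have "f -` box l u \<in> sets borel"
    using measurable_sets[OF fm, of "box l u"] by simp
  ultimately have "emeasure lborel (f -` box l u) = emeasure lborel (box l u)"
    by (simp add: im)
  then show "emeasure (distr lborel borel f) (box l u) = (\<Prod>b\<in>Basis. (u - l) \<bullet> b)"
    using le by (simp add: emeasure_distr)
qed simp

section \<open>Newton's theorem for a uniformly charged ball\<close>

abbreviation vol :: "R3 set \<Rightarrow> real" where "vol \<equiv> measure lborel"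

text \<open>With extended nonnegative values, potentials can be added and compared without
  integrability conditions. At y = x the kernel has the value 1/0 = 0, on a null set.\<close>

definition pot :: "R3 set \<Rightarrow> R3 \<Rightarrow> ennreal" where
  "pot A x = (\<integral>\<^sup>+y. indicator A y * ennreal (1 / norm (x - y)) \<partial>lborel)"

lemma pot_cball_rotate:
  assumes "norm x = norm y" shows "pot (cball 0 a) x = pot (cball 0 a) y"
proof -
  obtain f :: "R3 \<Rightarrow> R3" where f: "orthogonal_transformation f" and fx: "f x = y"
    using orthogonal_transformation_exists[OF assms] by blast
  have [measurable]: "f \<in> borel_measurable borel"
    using f by (intro borel_measurable_continuous_onI linear_continuous_on)
      (metis orthogonal_transformation_linear linear_conv_bounded_linear)
  have n: "norm (f z) = norm z" for z using f by (rule orthogonal_transformation_norm)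
  have d: "norm (y - f z) = norm (x - z)" for z
    using n[of "x - z"] fx f by (simp add: linear_diff orthogonal_transformation_linear)
  have "pot (cball 0 a) y = (\<integral>\<^sup>+z. indicator (cball 0 a) z * ennreal (1 / norm (y - z)) \<partial>distr lborel borel f)"
    unfolding pot_def lborel_distr_orthogonal[OF f] ..
  also have "\<dots> = (\<integral>\<^sup>+z. indicator (cball 0 a) (f z) * ennreal (1 / norm (y - f z)) \<partial>lborel)"
    by (subst nn_integral_distr) simp_all
  also have "\<dots> = pot (cball 0 a) x"
    unfolding pot_def d by (intro nn_integral_cong) (simp add: indicator_def n)
  finally show ?thesis ..
qed

text \<open>Up to the factor pi, this is the potential at height s on the axis of the disc that the
  plane at height z cuts from the ball of radius a; w is the squared distance from the axis. At z =
  s the integrand would be singular at w = 0.\<close>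

lemma slice_integral:
  assumes z: "z\<^sup>2 \<le> a\<^sup>2" "z \<noteq> s"
  shows "(\<integral>\<^sup>+w. indicator {0..a\<^sup>2 - z\<^sup>2} w * ennreal (1 / sqrt (w + (s-z)\<^sup>2)) \<partial>lborel)
    = ennreal (2 * (sqrt (a\<^sup>2 + s\<^sup>2 - 2 * s * z) - \<bar>s-z\<bar>))"
proof -
  have sz: "(s-z)\<^sup>2 > 0" using z by simp
  have "((\<lambda>w. 1 / sqrt (w + (s-z)\<^sup>2)) has_integral
      (2 * sqrt ((a\<^sup>2 - z\<^sup>2) + (s-z)\<^sup>2) - 2 * sqrt (0 + (s-z)\<^sup>2))) {0..a\<^sup>2-z\<^sup>2}"
  proof (rule fundamental_theorem_of_calculus)
    show "0 \<le> a\<^sup>2 - z\<^sup>2" using z by simp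
    fix w assume "w \<in> {0..a\<^sup>2 - z\<^sup>2}"
    then have p: "w + (s-z)\<^sup>2 > 0" using sz by (intro add_nonneg_pos) auto
    have "((\<lambda>w. 2 * sqrt (w + (s-z)\<^sup>2)) has_real_derivative 1 / sqrt (w + (s-z)\<^sup>2)) (at w)"
      using p by (auto intro!: derivative_eq_intros simp: divide_simps)
    then show "((\<lambda>w. 2 * sqrt (w + (s-z)\<^sup>2)) has_vector_derivative 1 / sqrt (w + (s-z)\<^sup>2)) (at w within {0..a\<^sup>2 - z\<^sup>2})"
      by (auto simp: has_real_derivative_iff_has_vector_derivative intro: has_vector_derivative_at_within)
  qed
  moreover have e: "(a\<^sup>2 - z\<^sup>2) + (s-z)\<^sup>2 = a\<^sup>2 + s\<^sup>2 - 2 * s * z" by (simp add: power2_eq_square algebra_simps)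
  ultimately have H: "((\<lambda>w. 1 / sqrt (w + (s-z)\<^sup>2)) has_integral
      (2 * (sqrt (a\<^sup>2 + s\<^sup>2 - 2 * s * z) - \<bar>s-z\<bar>))) {0..a\<^sup>2-z\<^sup>2}"
    unfolding e by (simp add: right_diff_distrib)
  have "(\<integral>\<^sup>+w. indicator {0..a\<^sup>2 - z\<^sup>2} w * ennreal (1 / sqrt (w + (s-z)\<^sup>2)) \<partial>lborel)
    = (\<integral>\<^sup>+w. ennreal (indicator {0..a\<^sup>2 - z\<^sup>2} w * (1 / sqrt (w + (s-z)\<^sup>2))) \<partial>lborel)"
    by (intro nn_integral_cong) (auto split: split_indicator)
  also have "\<dots> = ennreal (2 * (sqrt (a\<^sup>2 + s\<^sup>2 - 2 * s * z) - \<bar>s-z\<bar>))"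
    by (rule nn_integral_has_integral_lebesgue[OF _ H]) auto
  finally show ?thesis .
qed

text \<open>Adds up the discs. The two cases arise because the antiderivative at z = a contains sqrt
  ((s - a)^2) = |s - a|.\<close>

lemma slice_sum_integral:
  assumes s: "s > 0" and a: "a > 0"
  shows "(\<integral>\<^sup>+z. indicator {-a..a} z * ennreal (2 * (sqrt (a\<^sup>2 + s\<^sup>2 - 2 * s * z) - \<bar>s-z\<bar>)) \<partial>lborel)
    = ennreal (if s \<ge> a then 4/3 * a^3 / s else 2 * (a\<^sup>2 - s\<^sup>2/3))"
proof -
  define D where "D z = a\<^sup>2 + s\<^sup>2 - 2 * s * z" for z
  \<comment> \<open>\<open>D\<close> is affine in z with slope -2 s, so the first term has
    derivative 2 sqrt (D z); the second has derivative -2 |s - z|.\<close>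
  define F where "F z = - (2/(3 * s)) * (D z * sqrt (D z)) + (s-z) * \<bar>s-z\<bar>" for z
  define I where "I = (if s \<ge> a then 4/3 * a^3 / s else 2 * (a\<^sup>2 - s\<^sup>2/3))"
  have D0: "D z > 0" if "z < a" for z
  proof -
    have "D z > a\<^sup>2 + s\<^sup>2 - 2 * s * a" using that s by (simp add: D_def)
    moreover have "a\<^sup>2 + s\<^sup>2 - 2 * s * a = (a-s)\<^sup>2" by (simp add: power2_eq_square algebra_simps)
    ultimately show ?thesis using zero_le_power2[of "a-s"] by linarith
  qed
  have Da: "D a = (s-a)\<^sup>2" "D (-a) = (s+a)\<^sup>2"
    by (simp_all add: D_def power2_eq_square algebra_simps)
  have H: "((\<lambda>z. 2 * (sqrt (D z) - \<bar>s-z\<bar>)) has_integral (F a - F (-a))) {-a..a}"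
  \<comment> \<open>At z = s, where |s - z| changes its formula, only continuity of \<open>F\<close>
    is checked.\<close>
  proof (rule fundamental_theorem_of_calculus_interior_strong[where S="{s}"])
    show "continuous_on {-a..a} F" unfolding F_def D_def by (intro continuous_intros)
    fix z assume z: "z \<in> {-a<..<a} - {s}"
    have "D z > 0" using z D0 by auto
    have 1: "((\<lambda>z. D z * sqrt (D z)) has_real_derivative (-2 * s) * sqrt (D z) + D z * ((-2 * s) * (inverse (sqrt (D z)) / 2))) (at z)"
      unfolding D_def using \<open>D z > 0\<close>[unfolded D_def] by (auto intro!: derivative_eq_intros simp: divide_simps)
    have 11: "(-2 * s) * sqrt (D z) + D z * ((-2 * s) * (inverse (sqrt (D z)) / 2)) = -3 * s * sqrt (D z)"
      using \<open>D z > 0\<close> by (simp add: field_simps)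
    have 2: "((\<lambda>z. (s-z) * \<bar>s-z\<bar>) has_real_derivative -2*\<bar>s-z\<bar>) (at z)"
    proof (cases "z < s")
      case True
      have "((\<lambda>z. (s-z) * (s-z)) has_real_derivative -2*\<bar>s-z\<bar>) (at z)"
        using True by (auto intro!: derivative_eq_intros)
      then show ?thesis
        by (rule DERIV_cong_ev[THEN iffD1, rotated -1])
           (use True in \<open>auto intro!: eventually_mono[OF eventually_nhds_in_open[of "{..<s}"]]\<close>)
    next
      case False
      have "((\<lambda>z. (s-z) * (z-s)) has_real_derivative -2*\<bar>s-z\<bar>) (at z)"
        using False by (auto intro!: derivative_eq_intros)
      then show ?thesis
        by (rule DERIV_cong_ev[THEN iffD1, rotated -1])
           (use False z in \<open>auto intro!: eventually_mono[OF eventually_nhds_in_open[of "{s<..}"]]\<close>)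
    qed
    have "(F has_real_derivative - (2/(3 * s)) * (-3 * s * sqrt (D z)) + (-2*\<bar>s-z\<bar>)) (at z)"
      unfolding F_def using 1 2 unfolding 11 by (intro DERIV_add DERIV_cmult)
    moreover have "- (2/(3 * s)) * (-3 * s * sqrt (D z)) + (-2*\<bar>s-z\<bar>) = 2 * (sqrt (D z) - \<bar>s-z\<bar>)"
      using s by (simp add: field_simps)
    ultimately show "(F has_vector_derivative 2 * (sqrt (D z) - \<bar>s-z\<bar>)) (at z)"
      by (simp add: has_real_derivative_iff_has_vector_derivative)
  qed (use a in auto)
  have FI: "F a - F (-a) = I"
  proof -
    have Fm: "F (-a) = - (2/(3 * s)) * ((s+a)\<^sup>2 * (s+a)) + (s+a)*(s+a)"
      using s a by (simp add: F_def Da)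
    show ?thesis
    proof (cases "s \<ge> a")
      case True
      have "F a = - (2/(3 * s)) * ((s-a)\<^sup>2 * (s-a)) + (s-a)*(s-a)"
        using True by (simp add: F_def Da)
      with True s show ?thesis unfolding Fm I_def
        by (simp add: field_simps power2_eq_square power3_eq_cube)
    next
      case False
      have "F a = - (2/(3 * s)) * ((s-a)\<^sup>2 * (a-s)) - (s-a)*(s-a)"
        using False by (simp add: F_def Da algebra_simps)
      with False s show ?thesis unfolding Fm I_def
        by (simp add: field_simps power2_eq_square power3_eq_cube)
    qed
  qed
  have nn: "0 \<le> 2 * (sqrt (D z) - \<bar>s-z\<bar>)" if "z \<in> {-a..a}" for z
  proof -
    have "z\<^sup>2 \<le> a\<^sup>2" using that by (intro abs_le_square_iff[THEN iffD1]) auto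
    then have "(s-z)\<^sup>2 \<le> D z" by (simp add: D_def power2_eq_square algebra_simps)
    then have "\<bar>s-z\<bar> \<le> sqrt (D z)" using real_sqrt_le_mono by fastforce
    then show ?thesis by simp
  qed
  have "(\<integral>\<^sup>+z. indicator {-a..a} z * ennreal (2 * (sqrt (a\<^sup>2 + s\<^sup>2 - 2 * s * z) - \<bar>s-z\<bar>)) \<partial>lborel)
    = (\<integral>\<^sup>+z. ennreal (indicator {-a..a} z * (2 * (sqrt (D z) - \<bar>s-z\<bar>))) \<partial>lborel)"
    by (intro nn_integral_cong) (auto simp: D_def split: split_indicator)
  also have "\<dots> = ennreal I"
    by (rule nn_integral_has_integral_lebesgue[OF _ H[unfolded FI]]) (use nn in auto)
  finally show ?thesis by (simp add: I_def)
qed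

text \<open>A rotation moves x to the third axis, where slicing into discs leaves a one-dimensional
  integral. The centre is excluded because the antiderivative in \<open>slice_sum_integral\<close>
  divides by the height s = norm x.\<close>

lemma pot_cball:
  assumes x: "x \<noteq> 0" and a: "a > 0"
  shows "pot (cball 0 a) x
    = ennreal (if norm x \<ge> a then 4/3 * pi * a^3 / norm x else 2 * pi * (a\<^sup>2 - (norm x)\<^sup>2/3))"
proof -
  define s where "s = norm x"
  have s: "s > 0" using x by (simp add: s_def)
  define y :: R3 where "y = s *\<^sub>R axis 3 1"
  have "norm y = norm x" using s by (simp add: y_def norm_axis_1 s_def)
  then have "pot (cball 0 a) x = pot (cball 0 a) y" by (intro pot_cball_rotate) simp
  also have "\<dots> = (\<integral>\<^sup>+z. \<integral>\<^sup>+p. indicator (cball 0 a) (cyl (p,z)) * ennreal (1 / norm (y - cyl (p,z))) \<partial>lborel \<partial>lborel)"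
    unfolding pot_def by (rule nn_integral_cyl) simp
  also have "\<dots> = (\<integral>\<^sup>+z. \<integral>\<^sup>+(p::real\<times>real). indicator {..a\<^sup>2 - z\<^sup>2} ((norm p)\<^sup>2) * ennreal (1 / sqrt ((norm p)\<^sup>2 + (s-z)\<^sup>2)) \<partial>lborel \<partial>lborel)"
  proof (intro nn_integral_cong)
    fix z :: real and p :: "real\<times>real"
    obtain b c where p: "p = (b,c)" by (cases p)
    have "cyl (p,z) \<in> cball 0 a \<longleftrightarrow> (norm (cyl (p,z)))\<^sup>2 \<le> a\<^sup>2"
      using a abs_le_square_iff[of "norm (cyl (p,z))" a] by simp
    also have "\<dots> \<longleftrightarrow> (norm p)\<^sup>2 \<in> {..a\<^sup>2 - z\<^sup>2}"
      unfolding p norm_cyl by auto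
    finally have i: "indicator (cball 0 a) (cyl (p,z)) = (indicator {..a\<^sup>2 - z\<^sup>2} ((norm p)\<^sup>2) :: ennreal)"
      by (simp add: indicator_def)
    have "y - cyl (p,z) = cyl ((-b,-c), s-z)" by (simp add: y_def cyl_def p algebra_simps)
    then have "(norm (y - cyl (p,z)))\<^sup>2 = (norm p)\<^sup>2 + (s-z)\<^sup>2"
      by (simp add: norm_cyl p norm_Pair)
    then have "norm (y - cyl (p,z)) = sqrt ((norm p)\<^sup>2 + (s-z)\<^sup>2)"
      by (metis norm_ge_zero real_sqrt_unique)
    with i show "indicator (cball 0 a) (cyl (p,z)) * ennreal (1 / norm (y - cyl (p,z)))
      = indicator {..a\<^sup>2 - z\<^sup>2} ((norm p)\<^sup>2) * ennreal (1 / sqrt ((norm p)\<^sup>2 + (s-z)\<^sup>2))"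
      by simp
  qed
  also have "\<dots> = (\<integral>\<^sup>+z. ennreal pi * (\<integral>\<^sup>+w. indicator {0..} w * (indicator {..a\<^sup>2 - z\<^sup>2} w * ennreal (1 / sqrt (w + (s-z)\<^sup>2))) \<partial>lborel) \<partial>lborel)"
    by (intro nn_integral_cong, rule nn_integral_R2_radial) measurable
  also have "\<dots> = (\<integral>\<^sup>+z. ennreal pi * (indicator {-a..a} z * ennreal (2 * (sqrt (a\<^sup>2 + s\<^sup>2 - 2 * s * z) - \<bar>s-z\<bar>))) \<partial>lborel)"
  proof (rule nn_integral_cong_AE, rule AE_mp[OF AE_lborel_singleton[of s]], rule AE_I2, rule impI)
    fix z assume elim: "z \<noteq> s"
    have "(\<integral>\<^sup>+w. indicator {0..} w * (indicator {..a\<^sup>2 - z\<^sup>2} w * ennreal (1 / sqrt (w + (s-z)\<^sup>2))) \<partial>lborel)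
      = (\<integral>\<^sup>+w. indicator {0..a\<^sup>2 - z\<^sup>2} w * ennreal (1 / sqrt (w + (s-z)\<^sup>2)) \<partial>lborel)"
      by (intro nn_integral_cong) (auto split: split_indicator)
    also have "\<dots> = indicator {-a..a} z * ennreal (2 * (sqrt (a\<^sup>2 + s\<^sup>2 - 2 * s * z) - \<bar>s-z\<bar>))"
    proof (cases "z \<in> {-a..a}")
      case True
      then have "z\<^sup>2 \<le> a\<^sup>2" by (intro abs_le_square_iff[THEN iffD1]) auto
      with True elim show ?thesis by (simp add: slice_integral)
    next
      case False
      then have "\<not> \<bar>z\<bar> \<le> \<bar>a\<bar>" using a by auto
      then have "\<not> z\<^sup>2 \<le> a\<^sup>2" by (simp only: abs_le_square_iff not_False_eq_True)
      with False show ?thesis by simp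
    qed
    finally show "ennreal pi * (\<integral>\<^sup>+w. indicator {0..} w * (indicator {..a\<^sup>2 - z\<^sup>2} w * ennreal (1 / sqrt (w + (s-z)\<^sup>2))) \<partial>lborel)
      = ennreal pi * (indicator {-a..a} z * ennreal (2 * (sqrt (a\<^sup>2 + s\<^sup>2 - 2 * s * z) - \<bar>s-z\<bar>)))"
      by simp
  qed
  also have "\<dots> = ennreal pi * ennreal (if s \<ge> a then 4/3 * a^3 / s else 2 * (a\<^sup>2 - s\<^sup>2/3))"
    by (subst nn_integral_cmult, simp, simp only: slice_sum_integral[OF s a])
  also have "\<dots> = ennreal (if s \<ge> a then 4/3 * pi * a^3 / s else 2 * pi * (a\<^sup>2 - s\<^sup>2/3))"
    by (simp add: ennreal_mult'[symmetric] algebra_simps)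
  finally show ?thesis by (simp add: s_def)
qed

section \<open>Elementary bounds for potentials\<close>

lemma nn_integral_lborel_shift:
  fixes f :: "'a::euclidean_space \<Rightarrow> ennreal"
  assumes [measurable]: "f \<in> borel_measurable borel"
  shows "(\<integral>\<^sup>+x. f (t + x) \<partial>lborel) = (\<integral>\<^sup>+x. f x \<partial>lborel)"
proof -
  have "(\<integral>\<^sup>+x. f x \<partial>lborel) = (\<integral>\<^sup>+x. f x \<partial>distr lborel borel ((+) t))"
    by (simp only: lborel_distr_plus)
  also have "\<dots> = (\<integral>\<^sup>+x. f (t + x) \<partial>lborel)"
    by (subst nn_integral_distr) simp_all
  finally show ?thesis ..
qed

lemma pot_translate:
  assumes [measurable]: "A \<in> sets borel"
  shows "pot A x = (\<integral>\<^sup>+y. indicator A (x + y) * ennreal (1 / norm y) \<partial>lborel)"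
  unfolding pot_def
  by (subst nn_integral_lborel_shift[symmetric, where t=x]) simp_all

lemma pot_measurable [measurable]:
  assumes [measurable]: "A \<in> sets borel"
  shows "pot A \<in> borel_measurable borel"
  unfolding pot_def by measurable

lemma pot_mono: "A \<subseteq> B \<Longrightarrow> pot A x \<le> pot B x"
  unfolding pot_def by (intro nn_integral_mono) (auto split: split_indicator)

lemma pot_Un:
  assumes [measurable]: "A \<in> sets borel" "B \<in> sets borel" and "A \<inter> B = {}"
  shows "pot (A \<union> B) x = pot A x + pot B x"
  unfolding pot_def using assms(3)
  by (subst nn_integral_add[symmetric]) (auto intro!: nn_integral_cong split: split_indicator)

lemma pot_far:
  assumes [measurable]: "A \<in> sets borel" and d: "d > 0" "\<And>y. y \<in> A \<Longrightarrow> d \<le> norm (x - y)"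
  shows "pot A x \<le> ennreal (1/d) * emeasure lborel A"
proof -
  have "pot A x \<le> (\<integral>\<^sup>+y. ennreal (1/d) * indicator A y \<partial>lborel)"
    unfolding pot_def using d
    by (intro nn_integral_mono) (auto intro!: ennreal_leI divide_left_mono mult_pos_pos elim: less_le_trans split: split_indicator)
  then show ?thesis by (simp add: nn_integral_cmult)
qed

text \<open>Beyond distance 1 from x the kernel is at most 1. Within distance 1 the set can be
  enlarged to a full ball, whose potential is known.\<close>

lemma pot_le:
  assumes [measurable]: "A \<in> sets borel"
  shows "pot A x \<le> ennreal (8 * pi) + emeasure lborel A"
proof -
  \<comment> \<open>\<open>pot_cball\<close> is silent about the centre, so the unit ball around x
    is seen from x as a part of the ball of radius 2 seen from the off-centre point
    \<open>e\<close>.\<close>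
  define e :: R3 where "e = (1/2) *\<^sub>R axis 1 1"
  have e: "norm e = 1/2" "e \<noteq> 0" by (auto simp: e_def norm_axis_1)
  have "pot (A \<inter> cball x 1) x \<le> pot (cball 0 2) e"
    unfolding pot_translate[OF sets.Int[OF assms cball_borel]] pot_translate[OF cball_borel]
  proof (intro nn_integral_mono mult_right_mono)
    fix y show "indicator (A \<inter> cball x 1) (x + y) \<le> (indicator (cball 0 2) (e + y) :: ennreal)"
      using norm_triangle_ineq[of e y] e by (auto simp: dist_norm[of x "x + y"] split: split_indicator)
  qed auto
  also have "\<dots> = ennreal (2 * pi * (4 - 1/12))"
    using pot_cball[OF e(2), of 2] e(1) by (simp add: power2_eq_square)
  also have "\<dots> \<le> ennreal (8 * pi)" by (intro ennreal_leI) simp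
  finally have 1: "pot (A \<inter> cball x 1) x \<le> ennreal (8 * pi)" .
  have "pot (A - cball x 1) x \<le> ennreal (1/1) * emeasure lborel (A - cball x 1)"
    by (rule pot_far) (auto simp: dist_norm)
  also have "\<dots> \<le> emeasure lborel A" by (auto intro!: emeasure_mono)
  finally have 2: "pot (A - cball x 1) x \<le> emeasure lborel A" .
  have "pot A x = pot (A \<inter> cball x 1) x + pot (A - cball x 1) x"
    by (subst pot_Un[symmetric]) (auto simp: Int_Diff_Un)
  with add_mono[OF 1 2] show ?thesis by simp
qed

lemma pot_finite:
  "A \<in> sets borel \<Longrightarrow> emeasure lborel A < \<infinity> \<Longrightarrow> pot A x < \<infinity>"
  using pot_le[of A x] by (auto intro: le_less_trans)

subsection \<open>Positive definiteness of the Coulomb kernel\<close>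

definition coul :: "R3 set \<Rightarrow> R3 set \<Rightarrow> ennreal" where
  "coul A B = (\<integral>\<^sup>+x. indicator A x * pot B x \<partial>lborel)"

text \<open>Densities are needed in addition to sets because positive definiteness is applied to a
  set plus a multiple of a test charge.\<close>

definition coul_fun :: "(R3 \<Rightarrow> ennreal) \<Rightarrow> (R3 \<Rightarrow> ennreal) \<Rightarrow> ennreal" where
  "coul_fun f g = (\<integral>\<^sup>+x. \<integral>\<^sup>+y. f x * g y * ennreal (1 / norm (x - y)) \<partial>lborel \<partial>lborel)"

text \<open>Read from right to left, this writes 1/s as a superposition of Gaussians in s.\<close>

lemma gaussian_half_line:
  assumes s: "s > 0"
  shows "(\<integral>\<^sup>+u. indicator {0..} u * ennreal (exp (- (u\<^sup>2 * s\<^sup>2))) \<partial>lborel) = ennreal (sqrt pi / (2 * s))"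
proof -
  have "(\<integral>\<^sup>+u. ennreal (indicator {0..} u *\<^sub>R exp (- u\<^sup>2)) \<partial>lborel) = ennreal (sqrt pi / 2)"
    using gaussian_moment_0 by (subst nn_integral_eq_integral) (auto simp: has_bochner_integral_iff)
  moreover have "ennreal (indicator {0..} u *\<^sub>R exp (- u\<^sup>2)) = indicator {0..} u * ennreal (exp (- u\<^sup>2))" for u :: real
    by (simp split: split_indicator)
  ultimately have "ennreal (sqrt pi / 2) = (\<integral>\<^sup>+u. indicator {0..} u * ennreal (exp (- u\<^sup>2)) \<partial>lborel)"
    by simp
  also have "\<dots> = ennreal \<bar>s\<bar> * (\<integral>\<^sup>+u. indicator {0..} (0 + s * u) * ennreal (exp (- (0 + s * u)\<^sup>2)) \<partial>lborel)"
    using s by (subst nn_integral_real_affine[where c=s and t=0]) auto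
  also have "(\<integral>\<^sup>+u. indicator {0..} (0 + s * u) * ennreal (exp (- (0 + s * u)\<^sup>2)) \<partial>lborel)
    = (\<integral>\<^sup>+u. indicator {0..} u * ennreal (exp (- (u\<^sup>2 * s\<^sup>2))) \<partial>lborel)"
    using s by (intro nn_integral_cong) (auto simp: indicator_def power_mult_distrib zero_le_mult_iff mult.commute)
  finally have *: "ennreal (sqrt pi / 2) = ennreal s * (\<integral>\<^sup>+u. indicator {0..} u * ennreal (exp (- (u\<^sup>2 * s\<^sup>2))) \<partial>lborel)"
    using s by simp
  have "ennreal (sqrt pi / (2 * s)) = ennreal (1/s) * ennreal (sqrt pi / 2)"
    using s by (simp add: ennreal_mult'[symmetric])
  also have "\<dots> = (ennreal (1/s) * ennreal s) * (\<integral>\<^sup>+u. indicator {0..} u * ennreal (exp (- (u\<^sup>2 * s\<^sup>2))) \<partial>lborel)"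
    unfolding * by (simp add: mult.assoc)
  also have "ennreal (1/s) * ennreal s = 1" using s by (simp add: ennreal_mult'[symmetric])
  finally show ?thesis by simp
qed

text \<open>Only positivity and finiteness are recorded, as the value is divided out in
  \<open>coulomb_kernel_rank_one\<close>.\<close>

lemma gaussian_R3:
  assumes a: "a > 0"
  shows "\<exists>j>0. (\<integral>\<^sup>+(z::R3). ennreal (exp (- (a * (norm z)\<^sup>2))) \<partial>lborel) = ennreal j"
proof -
  define \<sigma> where "\<sigma> = 1 / sqrt (2 * a)"
  have \<sigma>: "\<sigma> > 0" "2 * \<sigma>\<^sup>2 = 1 / a" using a by (auto simp: \<sigma>_def power_divide)
  define c where "c = sqrt (2 * pi * \<sigma>\<^sup>2)"
  have c: "c > 0" using \<sigma> by (simp add: c_def)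
  interpret prob_space "density lborel (normal_density 0 \<sigma>)"
    using \<sigma> by (intro prob_space_normal_density)
  have "1 = (\<integral>\<^sup>+x. ennreal (normal_density 0 \<sigma> x) \<partial>lborel)"
    using emeasure_space_1 by (simp add: emeasure_density)
  then have "ennreal c = ennreal c * (\<integral>\<^sup>+x. ennreal (normal_density 0 \<sigma> x) \<partial>lborel)" by simp
  also have "\<dots> = (\<integral>\<^sup>+x. ennreal c * ennreal (normal_density 0 \<sigma> x) \<partial>lborel)"
    by (subst nn_integral_cmult) auto
  also have "\<dots> = (\<integral>\<^sup>+x. ennreal (exp (- (a * x\<^sup>2))) \<partial>lborel)"
  proof (intro nn_integral_cong)
    fix x
    have "c * normal_density 0 \<sigma> x = exp (- (a * x\<^sup>2))"
      using c \<sigma> a unfolding normal_density_def c_def[symmetric] by simp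
    with c show "ennreal c * ennreal (normal_density 0 \<sigma> x) = ennreal (exp (- (a * x\<^sup>2)))"
      by (simp add: ennreal_mult'[symmetric])
  qed
  finally have 1: "(\<integral>\<^sup>+x. ennreal (exp (- (a * x\<^sup>2))) \<partial>lborel) = ennreal c" ..
  have "(\<integral>\<^sup>+(z::R3). ennreal (exp (- (a * (norm z)\<^sup>2))) \<partial>lborel)
    = (\<integral>\<^sup>+(z::R3). (\<Prod>b\<in>Basis. ennreal (exp (- (a * (z \<bullet> b)\<^sup>2)))) \<partial>lborel)"
  proof (intro nn_integral_cong)
    fix z :: R3
    have "(norm z)\<^sup>2 = (\<Sum>b\<in>Basis. (z \<bullet> b)\<^sup>2)"
      by (subst norm_eq_sqrt_inner, subst euclidean_inner) (simp add: sum_nonneg power2_eq_square)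
    then show "ennreal (exp (- (a * (norm z)\<^sup>2))) = (\<Prod>b\<in>Basis. ennreal (exp (- (a * (z \<bullet> b)\<^sup>2))))"
      by (simp add: prod_ennreal exp_sum[symmetric] sum_distrib_left sum_negf)
  qed
  also have "\<dots> = (\<Prod>b\<in>(Basis::R3 set). ennreal c)"
    by (subst nn_integral_lborel_prod) (auto simp: 1)
  also have "\<dots> = ennreal (c^3)" using c by (simp add: ennreal_power)
  finally show ?thesis using c by (intro exI[of _ "c^3"]) auto
qed

text \<open>A Gaussian in x - y is, up to a constant, a superposition over centres z of products of
  one function of x and the same function of y. Shifting z by the midpoint of x and y and using the
  parallelogram law separates x - y from z.\<close>

lemma gaussian_convolution:
  fixes x y :: R3
  assumes u: "u > 0"
  shows "(\<integral>\<^sup>+z. ennreal (exp (- (2 * u\<^sup>2 * (norm (x - z))\<^sup>2))) * ennreal (exp (- (2 * u\<^sup>2 * (norm (y - z))\<^sup>2))) \<partial>lborel)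
    = ennreal (exp (- (u\<^sup>2 * (norm (x - y))\<^sup>2))) * (\<integral>\<^sup>+(z::R3). ennreal (exp (- (4 * u\<^sup>2 * (norm z)\<^sup>2))) \<partial>lborel)"
proof -
  define m where "m = (1/2) *\<^sub>R (x + y)"
  have e: "2 * u\<^sup>2 * (norm (x - (m + z)))\<^sup>2 + 2 * u\<^sup>2 * (norm (y - (m + z)))\<^sup>2
      = u\<^sup>2 * (norm (x - y))\<^sup>2 + 4 * u\<^sup>2 * (norm z)\<^sup>2" for z
  proof -
    have "(norm (x - (m + z)))\<^sup>2 + (norm (y - (m + z)))\<^sup>2 = (norm (x - y))\<^sup>2 / 2 + 2 * (norm z)\<^sup>2"
      unfolding m_def power2_norm_eq_inner
      by (simp add: inner_simps inner_commute field_simps)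
    from arg_cong[OF this, of "\<lambda>t. 2 * u\<^sup>2 * t"] show ?thesis by (simp add: algebra_simps)
  qed
  have "(\<integral>\<^sup>+z. ennreal (exp (- (2 * u\<^sup>2 * (norm (x - z))\<^sup>2))) * ennreal (exp (- (2 * u\<^sup>2 * (norm (y - z))\<^sup>2))) \<partial>lborel)
    = (\<integral>\<^sup>+z. ennreal (exp (- (2 * u\<^sup>2 * (norm (x - (m + z)))\<^sup>2))) * ennreal (exp (- (2 * u\<^sup>2 * (norm (y - (m + z)))\<^sup>2))) \<partial>lborel)"
    by (rule nn_integral_lborel_shift[symmetric]) measurable
  also have "\<dots> = (\<integral>\<^sup>+(z::R3). ennreal (exp (- (u\<^sup>2 * (norm (x - y))\<^sup>2))) * ennreal (exp (- (4 * u\<^sup>2 * (norm z)\<^sup>2))) \<partial>lborel)"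
  proof (intro nn_integral_cong)
    fix z
    have "ennreal (exp (- (2 * u\<^sup>2 * (norm (x - (m + z)))\<^sup>2))) * ennreal (exp (- (2 * u\<^sup>2 * (norm (y - (m + z)))\<^sup>2)))
      = ennreal (exp (- (2 * u\<^sup>2 * (norm (x - (m + z)))\<^sup>2 + 2 * u\<^sup>2 * (norm (y - (m + z)))\<^sup>2)))"
      by (simp add: ennreal_mult'[symmetric] exp_add[symmetric])
    also have "\<dots> = ennreal (exp (- (u\<^sup>2 * (norm (x - y))\<^sup>2))) * ennreal (exp (- (4 * u\<^sup>2 * (norm z)\<^sup>2)))"
      unfolding e by (simp add: ennreal_mult'[symmetric] exp_add[symmetric])
    finally show "ennreal (exp (- (2 * u\<^sup>2 * (norm (x - (m + z)))\<^sup>2))) * ennreal (exp (- (2 * u\<^sup>2 * (norm (y - (m + z)))\<^sup>2)))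
      = ennreal (exp (- (u\<^sup>2 * (norm (x - y))\<^sup>2))) * ennreal (exp (- (4 * u\<^sup>2 * (norm z)\<^sup>2)))" .
  qed
  also have "\<dots> = ennreal (exp (- (u\<^sup>2 * (norm (x - y))\<^sup>2))) * (\<integral>\<^sup>+(z::R3). ennreal (exp (- (4 * u\<^sup>2 * (norm z)\<^sup>2))) \<partial>lborel)"
    by (rule nn_integral_cmult) measurable
  finally show ?thesis .
qed

text \<open>Writing the kernel as an integral of rank-one kernels makes its quadratic form an integral of squares.\<close>

lemma coulomb_kernel_rank_one:
  "\<exists>(k :: real \<times> R3 \<Rightarrow> ennreal) (h :: real \<times> R3 \<Rightarrow> R3 \<Rightarrow> ennreal).
    k \<in> borel_measurable borel \<and> case_prod h \<in> borel_measurable borel \<and>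
    (\<forall>x y. x \<noteq> y \<longrightarrow> ennreal (1 / norm (x - y)) = (\<integral>\<^sup>+w. k w * h w x * h w y \<partial>lborel))"
proof -
  define J where "J u = (\<integral>\<^sup>+(z::R3). ennreal (exp (- (4 * u\<^sup>2 * (norm z)\<^sup>2))) \<partial>lborel)" for u :: real
  have [measurable]: "J \<in> borel_measurable borel" unfolding J_def by measurable
  \<comment> \<open>The parameter w consists of an inverse width and a centre. The weight divides by
    the Gaussian integral that the convolution produces.\<close>
  define k where "k = (\<lambda>w::real\<times>R3. ennreal (2 / sqrt pi) * indicator {0<..} (fst w) * inverse (J (fst w)))"
  define h where "h = (\<lambda>(w::real\<times>R3) x. ennreal (exp (- (2 * (fst w)\<^sup>2 * (norm (x - snd w))\<^sup>2))))"
  have km [measurable]: "k \<in> borel_measurable borel"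
    unfolding k_def by (simp add: borel_prod[symmetric])
  have hm [measurable]: "case_prod h \<in> borel_measurable borel"
    unfolding h_def case_prod_beta
    by (rule measurable_compose[OF _ measurable_ennreal], rule borel_measurable_continuous_onI)
       (intro continuous_intros)
  have "ennreal (1 / norm (x - y)) = (\<integral>\<^sup>+w. k w * h w x * h w y \<partial>lborel)" if "x \<noteq> y" for x y
  proof -
    have s: "norm (x - y) > 0" using that by simp
    have [measurable]: "(\<lambda>w. k w * h w x * h w y) \<in> borel_measurable (borel \<Otimes>\<^sub>M borel)"
      unfolding borel_prod using km measurable_compose[OF _ hm, of "\<lambda>w. (w, x)" borel] measurable_compose[OF _ hm, of "\<lambda>w. (w, y)" borel]
      by (simp add: borel_measurable_continuous_onI continuous_intros)
    have "(\<integral>\<^sup>+w. k w * h w x * h w y \<partial>lborel) = (\<integral>\<^sup>+u. \<integral>\<^sup>+z. k (u,z) * h (u,z) x * h (u,z) y \<partial>lborel \<partial>lborel)"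
      unfolding lborel_prod[symmetric] by (subst lborel.nn_integral_fst[symmetric]) simp_all
    also have "\<dots> = (\<integral>\<^sup>+u. ennreal (2 / sqrt pi) * (indicator {0<..} u * ennreal (exp (- (u\<^sup>2 * (norm (x - y))\<^sup>2)))) \<partial>lborel)"
    proof (intro nn_integral_cong)
      fix u :: real
      show "(\<integral>\<^sup>+z. k (u,z) * h (u,z) x * h (u,z) y \<partial>lborel)
        = ennreal (2 / sqrt pi) * (indicator {0<..} u * ennreal (exp (- (u\<^sup>2 * (norm (x - y))\<^sup>2))))"
      proof (cases "u > 0")
        case True
        then obtain j where j: "j > 0" "J u = ennreal j" using gaussian_R3[of "4 * u\<^sup>2"] by (auto simp: J_def)
        have "(\<integral>\<^sup>+z. k (u,z) * h (u,z) x * h (u,z) y \<partial>lborel) = ennreal (2 / sqrt pi) * inverse (J u) *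
          (\<integral>\<^sup>+z. ennreal (exp (- (2 * u\<^sup>2 * (norm (x - z))\<^sup>2))) * ennreal (exp (- (2 * u\<^sup>2 * (norm (y - z))\<^sup>2))) \<partial>lborel)"
          using True by (subst nn_integral_cmult[symmetric]) (auto simp: k_def h_def mult_ac)
        also have "\<dots> = ennreal (2 / sqrt pi) * (inverse (J u) * J u) * ennreal (exp (- (u\<^sup>2 * (norm (x - y))\<^sup>2)))"
          unfolding gaussian_convolution[OF True] J_def[symmetric] by (simp add: mult_ac)
        also have "inverse (J u) * J u = 1"
          using j by (simp add: inverse_ennreal ennreal_mult'[symmetric])
        finally show ?thesis using True by simp
      next
        case False
        then show ?thesis by (simp add: k_def)
      qed
    qed
    also have "\<dots> = ennreal (2 / sqrt pi) * (\<integral>\<^sup>+u. indicator {0<..} u * ennreal (exp (- (u\<^sup>2 * (norm (x - y))\<^sup>2))) \<partial>lborel)"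
      by (rule nn_integral_cmult) measurable
    also have "(\<integral>\<^sup>+u. indicator {0<..} u * ennreal (exp (- (u\<^sup>2 * (norm (x - y))\<^sup>2))) \<partial>lborel)
      = (\<integral>\<^sup>+u. indicator {0..} u * ennreal (exp (- (u\<^sup>2 * (norm (x - y))\<^sup>2))) \<partial>lborel)"
      by (rule nn_integral_cong_AE, rule AE_mp[OF AE_lborel_singleton[of 0]]) (auto split: split_indicator)
    also have "\<dots> = ennreal (sqrt pi / (2 * norm (x - y)))" by (rule gaussian_half_line[OF s])
    also have "ennreal (2 / sqrt pi) * \<dots> = ennreal (1 / norm (x - y))"
      using s by (simp add: ennreal_mult'[symmetric] field_simps)
    finally show ?thesis ..
  qed
  then show ?thesis using km hm by blast
qed

lemma ennreal_two_mult_le: "2 * (a * b) \<le> a * a + b * (b::ennreal)"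
proof (cases "a = \<infinity> \<or> b = \<infinity>")
  case True
  then show ?thesis by (auto simp: ennreal_top_mult)
next
  case False
  then obtain r s where rs: "a = ennreal r" "b = ennreal s" "r \<ge> 0" "s \<ge> 0"
    by (cases a; cases b) auto
  have "2 * (r * s) \<le> r * r + s * s"
    using sum_squares_bound[of r s] by (simp add: power2_eq_square)
  then have "ennreal (2 * (r * s)) \<le> ennreal (r * r + s * s)" by (rule ennreal_leI)
  then show ?thesis using rs by (simp add: ennreal_mult)
qed

text \<open>This is nonnegativity of the quadratic form at f - g, with the mixed terms moved to the
  other side since the values are extended nonnegative numbers.\<close>

lemma coul_fun_pos_def:
  assumes [measurable]: "f \<in> borel_measurable borel" "g \<in> borel_measurable borel"
  shows "2 * coul_fun f g \<le> coul_fun f f + coul_fun g g"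
proof -
  obtain k :: "real \<times> R3 \<Rightarrow> ennreal" and h :: "real \<times> R3 \<Rightarrow> R3 \<Rightarrow> ennreal"
    where km [measurable]: "k \<in> borel_measurable borel" and hm: "case_prod h \<in> borel_measurable borel"
    and K: "\<And>x y. x \<noteq> y \<Longrightarrow> ennreal (1 / norm (x - y)) = (\<integral>\<^sup>+w. k w * h w x * h w y \<partial>lborel)"
    using coulomb_kernel_rank_one by blast
  have hm' [measurable]: "(\<lambda>(w,x). h w x) \<in> borel_measurable (borel \<Otimes>\<^sub>M borel)"
    using hm by (simp add: borel_prod)
  define T where "T f w = (\<integral>\<^sup>+x. f x * h w x \<partial>lborel)" for f w
  have Tm [measurable]: "T f \<in> borel_measurable borel" if [measurable]: "f \<in> borel_measurable borel" for f
    unfolding T_def by measurable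
  \<comment> \<open>In the rank-one representation the form is a weighted L2 product of
    \<open>T f\<close> and \<open>T g\<close>, so the claim reduces to 2 a b <= a^2 + b^2 pointwise
    in w.\<close>
  have rep: "coul_fun f g = (\<integral>\<^sup>+w. k w * (T f w * T g w) \<partial>lborel)"
    if [measurable]: "f \<in> borel_measurable borel" "g \<in> borel_measurable borel" for f g
  proof -
    have "coul_fun f g = (\<integral>\<^sup>+x. \<integral>\<^sup>+y. \<integral>\<^sup>+w. f x * g y * (k w * h w x * h w y) \<partial>lborel \<partial>lborel \<partial>lborel)"
      unfolding coul_fun_def
    proof (rule nn_integral_cong, rule nn_integral_cong_AE)
      fix x :: R3
      show "AE y in lborel. f x * g y * ennreal (1 / norm (x - y)) = (\<integral>\<^sup>+w. f x * g y * (k w * h w x * h w y) \<partial>lborel)"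
        by (rule AE_mp[OF AE_lborel_singleton[of x]]) (auto simp: K nn_integral_cmult)
    qed
    also have "\<dots> = (\<integral>\<^sup>+x. \<integral>\<^sup>+w. \<integral>\<^sup>+y. f x * g y * (k w * h w x * h w y) \<partial>lborel \<partial>lborel \<partial>lborel)"
      by (intro nn_integral_cong, rule lborel_pair.Fubini') measurable
    also have "\<dots> = (\<integral>\<^sup>+x. \<integral>\<^sup>+w. (f x * h w x) * (k w * T g w) \<partial>lborel \<partial>lborel)"
      unfolding T_def by (intro nn_integral_cong) (simp add: nn_integral_cmult[symmetric] mult_ac)
    also have "\<dots> = (\<integral>\<^sup>+w. \<integral>\<^sup>+x. (f x * h w x) * (k w * T g w) \<partial>lborel \<partial>lborel)"
      by (rule lborel_pair.Fubini') measurable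
    also have "\<dots> = (\<integral>\<^sup>+w. k w * (T f w * T g w) \<partial>lborel)"
      unfolding T_def[of f] by (intro nn_integral_cong) (simp add: nn_integral_cmult[symmetric] mult_ac)
    finally show ?thesis .
  qed
  have "2 * coul_fun f g = (\<integral>\<^sup>+w. k w * (2 * (T f w * T g w)) \<partial>lborel)"
    unfolding rep[OF assms] by (subst nn_integral_cmult[symmetric]) (auto intro!: nn_integral_cong simp: mult_ac)
  also have "\<dots> \<le> (\<integral>\<^sup>+w. k w * (T f w * T f w + T g w * T g w) \<partial>lborel)"
    by (intro nn_integral_mono mult_left_mono ennreal_two_mult_le) auto
  also have "\<dots> = coul_fun f f + coul_fun g g"
    unfolding rep[OF assms(1) assms(1)] rep[OF assms(2) assms(2)]
    by (subst nn_integral_add[symmetric]) (auto simp: distrib_left)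
  finally show ?thesis .
qed

lemma coul_fun_indicator:
  assumes [measurable]: "A \<in> sets borel" "B \<in> sets borel"
  shows "coul_fun (indicator A) (indicator B) = coul A B"
  unfolding coul_fun_def coul_def pot_def
  by (intro nn_integral_cong) (simp add: nn_integral_cmult[symmetric] mult.assoc)

lemma coul_fun_sym:
  assumes [measurable]: "f \<in> borel_measurable borel" "g \<in> borel_measurable borel"
  shows "coul_fun f g = coul_fun g f"
  unfolding coul_fun_def
  by (subst lborel_pair.Fubini') (auto intro!: nn_integral_cong simp: mult_ac norm_minus_commute)

lemma coul_sym: "A \<in> sets borel \<Longrightarrow> B \<in> sets borel \<Longrightarrow> coul A B = coul B A"
  by (subst (1 2) coul_fun_indicator[symmetric]) (auto intro: coul_fun_sym)

lemma coul_fun_add_right: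
  assumes [measurable]: "f \<in> borel_measurable borel" "g \<in> borel_measurable borel" "h \<in> borel_measurable borel"
  shows "coul_fun f (\<lambda>x. g x + c * h x) = coul_fun f g + c * coul_fun f h"
proof -
  have "coul_fun f (\<lambda>x. g x + c * h x) = (\<integral>\<^sup>+x. (\<integral>\<^sup>+y. f x * g y * ennreal (1 / norm (x - y)) \<partial>lborel)
      + c * (\<integral>\<^sup>+y. f x * h y * ennreal (1 / norm (x - y)) \<partial>lborel) \<partial>lborel)"
    unfolding coul_fun_def
    by (intro nn_integral_cong) (simp add: nn_integral_cmult[symmetric] nn_integral_add[symmetric] algebra_simps)
  also have "\<dots> = coul_fun f g + c * coul_fun f h"
    unfolding coul_fun_def by (subst nn_integral_add) (auto simp: nn_integral_cmult)
  finally show ?thesis .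
qed

text \<open>Nonnegativity of the energy of the signed charge A - B - c T. The set T is a test charge
  that probes the difference of A and B.\<close>

lemma coul_pos_def:
  assumes [measurable]: "A \<in> sets borel" "B \<in> sets borel" "T \<in> sets borel"
  shows "2 * (coul A B + c * coul A T) \<le> coul A A + (coul B B + 2 * c * coul B T + c * c * coul T T)"
proof -
  let ?g = "\<lambda>x. indicator B x + c * indicator T x :: ennreal"
  have gg: "coul_fun ?g ?g = coul B B + 2 * c * coul B T + c * c * coul T T"
    by (simp add: coul_fun_add_right coul_fun_indicator coul_fun_sym[of ?g] coul_sym[of T B] algebra_simps
      mult_2[symmetric] del: mult_2)
  show ?thesis
    using coul_fun_pos_def[of "indicator A" ?g] unfolding gg
    by (simp add: coul_fun_add_right coul_fun_indicator)
qed

subsection \<open>Perimeter\<close>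

lemma C1c_field_derivative:
  "C1c_field \<phi> \<Longrightarrow> (\<phi> has_derivative frechet_derivative \<phi> (at x)) (at x)"
  by (simp add: C1c_field_def frechet_derivative_works[symmetric])

text \<open>\<open>frechet_derivative\<close> is a choice operator; this rule lets an explicit
  derivative take its place.\<close>

lemma C1c_fieldI:
  assumes "\<And>x. (\<phi> has_derivative D x) (at x)"
    and "\<And>i j. continuous_on UNIV (\<lambda>x. D x (axis j 1) $ i)"
    and "compact (closure {x. \<phi> x \<noteq> 0})"
  shows "C1c_field \<phi>" "divergence \<phi> x = (\<Sum>i\<in>UNIV. D x (axis i 1) $ i)"
proof -
  have "frechet_derivative \<phi> (at x) = D x" for x
    using assms(1) frechet_derivative_at by metis
  with assms show "C1c_field \<phi>" "divergence \<phi> x = (\<Sum>i\<in>UNIV. D x (axis i 1) $ i)"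
    by (auto simp: C1c_field_def divergence_def differentiable_def)
qed

lemma C1c_field_continuous_partial:
  "C1c_field \<phi> \<Longrightarrow> continuous_on UNIV (\<lambda>x. frechet_derivative \<phi> (at x) (axis j 1) $ i)"
  by (simp add: C1c_field_def)

lemma C1c_field_continuous: "C1c_field \<phi> \<Longrightarrow> continuous_on UNIV \<phi>"
  by (auto simp: C1c_field_def intro!: differentiable_imp_continuous_on differentiable_at_imp_differentiable_on)

lemma C1c_field_support:
  assumes "C1c_field \<phi>" obtains r where "r > 0" "\<And>x. norm x > r \<Longrightarrow> \<phi> x = 0"
proof -
  have "bounded (closure {x. \<phi> x \<noteq> 0})" using assms by (simp add: C1c_field_def compact_imp_bounded)
  then obtain r where r: "r > 0" "\<And>x. x \<in> closure {x. \<phi> x \<noteq> 0} \<Longrightarrow> norm x \<le> r"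
    by (auto simp: bounded_pos)
  show ?thesis
  proof (rule that[OF r(1)], rule ccontr)
    fix x assume "r < norm x" "\<phi> x \<noteq> 0"
    with r(2)[of x] closure_subset[of "{x. \<phi> x \<noteq> 0}"] show False by auto
  qed
qed

lemma compact_closure_boundedI:
  fixes \<phi> :: "R3 \<Rightarrow> R3"
  assumes "\<And>x. norm x > r \<Longrightarrow> \<phi> x = 0" shows "compact (closure {x. \<phi> x \<noteq> 0})"
proof -
  have "{x. \<phi> x \<noteq> 0} \<subseteq> cball 0 r" using assms by (auto simp: not_less[symmetric])
  then show ?thesis using bounded_subset[OF bounded_cball] by (simp add: compact_closure)
qed

lemma C1c_field_derivative_zero:
  assumes \<phi>: "C1c_field \<phi>" and r: "\<And>x. norm x > r \<Longrightarrow> \<phi> x = 0" and x: "norm x > r"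
  shows "frechet_derivative \<phi> (at x) = (\<lambda>h. 0)"
proof -
  have "((\<lambda>x. 0) has_derivative (\<lambda>h. 0)) (at x)" by simp
  then have "(\<phi> has_derivative (\<lambda>h. 0)) (at x)"
  proof (rule has_derivative_transform_within_open)
    show "open {x. norm x > r}" by (intro open_Collect_less continuous_intros)
  qed (use r x in auto)
  then show ?thesis using frechet_derivative_at by metis
qed

lemma continuous_divergence: "C1c_field \<phi> \<Longrightarrow> continuous_on UNIV (divergence \<phi>)"
  unfolding divergence_def by (intro continuous_on_sum C1c_field_continuous_partial)

lemma divergence_measurable [measurable (raw)]: "C1c_field \<phi> \<Longrightarrow> divergence \<phi> \<in> borel_measurable borel"
  by (intro borel_measurable_continuous_onI continuous_divergence)

lemma integrable_continuous_bounded_support: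
  fixes f :: "R3 \<Rightarrow> real"
  assumes "continuous_on UNIV f" "\<And>x. norm x > r \<Longrightarrow> f x = 0"
  shows "integrable lborel f"
proof -
  have "integrable lborel (\<lambda>x. indicator (cball 0 r) x *\<^sub>R f x)"
    using assms by (intro borel_integrable_compact) (auto intro: continuous_on_subset)
  also have "(\<lambda>x. indicator (cball 0 r) x *\<^sub>R f x) = f"
    using assms(2) by (auto simp: fun_eq_iff indicator_def)
  finally show ?thesis .
qed

lemma integrable_divergence:
  assumes "C1c_field \<phi>" shows "integrable lborel (divergence \<phi>)"
proof -
  obtain r where "\<And>x. norm x > r \<Longrightarrow> \<phi> x = 0" using C1c_field_support[OF assms] by metis
  then have "divergence \<phi> x = 0" if "norm x > r" for x
    using C1c_field_derivative_zero[OF assms _ that] by (simp add: divergence_def)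
  then show ?thesis
    using assms by (intro integrable_continuous_bounded_support[where r=r] continuous_divergence)
qed

lemma set_integrable_divergence:
  "C1c_field \<phi> \<Longrightarrow> A \<in> sets borel \<Longrightarrow> set_integrable lborel A (divergence \<phi>)"
  unfolding set_integrable_def by (intro integrable_mult_indicator integrable_divergence) auto

lemma C1c_field_add:
  assumes "C1c_field \<phi>" "C1c_field \<psi>"
  shows "C1c_field (\<lambda>x. \<phi> x + \<psi> x)" "divergence (\<lambda>x. \<phi> x + \<psi> x) x = divergence \<phi> x + divergence \<psi> x"
proof -
  obtain r s where r: "\<And>x. norm x > r \<Longrightarrow> \<phi> x = 0" and s: "\<And>x. norm x > s \<Longrightarrow> \<psi> x = 0"
    using assms[THEN C1c_field_support] by metis
  note I = C1c_fieldI[of "\<lambda>x. \<phi> x + \<psi> x" "\<lambda>x h. frechet_derivative \<phi> (at x) h + frechet_derivative \<psi> (at x) h"]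
  have 1: "((\<lambda>x. \<phi> x + \<psi> x) has_derivative (\<lambda>h. frechet_derivative \<phi> (at x) h + frechet_derivative \<psi> (at x) h)) (at x)" for x
    by (intro has_derivative_add C1c_field_derivative assms)
  have 2: "continuous_on UNIV (\<lambda>x. (frechet_derivative \<phi> (at x) (axis j 1) + frechet_derivative \<psi> (at x) (axis j 1)) $ i)" for i j
    using assms by (simp, intro continuous_on_add C1c_field_continuous_partial)
  have 3: "compact (closure {x. \<phi> x + \<psi> x \<noteq> 0})"
    by (rule compact_closure_boundedI[where r="max r s"]) (simp add: r s)
  show "C1c_field (\<lambda>x. \<phi> x + \<psi> x)" by (rule I(1)[OF 1 2 3])
  show "divergence (\<lambda>x. \<phi> x + \<psi> x) x = divergence \<phi> x + divergence \<psi> x"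
    by (subst I(2)[OF 1 2 3]) (simp add: divergence_def sum.distrib)
qed

lemma C1c_field_scale:
  assumes \<phi>: "C1c_field \<phi>" and \<eta>: "\<And>x. (\<eta> has_derivative (\<lambda>h. g x \<bullet> h)) (at x)" and g: "continuous_on UNIV g"
  shows "C1c_field (\<lambda>x. \<eta> x *\<^sub>R \<phi> x)" "divergence (\<lambda>x. \<eta> x *\<^sub>R \<phi> x) x = \<eta> x * divergence \<phi> x + g x \<bullet> \<phi> x"
proof -
  obtain r where r: "\<And>x. norm x > r \<Longrightarrow> \<phi> x = 0" using C1c_field_support[OF \<phi>] by metis
  let ?D = "\<lambda>x h. \<eta> x *\<^sub>R frechet_derivative \<phi> (at x) h + (g x \<bullet> h) *\<^sub>R \<phi> x"
  note I = C1c_fieldI[of "\<lambda>x. \<eta> x *\<^sub>R \<phi> x" ?D]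
  have c\<eta>: "continuous_on UNIV \<eta>"
    using \<eta> by (intro has_derivative_continuous_on) auto
  have 1: "((\<lambda>x. \<eta> x *\<^sub>R \<phi> x) has_derivative ?D x) (at x)" for x
    by (rule has_derivative_eq_rhs[OF has_derivative_scaleR[OF \<eta> C1c_field_derivative[OF \<phi>]]]) (simp add: fun_eq_iff)
  have 2: "continuous_on UNIV (\<lambda>x. ?D x (axis j 1) $ i)" for i j
  proof -
    have "continuous_on UNIV (\<lambda>x. g x $ j)" "continuous_on UNIV (\<lambda>x. \<phi> x $ i)"
      using g C1c_field_continuous[OF \<phi>] by (auto intro!: continuous_intros)
    with c\<eta> C1c_field_continuous_partial[OF \<phi>, of j i] show ?thesis
      by (simp add: inner_axis continuous_on_add continuous_on_mult)
  qed
  have 3: "compact (closure {x. \<eta> x *\<^sub>R \<phi> x \<noteq> 0})"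
    by (rule compact_closure_boundedI[where r=r]) (simp add: r)
  show "C1c_field (\<lambda>x. \<eta> x *\<^sub>R \<phi> x)" by (rule I(1)[OF 1 2 3])
  have "g x \<bullet> \<phi> x = (\<Sum>i\<in>UNIV. g x $ i * \<phi> x $ i)" by (simp add: inner_vec_def)
  then show "divergence (\<lambda>x. \<eta> x *\<^sub>R \<phi> x) x = \<eta> x * divergence \<phi> x + g x \<bullet> \<phi> x"
    by (subst I(2)[OF 1 2 3]) (simp add: divergence_def sum.distrib sum_distrib_left inner_axis)
qed

lemma C1c_field_zero: "C1c_field (\<lambda>x. 0)" "divergence (\<lambda>x. 0) x = 0"
proof -
  note I = C1c_fieldI[of "\<lambda>x. 0" "\<lambda>x h. 0"]
  show "C1c_field (\<lambda>x. 0)" by (rule I(1)) auto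
  show "divergence (\<lambda>x. 0) x = 0" by (subst I(2)) auto
qed

lemma C1c_field_shift:
  assumes \<phi>: "C1c_field \<phi>"
  shows "C1c_field (\<lambda>x. \<phi> (t + x))" "divergence (\<lambda>x. \<phi> (t + x)) x = divergence \<phi> (t + x)"
proof -
  obtain r where r: "\<And>x. norm x > r \<Longrightarrow> \<phi> x = 0" using C1c_field_support[OF \<phi>] by metis
  note I = C1c_fieldI[of "\<lambda>x. \<phi> (t + x)" "\<lambda>x. frechet_derivative \<phi> (at (t + x))"]
  have 1: "((\<lambda>x. \<phi> (t + x)) has_derivative frechet_derivative \<phi> (at (t + x))) (at x)" for x :: R3
  proof -
    have "((\<lambda>x. t + x) has_derivative (\<lambda>h. h)) (at x)" by (auto intro!: derivative_eq_intros)
    from has_derivative_compose[OF this C1c_field_derivative[OF \<phi>]] show ?thesis by simp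
  qed
  have 2: "continuous_on UNIV (\<lambda>x. frechet_derivative \<phi> (at (t + x)) (axis j 1) $ i)" for i j
    by (rule continuous_on_compose2[OF C1c_field_continuous_partial[OF \<phi>]]) (auto intro!: continuous_intros)
  have 3: "compact (closure {x. \<phi> (t + x) \<noteq> 0})"
  proof (rule compact_closure_boundedI[where r="r + norm t"], rule r)
    fix x :: R3 assume "norm x > r + norm t"
    then show "r < norm (t + x)" using norm_triangle_ineq4[of "t + x" t] by simp
  qed
  show "C1c_field (\<lambda>x. \<phi> (t + x))" by (rule I(1)[OF 1 2 3])
  show "divergence (\<lambda>x. \<phi> (t + x)) x = divergence \<phi> (t + x)"
    by (subst I(2)[OF 1 2 3]) (simp add: divergence_def)
qed

section \<open>Basic properties of the perimeter and gluing of test fields\<close>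

lemma perimeter_borel:
  assumes "A \<in> sets borel"
  shows "perimeter A = (SUP \<phi> \<in> {\<phi>. C1c_field \<phi> \<and> (\<forall>x. norm (\<phi> x) \<le> 1)}. ereal (LINT x:A|lborel. divergence \<phi> x))"
  unfolding perimeter_def set_lebesgue_integral_def using assms
  by (intro SUP_cong refl arg_cong[where f=ereal] integral_completion) auto

lemma perimeter_ge:
  "A \<in> sets borel \<Longrightarrow> C1c_field \<phi> \<Longrightarrow> (\<And>x. norm (\<phi> x) \<le> 1) \<Longrightarrow> ereal (LINT x:A|lborel. divergence \<phi> x) \<le> perimeter A"
  unfolding perimeter_borel by (intro SUP_upper) auto

lemma perimeter_leI:
  assumes "A \<in> sets borel" "\<And>\<phi>. C1c_field \<phi> \<Longrightarrow> (\<And>x. norm (\<phi> x) \<le> 1) \<Longrightarrow> ereal (LINT x:A|lborel. divergence \<phi> x) \<le> c"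
  shows "perimeter A \<le> c"
  using assms unfolding perimeter_borel[OF assms(1)] by (intro SUP_least) auto

lemma perimeter_nonneg: "0 \<le> perimeter A"
  unfolding perimeter_def
  by (rule SUP_upper2[of "\<lambda>x. 0"]) (auto simp: C1c_field_zero set_lebesgue_integral_def)

lemma perimeter_Un:
  assumes A: "A \<in> sets borel" "B \<in> sets borel" and d: "A \<inter> B = {}"
  shows "perimeter (A \<union> B) \<le> perimeter A + perimeter B"
proof (rule perimeter_leI)
  fix \<phi> assume \<phi>: "C1c_field \<phi>" "\<And>x. norm (\<phi> x) \<le> 1"
  have "(LINT x:A\<union>B|lborel. divergence \<phi> x) = (LINT x:A|lborel. divergence \<phi> x) + (LINT x:B|lborel. divergence \<phi> x)"
    by (intro set_integral_Un d set_integrable_divergence \<phi> A)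
  then show "ereal (LINT x:A\<union>B|lborel. divergence \<phi> x) \<le> perimeter A + perimeter B"
    using add_mono[OF perimeter_ge[OF A(1) \<phi>] perimeter_ge[OF A(2) \<phi>]] by simp
qed (use A in auto)

lemma plus_image_eq_vimage: "(+) t ` A = (\<lambda>x. x - t) -` (A :: 'a::ab_group_add set)"
  by (auto simp: image_iff algebra_simps) (metis add.commute diff_add_cancel)

lemma borel_translate:
  assumes [measurable]: "A \<in> sets borel" shows "(+) t ` (A :: R3 set) \<in> sets borel"
proof -
  have "(\<lambda>x. x - t) -` A \<inter> space borel \<in> sets borel" by measurable
  then show ?thesis by (simp add: plus_image_eq_vimage)
qed

text \<open>One inequality is enough because translated sets occur only in competitors, whose energy
  is estimated from above.\<close>

lemma perimeter_translate:
  assumes A: "A \<in> sets borel"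
  shows "perimeter ((+) t ` A) \<le> perimeter A"
proof (rule perimeter_leI[OF borel_translate[OF A]])
  fix \<phi> assume \<phi>: "C1c_field \<phi>" "\<And>x. norm (\<phi> x) \<le> 1"
  note A[measurable] borel_translate[OF A, of t, measurable] divergence_measurable[OF \<phi>(1), measurable]
  have "(LINT x:(+) t ` A|lborel. divergence \<phi> x)
     = (LINT x|distr lborel borel ((+) t). indicator ((+) t ` A) x *\<^sub>R divergence \<phi> x)"
    unfolding set_lebesgue_integral_def by (simp only: lborel_distr_plus)
  also have "\<dots> = (LINT x|lborel. indicator ((+) t ` A) (t + x) *\<^sub>R divergence \<phi> (t + x))"
    by (subst integral_distr) simp_all
  also have "\<dots> = (LINT x:A|lborel. divergence (\<lambda>x. \<phi> (t + x)) x)"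
    unfolding set_lebesgue_integral_def C1c_field_shift[OF \<phi>(1)]
    by (intro Bochner_Integration.integral_cong) (auto simp: indicator_def)
  also have "ereal \<dots> \<le> perimeter A"
    by (rule perimeter_ge[OF A]) (simp_all add: \<phi> C1c_field_shift)
  finally show "ereal (LINT x:(+) t ` A|lborel. divergence \<phi> x) \<le> perimeter A" .
qed

text \<open>A combination of two admissible fields with weights \<eta> and 1 - \<eta> is again
  admissible; its divergence gains the term g x . (\<phi> x - \<psi> x), which b dominates. It is
  applied with \<eta> switching across a plane, and with \<psi> = 0 and \<eta> switching across a
  sphere.\<close>

lemma perimeter_cutoff:
  assumes A [measurable]: "A \<in> sets borel"
    and \<phi>: "C1c_field \<phi>" "\<And>x. norm (\<phi> x) \<le> 1" and \<psi>: "C1c_field \<psi>" "\<And>x. norm (\<psi> x) \<le> 1"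
    and \<eta>: "\<And>x. (\<eta> has_derivative (\<lambda>h. g x \<bullet> h)) (at x)" and g: "continuous_on UNIV g"
    and \<eta>01: "\<And>x. 0 \<le> \<eta> x" "\<And>x. \<eta> x \<le> 1"
    and gi: "set_integrable lborel A b" and gb: "\<And>x. norm (g x) * norm (\<phi> x - \<psi> x) \<le> b x"
  shows "ereal (LINT x:A|lborel. \<eta> x * divergence \<phi> x + (1 - \<eta> x) * divergence \<psi> x) \<le> perimeter A + ereal (LINT x:A|lborel. b x)"
proof -
  have \<eta>': "((\<lambda>x. 1 - \<eta> x) has_derivative (\<lambda>h. (- g x) \<bullet> h)) (at x)" for x
    using \<eta>[of x] by (auto intro!: derivative_eq_intros)
  have g': "continuous_on UNIV (\<lambda>x. - g x)" using g by (intro continuous_intros)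
  define \<theta> where "\<theta> x = \<eta> x *\<^sub>R \<phi> x + (1 - \<eta> x) *\<^sub>R \<psi> x" for x
  have \<theta>: "C1c_field \<theta>"
    unfolding \<theta>_def by (intro C1c_field_add C1c_field_scale[OF \<phi>(1) \<eta> g] C1c_field_scale[OF \<psi>(1) \<eta>' g'])
  have div: "divergence \<theta> x = (\<eta> x * divergence \<phi> x + (1 - \<eta> x) * divergence \<psi> x) + g x \<bullet> (\<phi> x - \<psi> x)" for x
    unfolding \<theta>_def C1c_field_add(2)[OF C1c_field_scale(1)[OF \<phi>(1) \<eta> g] C1c_field_scale(1)[OF \<psi>(1) \<eta>' g']]
      C1c_field_scale(2)[OF \<phi>(1) \<eta> g] C1c_field_scale(2)[OF \<psi>(1) \<eta>' g']
    by (simp add: inner_diff_right)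
  have "norm (\<theta> x) \<le> 1" for x
  proof -
    have "norm (\<theta> x) \<le> \<eta> x * norm (\<phi> x) + (1 - \<eta> x) * norm (\<psi> x)"
      unfolding \<theta>_def using \<eta>01[of x] by (intro norm_triangle_le) simp
    also have "\<dots> \<le> \<eta> x * 1 + (1 - \<eta> x) * 1"
      using \<eta>01[of x] \<phi>(2)[of x] \<psi>(2)[of x] by (intro add_mono mult_left_mono) auto
    finally show ?thesis by simp
  qed
  then have P: "ereal (LINT x:A|lborel. divergence \<theta> x) \<le> perimeter A"
    by (intro perimeter_ge A \<theta>)
  have I: "set_integrable lborel A (\<lambda>x. divergence \<theta> x + b x)"
    by (intro set_integral_add set_integrable_divergence \<theta> gi A)
  have le: "\<eta> x * divergence \<phi> x + (1 - \<eta> x) * divergence \<psi> x \<le> divergence \<theta> x + b x" for x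
    using div[of x] gb[of x] norm_cauchy_schwarz[of "- g x" "\<phi> x - \<psi> x"] by simp
  obtain r where r: "\<And>x. norm x > r \<Longrightarrow> divergence \<phi> x = 0" "\<And>x. norm x > r \<Longrightarrow> divergence \<psi> x = 0"
  proof -
    obtain r s where r: "\<And>x. norm x > r \<Longrightarrow> \<phi> x = 0" and s: "\<And>x. norm x > s \<Longrightarrow> \<psi> x = 0"
      using \<phi>(1) \<psi>(1) C1c_field_support by metis
    show ?thesis
      by (rule that[of "max r s"])
        (simp_all add: divergence_def C1c_field_derivative_zero[OF \<phi>(1) r] C1c_field_derivative_zero[OF \<psi>(1) s])
  qed
  have c\<eta>: "continuous_on UNIV \<eta>"
    using \<eta> by (intro has_derivative_continuous_on) auto
  have J: "integrable lborel (\<lambda>x. \<eta> x * divergence \<phi> x + (1 - \<eta> x) * divergence \<psi> x)"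
    by (rule integrable_continuous_bounded_support[where r=r])
       (use r in \<open>auto intro!: continuous_intros c\<eta> continuous_divergence \<phi> \<psi>\<close>)
  have "(LINT x:A|lborel. \<eta> x * divergence \<phi> x + (1 - \<eta> x) * divergence \<psi> x) \<le> (LINT x:A|lborel. divergence \<theta> x + b x)"
    by (intro set_integral_mono I le)
       (auto simp: set_integrable_def intro: integrable_mult_indicator[OF _ J, of A, simplified])
  also have "\<dots> = (LINT x:A|lborel. divergence \<theta> x) + (LINT x:A|lborel. b x)"
    by (intro set_integral_add set_integrable_divergence \<theta> gi A)
  finally have "ereal (LINT x:A|lborel. \<eta> x * divergence \<phi> x + (1 - \<eta> x) * divergence \<psi> x)
     \<le> ereal (LINT x:A|lborel. divergence \<theta> x) + ereal (LINT x:A|lborel. b x)" by simp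
  also have "\<dots> \<le> perimeter A + ereal (LINT x:A|lborel. b x)"
    using P by (intro add_right_mono)
  finally show ?thesis .
qed

lemma DERIV_max_square: "((\<lambda>s. (max 0 s)\<^sup>2) has_real_derivative 2 * max 0 s) (at s)"
proof (cases s "0::real" rule: linorder_cases)
  case less
  have "((\<lambda>s. 0) has_real_derivative 2 * max 0 s) (at s)" using less by simp
  then show ?thesis
    by (rule DERIV_cong_ev[THEN iffD1, rotated -1])
       (use less in \<open>auto intro!: eventually_mono[OF eventually_nhds_in_open[of "{..<0}"]]\<close>)
next
  case greater
  have "((\<lambda>s. s\<^sup>2) has_real_derivative 2 * max 0 s) (at s)"
    using greater by (auto intro!: derivative_eq_intros)
  then show ?thesis
    by (rule DERIV_cong_ev[THEN iffD1, rotated -1])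
       (use greater in \<open>auto intro!: eventually_mono[OF eventually_nhds_in_open[of "{0<..}"]]\<close>)
next
  case equal
  have "((\<lambda>h. (max 0 h)\<^sup>2 / h) \<longlongrightarrow> 0) (at (0::real))"
  proof (rule Lim_null_comparison)
    show "\<forall>\<^sub>F h in at (0::real). norm ((max 0 h)\<^sup>2 / h) \<le> \<bar>h\<bar>"
      by (intro always_eventually) (auto simp: max_def power2_eq_square)
    show "((\<lambda>h. \<bar>h\<bar>) \<longlongrightarrow> 0) (at (0::real))" by (intro tendsto_eq_intros) auto
  qed
  then show ?thesis using equal by (simp add: DERIV_def)
qed

text \<open>A transition from 0 to 1 on [0, 1] made of two parabolic arcs meeting at 1/2. It is
  continuously differentiable, as test fields must be, and its slope is at most 2.\<close>

definition ramp :: "real \<Rightarrow> real" where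
  "ramp s = 2 * (max 0 s)\<^sup>2 - 4 * (max 0 (s - 1/2))\<^sup>2 + 2 * (max 0 (s - 1))\<^sup>2"

definition ramp' :: "real \<Rightarrow> real" where
  "ramp' s = 4 * max 0 s - 8 * max 0 (s - 1/2) + 4 * max 0 (s - 1)"

lemma DERIV_ramp: "(ramp has_real_derivative ramp' s) (at s)"
proof -
  have 1: "((\<lambda>s. (max 0 (s - c))\<^sup>2) has_real_derivative 2 * max 0 (s - c)) (at s)" for c
  proof -
    have "((\<lambda>s. s - c) has_real_derivative 1) (at s)" by (auto intro!: derivative_eq_intros)
    from DERIV_chain2[OF DERIV_max_square this] show ?thesis by simp
  qed
  show ?thesis
    unfolding ramp_def ramp'_def
    by (rule derivative_eq_intros DERIV_max_square 1 refl)+ simp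
qed

lemma ramp'_bounds: "0 \<le> ramp' s" "ramp' s \<le> 2" "s \<le> 0 \<Longrightarrow> ramp' s = 0" "1 \<le> s \<Longrightarrow> ramp' s = 0"
  by (auto simp: ramp'_def max_def)

lemma ramp_simps: "s \<le> 0 \<Longrightarrow> ramp s = 0" "1 \<le> s \<Longrightarrow> ramp s = 1"
  by (auto simp: ramp_def max_def power2_eq_square algebra_simps)

lemma ramp_bounds: "0 \<le> ramp s" "ramp s \<le> 1"
proof -
  have mono: "ramp a \<le> ramp b" if "a \<le> b" for a b
    using that by (rule DERIV_nonneg_imp_nondecreasing) (use DERIV_ramp ramp'_bounds in blast)
  show "0 \<le> ramp s" using mono[of "min 0 s" s] ramp_simps(1)[of "min 0 s"] by simp
  show "ramp s \<le> 1" using mono[of s "max 1 s"] ramp_simps(2)[of "max 1 s"] by simp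
qed

lemma continuous_ramp' [continuous_intros]: "continuous_on S f \<Longrightarrow> continuous_on S (\<lambda>x. ramp' (f x))"
  unfolding ramp'_def by (intro continuous_intros)

lemma continuous_ramp: "continuous_on S f \<Longrightarrow> continuous_on S (\<lambda>x. ramp (f x))"
  unfolding ramp_def by (intro continuous_intros)

text \<open>Test fields on the two sides of a cut are chosen independently, so a bound for all pairs
  has to become a bound for the sum of the two suprema.\<close>

lemma SUP_add_SUP_le_ereal:
  fixes f g :: "'a \<Rightarrow> ereal"
  assumes "X \<noteq> {}" "\<And>a. a \<in> X \<Longrightarrow> f a \<noteq> -\<infinity>" "\<And>a. a \<in> X \<Longrightarrow> g a \<noteq> -\<infinity>"
    and "\<And>a b. a \<in> X \<Longrightarrow> b \<in> X \<Longrightarrow> f a + g b \<le> c"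
  shows "(SUP a\<in>X. f a) + (SUP b\<in>X. g b) \<le> c"
proof -
  obtain a where a: "a \<in> X" using assms(1) by auto
  have "(SUP b\<in>X. g b) \<noteq> -\<infinity>"
    using SUP_upper[OF a, of g] assms(3)[OF a] by auto
  then have "(SUP a\<in>X. f a) + (SUP b\<in>X. g b) = (SUP a\<in>X. f a + (SUP b\<in>X. g b))"
    by (intro SUP_ereal_add_left[symmetric] assms(1))
  also have "\<dots> \<le> c"
  proof (rule SUP_least)
    fix a assume a: "a \<in> X"
    have "f a + (SUP b\<in>X. g b) = (SUP b\<in>X. f a + g b)"
      by (intro SUP_ereal_add_right[symmetric] assms(1,2) a)
    also have "\<dots> \<le> c" using assms(4)[OF a] by (intro SUP_least)
    finally show "f a + (SUP b\<in>X. g b) \<le> c" .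
  qed
  finally show ?thesis .
qed

text \<open>The layer in which the n-th cutoff is not constant. Its intersection with a set has a
  volume which, multiplied by \<open>Suc n\<close>, stands in for the area of the plane
  section.\<close>

definition slab :: "R3 \<Rightarrow> real \<Rightarrow> nat \<Rightarrow> R3 set" where
  "slab \<nu> l n = {x. l < \<nu> \<bullet> x \<and> \<nu> \<bullet> x < l + 1 / Suc n}"

lemma slab_borel [measurable]: "slab \<nu> l n \<in> sets borel"
  unfolding slab_def by measurable

text \<open>Arbitrary test fields for the two pieces are glued across the plane by a cutoff. The
  gluing error lives on the slab, where it is at most \<open>Suc n\<close> times the slope 2 times
  norm (\<phi> x - \<psi> x) <= 2; this is the factor 4.\<close>

lemma perimeter_cut:
  assumes A [measurable]: "A \<in> sets borel" and fin: "emeasure lborel A < \<infinity>" and \<nu>: "norm \<nu> \<le> 1"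
  shows "perimeter (A \<inter> {x. l < \<nu> \<bullet> x}) + perimeter (A \<inter> {x. \<nu> \<bullet> x \<le> l})
    \<le> perimeter A + liminf (\<lambda>n. ereal (4 * (real (Suc n) * vol (A \<inter> slab \<nu> l n))))"
proof -
  let ?P = "A \<inter> {x. l < \<nu> \<bullet> x}" and ?M = "A \<inter> {x. \<nu> \<bullet> x \<le> l}"
  have m [measurable]: "?P \<in> sets borel" "?M \<in> sets borel" by measurable
  let ?X = "{\<phi>. C1c_field \<phi> \<and> (\<forall>x. norm (\<phi> x) \<le> 1)}"
  let ?s = "\<lambda>n. 4 * (real (Suc n) * vol (A \<inter> slab \<nu> l n))"
  have key: "ereal (LINT x:?P|lborel. divergence \<phi> x) + ereal (LINT x:?M|lborel. divergence \<psi> x)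
      \<le> perimeter A + liminf (\<lambda>n. ereal (?s n))" if "\<phi> \<in> ?X" "\<psi> \<in> ?X" for \<phi> \<psi>
  proof -
    have \<phi>: "C1c_field \<phi>" "\<And>x. norm (\<phi> x) \<le> 1" and \<psi>: "C1c_field \<psi>" "\<And>x. norm (\<psi> x) \<le> 1"
      using that by auto
    note [measurable] = divergence_measurable[OF \<phi>(1)] divergence_measurable[OF \<psi>(1)]
    define \<eta> where "\<eta> n x = ramp (real (Suc n) * (\<nu> \<bullet> x - l))" for n x
    define g where "g n x = (ramp' (real (Suc n) * (\<nu> \<bullet> x - l)) * real (Suc n)) *\<^sub>R \<nu>" for n x
    have D: "(\<eta> n has_derivative (\<lambda>h. g n x \<bullet> h)) (at x)" for n x
    proof -
      have "((\<lambda>x. real (Suc n) * (\<nu> \<bullet> x - l)) has_derivative (\<lambda>h. real (Suc n) * (\<nu> \<bullet> h))) (at x)"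
        by (auto intro!: derivative_eq_intros)
      from has_derivative_compose[OF this DERIV_ramp[unfolded has_field_derivative_def]]
      show ?thesis unfolding \<eta>_def g_def by (simp add: mult.assoc)
    qed
    define b where "b n x = 4 * real (Suc n) * indicator (slab \<nu> l n) x" for n x
    have gb: "norm (g n x) * norm (\<phi> x - \<psi> x) \<le> b n x" for n x
    proof -
      have n2: "norm (\<phi> x - \<psi> x) \<le> 2" using norm_triangle_ineq4[of "\<phi> x" "\<psi> x"] \<phi>(2)[of x] \<psi>(2)[of x] by linarith
      have "norm (g n x) \<le> 2 * real (Suc n) * indicator (slab \<nu> l n) x"
      proof (cases "x \<in> slab \<nu> l n")
        case True
        have "norm (g n x) = ramp' (real (Suc n) * (\<nu> \<bullet> x - l)) * real (Suc n) * norm \<nu>"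
          unfolding g_def using ramp'_bounds(1) by (simp add: abs_mult)
        also have "\<dots> \<le> 2 * real (Suc n) * 1"
          using \<nu> ramp'_bounds by (intro mult_mono mult_nonneg_nonneg) auto
        finally show ?thesis using True by simp
      next
        case False
        then have "\<nu> \<bullet> x - l \<le> 0 \<or> 1 / real (Suc n) \<le> \<nu> \<bullet> x - l"
          unfolding slab_def by auto
        then have "real (Suc n) * (\<nu> \<bullet> x - l) \<le> 0 \<or> 1 \<le> real (Suc n) * (\<nu> \<bullet> x - l)"
          by (auto simp: mult_le_0_iff divide_le_eq mult.commute simp del: of_nat_Suc)
        then have "g n x = 0" unfolding g_def using ramp'_bounds(3,4) by auto
        then show ?thesis by simp
      qed
      from mult_mono[OF this n2] show ?thesis
        by (cases "x \<in> slab \<nu> l n") (simp_all add: b_def)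
    qed
    have fin': "emeasure lborel (A \<inter> slab \<nu> l n) < \<infinity>" for n
      using emeasure_mono[of "A \<inter> slab \<nu> l n" A lborel] fin by (auto intro: le_less_trans)
    have bi: "set_integrable lborel A (b n)" "(LINT x:A|lborel. b n x) = ?s n" for n
    proof -
      have e: "indicator A x *\<^sub>R b n x = 4 * real (Suc n) * indicator (A \<inter> slab \<nu> l n) x" for x
        by (simp add: b_def split: split_indicator)
      show "set_integrable lborel A (b n)" "(LINT x:A|lborel. b n x) = ?s n"
        unfolding set_integrable_def set_lebesgue_integral_def e using fin' by auto
    qed
    let ?m = "\<lambda>n x. \<eta> n x * divergence \<phi> x + (1 - \<eta> n x) * divergence \<psi> x"
    let ?w = "\<lambda>x. indicator {x. l < \<nu> \<bullet> x} x * divergence \<phi> x + indicator {x. \<nu> \<bullet> x \<le> l} x * divergence \<psi> x"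
    have le: "ereal (LINT x:A|lborel. ?m n x) \<le> perimeter A + ereal (?s n)" for n
      unfolding bi(2)[symmetric]
      by (rule perimeter_cutoff[OF A \<phi> \<psi> D _ _ _ bi(1) gb])
         (auto simp: \<eta>_def g_def ramp_bounds intro!: continuous_intros)
    \<comment> \<open>The cutoffs tend to the indicator of the open half-space, so in the limit the
      glued divergence separates into the integrals over the two pieces.\<close>
    have lim: "(\<lambda>n. LINT x:A|lborel. ?m n x)
      \<longlonglongrightarrow> (LINT x:A|lborel. ?w x)"
      unfolding set_lebesgue_integral_def
    proof (rule integral_dominated_convergence[where w="\<lambda>x. \<bar>divergence \<phi> x\<bar> + \<bar>divergence \<psi> x\<bar>"])
      show "integrable lborel (\<lambda>x. \<bar>divergence \<phi> x\<bar> + \<bar>divergence \<psi> x\<bar>)"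
        by (intro Bochner_Integration.integrable_add integrable_abs integrable_divergence \<phi> \<psi>)
      have [measurable]: "\<eta> n \<in> borel_measurable borel" for n
        unfolding \<eta>_def by (intro borel_measurable_continuous_onI continuous_ramp continuous_intros)
      show "(\<lambda>x. indicator A x *\<^sub>R ?m n x) \<in> borel_measurable lborel" for n
        by measurable
      show "AE x in lborel. norm (indicator A x *\<^sub>R ?m n x) \<le> \<bar>divergence \<phi> x\<bar> + \<bar>divergence \<psi> x\<bar>" for n
      proof (rule AE_I2)
        fix x
        have "\<bar>?m n x\<bar> \<le> \<bar>\<eta> n x * divergence \<phi> x\<bar> + \<bar>(1 - \<eta> n x) * divergence \<psi> x\<bar>"
          by (rule abs_triangle_ineq)
        also have "\<dots> \<le> 1 * \<bar>divergence \<phi> x\<bar> + 1 * \<bar>divergence \<psi> x\<bar>"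
          unfolding abs_mult using ramp_bounds by (intro add_mono mult_right_mono) (auto simp: \<eta>_def)
        finally show "norm (indicator A x *\<^sub>R ?m n x) \<le> \<bar>divergence \<phi> x\<bar> + \<bar>divergence \<psi> x\<bar>"
          by (auto split: split_indicator)
      qed
      show "AE x in lborel. (\<lambda>n. indicator A x *\<^sub>R ?m n x)
        \<longlonglongrightarrow> indicator A x *\<^sub>R ?w x"
      proof (rule AE_I2)
        fix x
        have "(\<lambda>n. \<eta> n x) \<longlonglongrightarrow> indicator {x. l < \<nu> \<bullet> x} x"
        proof (cases "l < \<nu> \<bullet> x")
          case True
          then obtain N where N: "1 / (\<nu> \<bullet> x - l) < real N" using reals_Archimedean2 by blast
          have "\<eta> n x = 1" if "n \<ge> N" for n
          proof -
            have "1 / (\<nu> \<bullet> x - l) < real (Suc n)" using N that by simp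
            then have "1 \<le> real (Suc n) * (\<nu> \<bullet> x - l)" using True by (simp add: field_simps)
            then show ?thesis unfolding \<eta>_def by (rule ramp_simps)
          qed
          then have "\<forall>\<^sub>F n in sequentially. \<eta> n x = indicator {x. l < \<nu> \<bullet> x} x"
            using True by (auto intro: eventually_sequentiallyI)
          then show ?thesis by (rule tendsto_eventually)
        next
          case False
          then have "\<eta> n x = 0" for n unfolding \<eta>_def by (intro ramp_simps) (auto simp: mult_le_0_iff)
          then show ?thesis using False by simp
        qed
        moreover have "indicator {x. \<nu> \<bullet> x \<le> l} x = 1 - (indicator {x. l < \<nu> \<bullet> x} x :: real)"
          by (auto split: split_indicator)
        ultimately show "(\<lambda>n. indicator A x *\<^sub>R ?m n x)
          \<longlonglongrightarrow> indicator A x *\<^sub>R ?w x"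
          by (auto intro!: tendsto_intros)
      qed
    qed measurable
    have "(LINT x:A|lborel. ?w x)
       = (LINT x|lborel. indicator ?P x *\<^sub>R divergence \<phi> x + indicator ?M x *\<^sub>R divergence \<psi> x)"
      unfolding set_lebesgue_integral_def by (intro Bochner_Integration.integral_cong) (auto split: split_indicator)
    also have "\<dots> = (LINT x:?P|lborel. divergence \<phi> x) + (LINT x:?M|lborel. divergence \<psi> x)"
      unfolding set_lebesgue_integral_def
      using set_integrable_divergence[OF \<phi>(1) m(1)] set_integrable_divergence[OF \<psi>(1) m(2)]
      by (intro Bochner_Integration.integral_add) (auto simp: set_integrable_def)
    finally have "ereal (LINT x:?P|lborel. divergence \<phi> x) + ereal (LINT x:?M|lborel. divergence \<psi> x)
      = liminf (\<lambda>n. ereal (LINT x:A|lborel. ?m n x))"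
      using lim by (intro lim_imp_Liminf[symmetric]) auto
    also have "\<dots> \<le> liminf (\<lambda>n. perimeter A + ereal (?s n))"
      by (intro Liminf_mono always_eventually allI le)
    also have "\<dots> \<le> perimeter A + liminf (\<lambda>n. ereal (?s n))"
    proof (cases "perimeter A")
      case (real p)
      then show ?thesis by (simp add: Liminf_add_ereal_left flip: plus_ereal.simps)
    qed (use perimeter_nonneg[of A] Liminf_bounded[of "0::ereal" "\<lambda>n. ereal (?s n)" sequentially] in auto)
    finally show ?thesis .
  qed
  show ?thesis unfolding perimeter_borel[OF m(1)] perimeter_borel[OF m(2)]
    by (rule SUP_add_SUP_le_ereal) (use key C1c_field_zero(1) in auto)
qed


section \<open>The perimeter of a ball\<close>

text \<open>A partial derivative is a limit of difference quotients, and each of these has integral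
  0 by translation invariance. The mean value theorem supplies the bound for dominated
  convergence.\<close>

lemma integral_divergence_eq_0:
  assumes \<phi>: "C1c_field \<phi>"
  shows "(LINT x|lborel. divergence \<phi> x) = 0"
proof -
  obtain r where r: "\<And>x. norm x > r \<Longrightarrow> \<phi> x = 0" using C1c_field_support[OF \<phi>] by metis
  have "(LINT x|lborel. frechet_derivative \<phi> (at x) (axis i 1) $ i) = 0"
    and "integrable lborel (\<lambda>x. frechet_derivative \<phi> (at x) (axis i 1) $ i)" for i
  proof -
    let ?e = "axis i 1 :: R3"
    define f where "f x = \<phi> x $ i" for x
    define d where "d x = frechet_derivative \<phi> (at x) ?e $ i" for x
    have cd: "continuous_on UNIV d" unfolding d_def by (rule C1c_field_continuous_partial[OF \<phi>])
    have d0: "d x = 0" if "norm x > r" for x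
      using C1c_field_derivative_zero[OF \<phi> r that] by (simp add: d_def)
    have f0: "f x = 0" if "norm x > r" for x using r[OF that] by (simp add: f_def)
    have cf: "continuous_on UNIV f" unfolding f_def using C1c_field_continuous[OF \<phi>] by (intro continuous_intros)
    have [measurable]: "f \<in> borel_measurable borel" "d \<in> borel_measurable borel"
      using cf cd by (auto intro: borel_measurable_continuous_onI)
    show id: "integrable lborel (\<lambda>x. frechet_derivative \<phi> (at x) (axis i 1) $ i)"
      using integrable_continuous_bounded_support[OF cd d0] by (simp add: d_def)
    have if': "integrable lborel f" by (rule integrable_continuous_bounded_support[OF cf f0])
    have D: "((\<lambda>t. f (x + t *\<^sub>R ?e)) has_real_derivative d (x + t *\<^sub>R ?e)) (at t)" for x t
    proof -
      have 1: "((\<lambda>t. x + t *\<^sub>R ?e) has_derivative (\<lambda>t. t *\<^sub>R ?e)) (at t)" by (auto intro!: derivative_eq_intros)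
      let ?D = "frechet_derivative \<phi> (at (x + t *\<^sub>R ?e))"
      have "((\<lambda>t. \<phi> (x + t *\<^sub>R ?e)) has_derivative (\<lambda>s. ?D (s *\<^sub>R ?e))) (at t)"
        by (rule has_derivative_compose[OF 1 C1c_field_derivative[OF \<phi>]])
      then have "((\<lambda>t. \<phi> (x + t *\<^sub>R ?e) $ i) has_derivative (\<lambda>s. ?D (s *\<^sub>R ?e) $ i)) (at t)"
        by (rule bounded_linear.has_derivative[OF bounded_linear_vec_nth])
      moreover have "?D (s *\<^sub>R ?e) = s *\<^sub>R ?D ?e" for s
        using linear_cmul[OF has_derivative_linear[OF C1c_field_derivative[OF \<phi>]]] by blast
      ultimately show ?thesis
        by (simp add: has_field_derivative_def f_def d_def mult.commute[of _ "_ $ _"])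
    qed
    have "compact (d ` cball 0 (r + 1))"
      using cd by (intro compact_continuous_image) (auto intro: continuous_on_subset)
    then obtain C where C: "\<And>x. norm x \<le> r + 1 \<Longrightarrow> \<bar>d x\<bar> \<le> C"
      by (force simp: bounded_iff dest!: compact_imp_bounded)
    have dC: "\<bar>d x\<bar> \<le> max 0 C" for x
      using C[of x] d0[of x] by (cases "norm x \<le> r + 1") auto
    define q where "q n x = real (Suc n) * (f (x + (1 / Suc n) *\<^sub>R ?e) - f x)" for n x
    \<comment> \<open>The shifts have length at most 1, so the quotients vanish outside the ball of
      radius r + 1.\<close>
    have q_bound: "\<bar>q n x\<bar> \<le> max 0 C * indicator (cball 0 (r + 1)) x" for n x
    proof (cases "norm x \<le> r + 1")
      case True
      have "\<exists>z. 0 < z \<and> z < 1 / real (Suc n) \<and> f (x + (1 / Suc n) *\<^sub>R ?e) - f (x + 0 *\<^sub>R ?e) = (1 / real (Suc n) - 0) * d (x + z *\<^sub>R ?e)"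
        by (rule MVT2) (use D in auto)
      then obtain z where "f (x + (1 / Suc n) *\<^sub>R ?e) - f x = (1 / real (Suc n)) * d (x + z *\<^sub>R ?e)" by auto
      then have "q n x = d (x + z *\<^sub>R ?e)" by (simp add: q_def)
      with True dC show ?thesis by simp
    next
      case False
      have "norm x - 1 \<le> norm (x + (1 / Suc n) *\<^sub>R ?e)"
        using norm_diff_ineq[of x "(1 / Suc n) *\<^sub>R ?e"] by (simp add: norm_axis_1) (smt (verit) divide_le_eq_1_pos of_nat_0_le_iff)
      with False show ?thesis by (simp add: q_def f0)
    qed
    have q_int: "(LINT x|lborel. q n x) = 0" for n
    proof -
      let ?t = "(1 / Suc n) *\<^sub>R ?e"
      have s: "has_bochner_integral lborel (\<lambda>x. f (?t + x)) (LINT x|lborel. f x)"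
      proof -
        have "has_bochner_integral (distr lborel borel ((+) ?t)) f (LINT x|lborel. f x)"
          unfolding lborel_distr_plus using if' by (simp add: has_bochner_integral_iff)
        then show ?thesis by (simp add: has_bochner_integral_iff integrable_distr_eq integral_distr)
      qed
      then show ?thesis
        using if' unfolding q_def by (simp add: has_bochner_integral_iff add.commute)
    qed
    have "(\<lambda>n. LINT x|lborel. q n x) \<longlonglongrightarrow> (LINT x|lborel. d x)"
    proof (rule integral_dominated_convergence[where w="\<lambda>x. max 0 C * indicator (cball 0 (r + 1)) x"])
      show "integrable lborel (\<lambda>x. max 0 C * indicator (cball (0::R3) (r + 1)) x)"
        using emeasure_bounded_finite[OF bounded_cball, of "0::R3" "r+1"] by (intro integrable_mult_right integrable_real_indicator) auto
      show "(\<lambda>x. q n x) \<in> borel_measurable lborel" for n unfolding q_def by measurable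
      show "AE x in lborel. norm (q n x) \<le> max 0 C * indicator (cball 0 (r + 1)) x" for n
        using q_bound by auto
      show "AE x in lborel. (\<lambda>n. q n x) \<longlonglongrightarrow> d x"
      proof (rule AE_I2)
        fix x
        have "((\<lambda>h. (f (x + (0 + h) *\<^sub>R ?e) - f (x + 0 *\<^sub>R ?e)) / h) \<longlongrightarrow> d (x + 0 *\<^sub>R ?e)) (at 0)"
          using D[of x 0] unfolding DERIV_def .
        moreover have "filterlim (\<lambda>n. 1 / real (Suc n)) (at 0) sequentially"
          using LIMSEQ_inverse_real_of_nat by (auto simp: filterlim_at inverse_eq_divide)
        ultimately have "(\<lambda>n. (f (x + (0 + 1 / real (Suc n)) *\<^sub>R ?e) - f (x + 0 *\<^sub>R ?e)) / (1 / real (Suc n))) \<longlonglongrightarrow> d (x + 0 *\<^sub>R ?e)"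
          by (rule filterlim_compose)
        then show "(\<lambda>n. q n x) \<longlonglongrightarrow> d x" by (simp add: q_def mult.commute)
      qed
    qed measurable
    then show "(LINT x|lborel. frechet_derivative \<phi> (at x) (axis i 1) $ i) = 0"
      unfolding q_int d_def by (rule LIMSEQ_unique[OF _ tendsto_const])
  qed
  then show ?thesis unfolding divergence_def by simp
qed

lemma perimeter_UNIV: "perimeter UNIV = 0"
proof (rule antisym)
  show "perimeter UNIV \<le> 0"
    by (rule perimeter_leI) (auto simp: set_lebesgue_integral_def integral_divergence_eq_0)
qed (rule perimeter_nonneg)

lemma shell_volume:
  assumes a: "0 < a" "a \<le> b"
  shows "vol (cball (0::R3) b - cball 0 a) \<le> 4 * pi * b\<^sup>2 * (b - a)"
proof -
  have "vol (cball (0::R3) b - cball 0 a) = vol (cball (0::R3) b) - vol (cball (0::R3) a)"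
    using a by (intro measure_Diff) (auto simp: emeasure_cball_R3 )
  also have "\<dots> = 4/3 * pi * (b^3 - a^3)"
    using a by (simp add: measure_def emeasure_cball_R3 algebra_simps)
  also have "b^3 - a^3 = (b - a) * (b\<^sup>2 + a * b + a\<^sup>2)" by (simp add: power2_eq_square power3_eq_cube algebra_simps)
  also have "4/3 * pi * ((b - a) * (b\<^sup>2 + a * b + a\<^sup>2)) \<le> 4/3 * pi * ((b - a) * (3 * b\<^sup>2))"
  proof (intro mult_left_mono)
    have "a * b \<le> b * b" "a * a \<le> b * b" using a by (auto intro!: mult_mono)
    then show "b\<^sup>2 + a * b + a\<^sup>2 \<le> 3 * b\<^sup>2" by (simp add: power2_eq_square)
  qed (use a in auto)
  finally show ?thesis by (simp add: algebra_simps)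
qed

text \<open>Only the order a^2 matters, not the sharp factor 4 pi. A test field is cut off across a
  thin shell outside the ball; over the whole space the cut-off field has divergence of integral 0,
  which leaves the cutoff error as the bound.\<close>

lemma perimeter_cball:
  assumes a: "a > 0"
  shows "perimeter (cball 0 a) \<le> ereal (32 * pi * a\<^sup>2)"
proof (rule perimeter_leI)
  fix \<phi> assume \<phi>: "C1c_field \<phi>" "\<And>x. norm (\<phi> x) \<le> 1"
  note [measurable] = divergence_measurable[OF \<phi>(1)]
  \<comment> \<open>The squared norm, unlike the norm, is differentiable at the origin. The
    transition takes place where norm x lies between a and \<open>B n\<close>.\<close>
  define \<eta> where "\<eta> n x = 1 - ramp (real (Suc n) * (x \<bullet> x - a\<^sup>2))" for n and x :: R3
  define g where "g n x = (- (ramp' (real (Suc n) * (x \<bullet> x - a\<^sup>2)) * (real (Suc n) * 2))) *\<^sub>R x" for n and x :: R3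
  define B where "B n = sqrt (a\<^sup>2 + 1 / real (Suc n))" for n
  have B: "a \<le> B n" "(B n)\<^sup>2 = a\<^sup>2 + 1 / real (Suc n)" "0 \<le> B n" for n
    using a by (auto simp: B_def real_le_rsqrt)
  let ?S = "\<lambda>n. cball (0::R3) (B n) - cball 0 a"
  define b where "b n x = 4 * real (Suc n) * B n * indicator (?S n) x" for n and x :: R3
  have D: "(\<eta> n has_derivative (\<lambda>h. g n x \<bullet> h)) (at x)" for n x
  proof -
    have "((\<lambda>x. real (Suc n) * (x \<bullet> x - a\<^sup>2)) has_derivative (\<lambda>h. real (Suc n) * (2 * (x \<bullet> h)))) (at x)"
      by (auto intro!: derivative_eq_intros simp: inner_commute)
    from has_derivative_compose[OF this DERIV_ramp[unfolded has_field_derivative_def]]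
    show ?thesis unfolding \<eta>_def g_def by (auto intro!: derivative_eq_intros simp: mult.assoc)
  qed
  have gb: "norm (g n x) * norm (\<phi> x - 0) \<le> b n x" for n x
  proof -
    have "norm (g n x) \<le> b n x"
    proof (cases "x \<in> ?S n")
      case True
      have "norm (g n x) = ramp' (real (Suc n) * (x \<bullet> x - a\<^sup>2)) * (real (Suc n) * 2) * norm x"
        unfolding g_def using ramp'_bounds(1) by (simp add: abs_mult)
      also have "\<dots> \<le> 2 * (real (Suc n) * 2) * B n"
        using True ramp'_bounds by (intro mult_mono mult_nonneg_nonneg) auto
      finally show ?thesis using True by (simp add: b_def)
    next
      case False
      then consider "norm x \<le> a" | "B n \<le> norm x" by fastforce
      then have "g n x = 0"
      proof cases
        case 1
        then have "(norm x)\<^sup>2 \<le> a\<^sup>2" by (intro power_mono) auto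
        then have "real (Suc n) * (x \<bullet> x - a\<^sup>2) \<le> 0"
          by (intro mult_nonneg_nonpos) (auto simp: power2_norm_eq_inner)
        then show ?thesis by (simp only: g_def ramp'_bounds(3)) simp
      next
        case 2
        then have "(B n)\<^sup>2 \<le> (norm x)\<^sup>2" using B by (intro power_mono) auto
        then have "1 / real (Suc n) \<le> x \<bullet> x - a\<^sup>2" unfolding B by (simp add: power2_norm_eq_inner)
        then have "1 \<le> real (Suc n) * (x \<bullet> x - a\<^sup>2)" by (simp add: divide_le_eq mult.commute del: of_nat_Suc)
        then show ?thesis by (simp only: g_def ramp'_bounds(4)) simp
      qed
      then show ?thesis using B by (simp add: b_def)
    qed
    moreover have "norm (g n x) * norm (\<phi> x - 0) \<le> norm (g n x) * 1" using \<phi>(2)[of x] by (intro mult_left_mono) auto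
    ultimately show ?thesis by simp
  qed
  have fin: "emeasure lborel (?S n) < \<infinity>" for n
    using emeasure_bounded_finite[of "?S n"] by (simp add: bounded_diff)
  have bi: "set_integrable lborel UNIV (b n)" "(LINT x:UNIV|lborel. b n x) = 4 * real (Suc n) * B n * vol (?S n)" for n
    unfolding set_integrable_def set_lebesgue_integral_def b_def using fin[of n] by auto
  have le: "(LINT x|lborel. \<eta> n x * divergence \<phi> x) \<le> 16 * pi * (B n)\<^sup>2 * 2" for n
  proof -
    have "ereal (LINT x:UNIV|lborel. \<eta> n x * divergence \<phi> x + (1 - \<eta> n x) * divergence (\<lambda>x. 0) x)
        \<le> perimeter UNIV + ereal (LINT x:UNIV|lborel. b n x)"
      by (rule perimeter_cutoff[OF _ \<phi> C1c_field_zero(1) _ D _ _ _ bi(1) gb])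
         (use ramp_bounds in \<open>auto simp: \<eta>_def g_def intro!: continuous_intros\<close>)
    then have "(LINT x|lborel. \<eta> n x * divergence \<phi> x) \<le> 4 * real (Suc n) * B n * vol (?S n)"
      unfolding bi by (simp add: perimeter_UNIV C1c_field_zero) (simp add: set_lebesgue_integral_def)
    also have "\<dots> \<le> 4 * real (Suc n) * B n * (4 * pi * (B n)\<^sup>2 * (B n - a))"
      using B a by (intro mult_left_mono shell_volume) auto
    also have "\<dots> = 16 * pi * (B n)\<^sup>2 * (real (Suc n) * (B n * (B n - a)))" by (simp add: algebra_simps)
    also have "\<dots> \<le> 16 * pi * (B n)\<^sup>2 * (real (Suc n) * (1 / real (Suc n)))"
    proof (intro mult_left_mono)
      have "B n * (B n - a) \<le> (B n)\<^sup>2 - a\<^sup>2"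
        using mult_right_mono[OF B(1)[of n], of a] a by (simp add: power2_eq_square algebra_simps)
      then show "B n * (B n - a) \<le> 1 / real (Suc n)" using B(2)[of n] by simp
    qed auto
    also have "\<dots> \<le> 16 * pi * (B n)\<^sup>2 * 2" by simp
    finally show ?thesis .
  qed
  have lim: "(\<lambda>n. LINT x|lborel. \<eta> n x * divergence \<phi> x) \<longlonglongrightarrow> (LINT x|lborel. indicator (cball 0 a) x *\<^sub>R divergence \<phi> x)"
  proof (rule integral_dominated_convergence[where w="\<lambda>x. \<bar>divergence \<phi> x\<bar>"])
    show "integrable lborel (\<lambda>x. \<bar>divergence \<phi> x\<bar>)" by (intro integrable_abs integrable_divergence \<phi>)
    have [measurable]: "\<eta> n \<in> borel_measurable borel" for n
      unfolding \<eta>_def by (intro borel_measurable_continuous_onI continuous_ramp continuous_intros)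
    show "(\<lambda>x. \<eta> n x * divergence \<phi> x) \<in> borel_measurable lborel" for n by measurable
    show "AE x in lborel. norm (\<eta> n x * divergence \<phi> x) \<le> \<bar>divergence \<phi> x\<bar>" for n
      using ramp_bounds by (auto simp: abs_mult \<eta>_def intro!: mult_left_le_one_le)
    show "AE x in lborel. (\<lambda>n. \<eta> n x * divergence \<phi> x) \<longlonglongrightarrow> indicator (cball 0 a) x *\<^sub>R divergence \<phi> x"
    proof (rule AE_I2)
      fix x :: R3
      have "(\<lambda>n. \<eta> n x) \<longlonglongrightarrow> indicator (cball 0 a) x"
      proof (cases "norm x \<le> a")
        case True
        then have "(norm x)\<^sup>2 \<le> a\<^sup>2" by (intro power_mono) auto
        then have "real (Suc n) * (x \<bullet> x - a\<^sup>2) \<le> 0" for n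
          by (intro mult_nonneg_nonpos) (auto simp: power2_norm_eq_inner)
        then have "\<eta> n x = 1" for n by (simp only: \<eta>_def ramp_simps(1))
        then show ?thesis using True by simp
      next
        case False
        then have "a\<^sup>2 < (norm x)\<^sup>2" using a by (intro power_strict_mono) auto
        then have p: "x \<bullet> x - a\<^sup>2 > 0" by (simp add: power2_norm_eq_inner)
        then obtain N where N: "1 / (x \<bullet> x - a\<^sup>2) < real N" using reals_Archimedean2 by blast
        have "\<eta> n x = 0" if "n \<ge> N" for n
        proof -
          have "1 / (x \<bullet> x - a\<^sup>2) < real (Suc n)" using N that by simp
          then have "1 \<le> real (Suc n) * (x \<bullet> x - a\<^sup>2)" using p by (simp add: field_simps)
          then show ?thesis by (simp only: \<eta>_def ramp_simps(2))
        qed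
        then have "\<forall>\<^sub>F n in sequentially. \<eta> n x = indicator (cball 0 a) x"
          using False by (auto intro: eventually_sequentiallyI)
        then show ?thesis by (rule tendsto_eventually)
      qed
      then show "(\<lambda>n. \<eta> n x * divergence \<phi> x) \<longlonglongrightarrow> indicator (cball 0 a) x *\<^sub>R divergence \<phi> x"
        by (auto intro!: tendsto_intros)
    qed
  qed measurable
  have "(\<lambda>n. 16 * pi * (B n)\<^sup>2 * 2) \<longlonglongrightarrow> 16 * pi * (a\<^sup>2 + 0) * 2"
    unfolding B by (intro tendsto_intros LIMSEQ_inverse_real_of_nat[unfolded inverse_eq_divide])
  from LIMSEQ_le[OF lim this] le
  show "ereal (LINT x:cball 0 a|lborel. divergence \<phi> x) \<le> ereal (32 * pi * a\<^sup>2)"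
    by (simp add: set_lebesgue_integral_def algebra_simps)
qed auto

subsection \<open>Energies of Borel sets\<close>

abbreviation coulr :: "R3 set \<Rightarrow> R3 set \<Rightarrow> real" where
  "coulr A B \<equiv> enn2real (coul A B)"

abbreviation attr :: "R3 set \<Rightarrow> real" where
  "attr A \<equiv> enn2real (pot A 0)"

definition borel_fin :: "R3 set \<Rightarrow> bool" where
  "borel_fin A \<longleftrightarrow> A \<in> sets borel \<and> emeasure lborel A < \<infinity>"

lemma borel_finD: "borel_fin A \<Longrightarrow> A \<in> sets borel" "borel_fin A \<Longrightarrow> emeasure lborel A < \<infinity>"
  "borel_fin A \<Longrightarrow> emeasure lborel A = ennreal (vol A)"
  by (auto simp: borel_fin_def emeasure_eq_ennreal_measure)

lemma borel_fin_subset: "borel_fin B \<Longrightarrow> A \<subseteq> B \<Longrightarrow> A \<in> sets borel \<Longrightarrow> borel_fin A"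
  unfolding borel_fin_def using emeasure_mono[of A B lborel] by (auto intro: le_less_trans)

lemma borel_fin_Un: "borel_fin A \<Longrightarrow> borel_fin B \<Longrightarrow> borel_fin (A \<union> B)"
  unfolding borel_fin_def using emeasure_subadditive[of A lborel B]
  by (auto intro: le_less_trans simp: ennreal_add_less_top)

lemma borel_fin_cball: "borel_fin (cball c r)"
  unfolding borel_fin_def using emeasure_bounded_finite[OF bounded_cball] by auto

lemma emeasure_translate:
  assumes A: "A \<in> sets borel" shows "emeasure lborel ((+) t ` (A :: R3 set)) = emeasure lborel A"
proof -
  note [measurable] = A borel_translate[OF A, of t]
  have "emeasure lborel ((+) t ` A) = emeasure (distr lborel borel ((+) t)) ((+) t ` A)"
    by (simp only: lborel_distr_plus)
  also have "\<dots> = emeasure lborel ((+) t -` ((+) t ` A))" by (subst emeasure_distr) simp_all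
  also have "(+) t -` ((+) t ` A) = A" by auto
  finally show ?thesis .
qed

lemma borel_fin_translate: "borel_fin A \<Longrightarrow> borel_fin ((+) t ` A)"
  by (simp add: borel_fin_def borel_translate emeasure_translate)

lemma pot_shift:
  assumes A [measurable]: "A \<in> sets borel" shows "pot ((+) t ` A) x = pot A (x - t)"
proof -
  note [measurable] = borel_translate[OF A, of t]
  have "pot ((+) t ` A) x = (\<integral>\<^sup>+y. indicator ((+) t ` A) (t + y) * ennreal (1 / norm (x - (t + y))) \<partial>lborel)"
    unfolding pot_def by (subst nn_integral_lborel_shift[where t=t]) simp_all
  also have "\<dots> = pot A (x - t)"
    unfolding pot_def by (intro nn_integral_cong) (auto simp: algebra_simps indicator_def)
  finally show ?thesis .
qed

lemma coul_translate:
  assumes A [measurable]: "A \<in> sets borel" "B \<in> sets borel"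
  shows "coul ((+) t ` A) ((+) t ` B) = coul A B"
proof -
  note [measurable] = borel_translate[OF A(1), of t]
  have "coul ((+) t ` A) ((+) t ` B) = (\<integral>\<^sup>+x. indicator ((+) t ` A) (t + x) * pot B (t + x - t) \<partial>lborel)"
    unfolding coul_def pot_shift[OF A(2)]
    by (subst nn_integral_lborel_shift[where t=t]) simp_all
  also have "\<dots> = coul A B"
    unfolding coul_def by (intro nn_integral_cong) (auto simp: indicator_def)
  finally show ?thesis .
qed

text \<open>The origin is exempted here and in \<open>coul_ge\<close> so that the formula of
  \<open>pot_cball\<close> can be used.\<close>

lemma coul_le:
  assumes [measurable]: "A \<in> sets borel" and "\<And>x. x \<in> A \<Longrightarrow> x \<noteq> 0 \<Longrightarrow> pot B x \<le> c"
  shows "coul A B \<le> c * emeasure lborel A"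
proof -
  have "coul A B \<le> (\<integral>\<^sup>+x. c * indicator A x \<partial>lborel)"
    unfolding coul_def
    by (rule nn_integral_mono_AE, rule AE_mp[OF AE_lborel_singleton[of 0]], rule AE_I2)
       (use assms(2) in \<open>auto split: split_indicator\<close>)
  then show ?thesis by (simp add: nn_integral_cmult)
qed

lemma coul_ge:
  assumes [measurable]: "A \<in> sets borel" and "\<And>x. x \<in> A \<Longrightarrow> x \<noteq> 0 \<Longrightarrow> c \<le> pot B x"
  shows "c * emeasure lborel A \<le> coul A B"
proof -
  have "(\<integral>\<^sup>+x. c * indicator A x \<partial>lborel) \<le> coul A B"
    unfolding coul_def
    by (rule nn_integral_mono_AE, rule AE_mp[OF AE_lborel_singleton[of 0]], rule AE_I2)
       (use assms(2) in \<open>auto split: split_indicator\<close>)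
  then show ?thesis by (simp add: nn_integral_cmult)
qed

lemma coul_le_volume:
  assumes "borel_fin A" "borel_fin B"
  shows "coul A B \<le> (ennreal (8 * pi) + emeasure lborel B) * emeasure lborel A"
  using assms by (intro coul_le pot_le) (auto simp: borel_fin_def)

lemma coul_finite:
  assumes "borel_fin A" "borel_fin B" shows "coul A B < \<infinity>"
proof -
  have "(ennreal (8 * pi) + emeasure lborel B) * emeasure lborel A < \<infinity>"
    using assms by (simp add: borel_fin_def ennreal_mult_less_top)
  with coul_le_volume[OF assms] show ?thesis by (rule le_less_trans)
qed

lemma coul_Un_left:
  assumes [measurable]: "A \<in> sets borel" "B \<in> sets borel" "C \<in> sets borel" and "A \<inter> B = {}"
  shows "coul (A \<union> B) C = coul A C + coul B C"
  unfolding coul_def using assms(4)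
  by (subst nn_integral_add[symmetric]) (auto intro!: nn_integral_cong split: split_indicator)

lemma coulr_Un_left:
  assumes "borel_fin A" "borel_fin B" "borel_fin C" "A \<inter> B = {}"
  shows "coulr (A \<union> B) C = coulr A C + coulr B C"
  using assms coul_finite[of A C] coul_finite[of B C]
  by (subst coul_Un_left) (auto simp: borel_fin_def enn2real_plus)

lemma coulr_sym: "borel_fin A \<Longrightarrow> borel_fin B \<Longrightarrow> coulr A B = coulr B A"
  by (simp add: coul_sym borel_fin_def)

lemma attr_Un:
  assumes "borel_fin A" "borel_fin B" "A \<inter> B = {}"
  shows "attr (A \<union> B) = attr A + attr B"
  using assms pot_finite[of A 0] pot_finite[of B 0]
  by (subst pot_Un) (auto simp: borel_fin_def enn2real_plus)

lemma coulr_Un_Un: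
  assumes "borel_fin A" "borel_fin B" "A \<inter> B = {}"
  shows "coulr (A \<union> B) (A \<union> B) = coulr A A + coulr B B + 2 * coulr A B"
  using assms borel_fin_Un[of A B] coulr_sym[of "A \<union> B" A] coulr_sym[of "A \<union> B" B] coulr_sym[of A B]
  by (simp add: coulr_Un_left)

text \<open>Isolates the perimeter as the only term that can be infinite; the rest of every
  comparison is then real arithmetic.\<close>

lemma energy_borel:
  assumes A: "borel_fin A"
  shows "energy Z A = perimeter A + ereal (coulr A A / 2 - Z * attr A)"
proof -
  note [measurable] = borel_finD(1)[OF A]
  have 1: "(\<integral>\<^sup>+ x. \<integral>\<^sup>+ y. ennreal (indicator A x * indicator A y / norm (x - y)) \<partial>lebesgue \<partial>lebesgue) = coul A A"
    unfolding nn_integral_completion coul_fun_indicator[OF borel_finD(1)[OF A] borel_finD(1)[OF A], symmetric] coul_fun_def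
    by (intro nn_integral_cong) (auto split: split_indicator)
  have 2: "(\<integral>\<^sup>+ x. ennreal (indicator A x / norm x) \<partial>lebesgue) = pot A 0"
    unfolding nn_integral_completion pot_def
    by (intro nn_integral_cong) (auto split: split_indicator)
  have "coul A A < \<infinity>" "pot A 0 < \<infinity>" using A coul_finite pot_finite by (auto simp: borel_fin_def)
  then obtain c p where c: "coul A A = ennreal c" "c \<ge> 0" and p: "pot A 0 = ennreal p" "p \<ge> 0"
    by (metis ennreal_cases infinity_ennreal_def less_irrefl)
  show ?thesis
    unfolding energy_def 1 2 c(1) p(1) using c(2) p(2)
    by (cases "perimeter A") (simp_all add: enn2ereal_ennreal)
qed

text \<open>A Lebesgue set differs from a Borel set by a null set, to which all three terms of the
  energy are blind.\<close>

lemma borel_representative: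
  assumes \<Omega>: "\<Omega> \<in> sets lebesgue"
  obtains A where "A \<in> sets borel" "emeasure lborel A = emeasure lebesgue \<Omega>" "\<And>Z. energy Z A = energy Z \<Omega>"
proof -
  obtain A N N' where A: "\<Omega> = A \<union> N" "N \<subseteq> N'" "N' \<in> null_sets lborel" "A \<in> sets lborel"
    using \<Omega> by (rule sets_completionE)
  have ae: "AE x in lborel. x \<in> A \<longleftrightarrow> x \<in> \<Omega>"
    using AE_not_in[OF A(3)] by eventually_elim (use A(1,2) in auto)
  then have ae': "AE x in lebesgue. x \<in> A \<longleftrightarrow> x \<in> \<Omega>" by (rule AE_completion)
  have As: "A \<in> sets borel" using A(4) by simp
  have em: "emeasure lborel A = emeasure lebesgue \<Omega>"
  proof -
    have "emeasure lborel A = emeasure lebesgue A" using As by simp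
    also have "\<dots> = emeasure lebesgue \<Omega>" using ae' \<Omega> As by (intro emeasure_eq_AE) auto
    finally show ?thesis .
  qed
  have "perimeter A = perimeter \<Omega>"
  proof -
    have "(LINT x:A|lebesgue. divergence \<phi> x) = (LINT x:\<Omega>|lebesgue. divergence \<phi> x)" if "C1c_field \<phi>" for \<phi>
    proof -
      have m: "divergence \<phi> \<in> borel_measurable lebesgue"
        using divergence_measurable[OF that] by (simp add: measurable_completion)
      show ?thesis unfolding set_lebesgue_integral_def
        using ae' As \<Omega> m by (intro integral_cong_AE borel_measurable_scaleR borel_measurable_indicator)
          (auto elim!: eventually_mono simp: indicator_def)
    qed
    then show ?thesis unfolding perimeter_def by (intro SUP_cong) auto
  qed
  moreover have "(\<integral>\<^sup>+ x. \<integral>\<^sup>+ y. ennreal (indicator A x * indicator A y / norm (x - y)) \<partial>lebesgue \<partial>lebesgue)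
    = (\<integral>\<^sup>+ x. \<integral>\<^sup>+ y. ennreal (indicator \<Omega> x * indicator \<Omega> y / norm (x - y)) \<partial>lebesgue \<partial>lebesgue)"
  proof (rule nn_integral_cong_AE, use ae' in eventually_elim)
    fix x assume x: "x \<in> A \<longleftrightarrow> x \<in> \<Omega>"
    show "(\<integral>\<^sup>+ y. ennreal (indicator A x * indicator A y / norm (x - y)) \<partial>lebesgue)
       = (\<integral>\<^sup>+ y. ennreal (indicator \<Omega> x * indicator \<Omega> y / norm (x - y)) \<partial>lebesgue)"
      by (rule nn_integral_cong_AE, use ae' in eventually_elim) (simp add: indicator_def x)
  qed
  moreover have "(\<integral>\<^sup>+ x. ennreal (indicator A x / norm x) \<partial>lebesgue) = (\<integral>\<^sup>+ x. ennreal (indicator \<Omega> x / norm x) \<partial>lebesgue)"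
    by (rule nn_integral_cong_AE, use ae' in eventually_elim) (simp add: indicator_def)
  ultimately have "energy Z A = energy Z \<Omega>" for Z unfolding energy_def by simp
  with that As em show ?thesis by blast
qed

subsection \<open>Moving a piece to infinity\<close>

text \<open>Since a plane separates the sets, moving B along the normal away from A never decreases
  a distance between their points. The integrand at the original position therefore dominates, and
  the argument covers unbounded sets of finite volume.\<close>

lemma coul_separate_tendsto_0:
  assumes A: "borel_fin A" "A \<subseteq> {x. \<nu> \<bullet> x \<le> l}" and B: "borel_fin B" "B \<subseteq> {x. l < \<nu> \<bullet> x}" and \<nu>: "\<nu> \<noteq> 0"
  shows "(\<lambda>n. coul A ((+) (real n *\<^sub>R \<nu>) ` B)) \<longlonglongrightarrow> 0"
proof -
  note [measurable] = borel_finD(1)[OF A(1)] borel_finD(1)[OF B(1)]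
  have dist: "norm (x - y) \<le> norm (x - real n *\<^sub>R \<nu> - y)" if "x \<in> A" "y \<in> B" for x y n
  proof -
    have "\<nu> \<bullet> x \<le> l" "l < \<nu> \<bullet> y" using that A(2) B(2) by auto
    then have "0 \<le> \<nu> \<bullet> (y - x)" by (simp add: inner_diff_right)
    then have "(norm (y - x))\<^sup>2 \<le> (norm (y - x + real n *\<^sub>R \<nu>))\<^sup>2"
      unfolding power2_norm_eq_inner by (simp add: inner_add_left inner_add_right inner_commute[of "y - x" \<nu>])
    then have "norm (y - x) \<le> norm (y - x + real n *\<^sub>R \<nu>)" by (rule power2_le_imp_le) simp
    also have "y - x + real n *\<^sub>R \<nu> = - (x - real n *\<^sub>R \<nu> - y)" by simp
    finally show ?thesis by (simp only: norm_minus_cancel norm_minus_commute[of y x])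
  qed
  have ker: "AE y in lborel. indicator B y * ennreal (1 / norm (x - real n *\<^sub>R \<nu> - y)) \<le> indicator B y * ennreal (1 / norm (x - y))"
    if x: "x \<in> A" for x n
  proof (rule AE_mp[OF AE_lborel_singleton[of x]], rule AE_I2, rule impI)
    fix y assume "y \<noteq> x"
    then show "indicator B y * ennreal (1 / norm (x - real n *\<^sub>R \<nu> - y)) \<le> indicator B y * ennreal (1 / norm (x - y))"
      using dist[OF x, of y n] by (cases "y \<in> B") (auto intro!: ennreal_leI divide_left_mono mult_pos_pos intro: less_le_trans[of 0 "norm (x - y)"])
  qed
  have pt: "(\<lambda>n. pot B (x - real n *\<^sub>R \<nu>)) \<longlonglongrightarrow> 0" if x: "x \<in> A" for x
  proof -
    have "(\<lambda>n. \<integral>\<^sup>+y. indicator B y * ennreal (1 / norm (x - real n *\<^sub>R \<nu> - y)) \<partial>lborel) \<longlonglongrightarrow> (\<integral>\<^sup>+(y::R3). 0 \<partial>lborel)"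
    proof (rule nn_integral_dominated_convergence[where w="\<lambda>y. indicator B y * ennreal (1 / norm (x - y))"])
      show "AE y in lborel. indicator B y * ennreal (1 / norm (x - real n *\<^sub>R \<nu> - y)) \<le> indicator B y * ennreal (1 / norm (x - y))" for n
        by (rule ker[OF x])
      show "(\<integral>\<^sup>+y. indicator B y * ennreal (1 / norm (x - y)) \<partial>lborel) < \<infinity>"
        using pot_finite[OF borel_finD(1,2)[OF B(1) ]] B(1) unfolding pot_def by simp
      show "AE y in lborel. (\<lambda>n. indicator B y * ennreal (1 / norm (x - real n *\<^sub>R \<nu> - y))) \<longlonglongrightarrow> 0"
      proof (rule AE_I2)
        fix y
        have "filterlim (\<lambda>n. real n * norm \<nu> - norm (x - y)) at_top sequentially"
          using \<nu> by (intro filterlim_tendsto_add_at_top[where f="\<lambda>_. - norm (x - y)", simplified]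
             filterlim_at_top_mult_tendsto_pos[OF tendsto_const _ filterlim_real_sequentially]) auto
        then have "filterlim (\<lambda>n. norm (x - real n *\<^sub>R \<nu> - y)) at_top sequentially"
        proof (rule filterlim_at_top_mono, intro always_eventually allI)
          fix n
          have "real n *\<^sub>R \<nu> = (x - y) - (x - real n *\<^sub>R \<nu> - y)" by simp
          then have "norm (real n *\<^sub>R \<nu>) \<le> norm (x - y) + norm (x - real n *\<^sub>R \<nu> - y)"
            using norm_triangle_ineq4 by metis
          then show "real n * norm \<nu> - norm (x - y) \<le> norm (x - real n *\<^sub>R \<nu> - y)" by simp
        qed
        then have "(\<lambda>n. 1 / norm (x - real n *\<^sub>R \<nu> - y)) \<longlonglongrightarrow> 0"
          by (intro tendsto_divide_0[OF tendsto_const] filterlim_at_top_imp_at_infinity)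
        then have "(\<lambda>n. ennreal (1 / norm (x - real n *\<^sub>R \<nu> - y))) \<longlonglongrightarrow> ennreal 0" by (rule tendsto_ennrealI)
        then show "(\<lambda>n. indicator B y * ennreal (1 / norm (x - real n *\<^sub>R \<nu> - y))) \<longlonglongrightarrow> 0"
          by (cases "y \<in> B") auto
      qed
    qed measurable
    then show ?thesis by (simp add: pot_def)
  qed
  have "(\<lambda>n. \<integral>\<^sup>+x. indicator A x * pot B (x - real n *\<^sub>R \<nu>) \<partial>lborel) \<longlonglongrightarrow> (\<integral>\<^sup>+(x::R3). 0 \<partial>lborel)"
  proof (rule nn_integral_dominated_convergence[where w="\<lambda>x. indicator A x * pot B x"])
    show "AE x in lborel. indicator A x * pot B (x - real n *\<^sub>R \<nu>) \<le> indicator A x * pot B x" for n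
    proof (rule AE_I2)
      fix x :: R3
      show "indicator A x * pot B (x - real n *\<^sub>R \<nu>) \<le> indicator A x * pot B x"
      proof (cases "x \<in> A")
        case True
        have "pot B (x - real n *\<^sub>R \<nu>) \<le> pot B x"
          unfolding pot_def by (rule nn_integral_mono_AE[OF ker[OF True]])
        with True show ?thesis by simp
      qed simp
    qed
    show "(\<integral>\<^sup>+x. indicator A x * pot B x \<partial>lborel) < \<infinity>"
      using coul_finite[OF A(1) B(1)] by (simp add: coul_def)
    show "AE x in lborel. (\<lambda>n. indicator A x * pot B (x - real n *\<^sub>R \<nu>)) \<longlonglongrightarrow> 0"
    proof (rule AE_I2)
      fix x show "(\<lambda>n. indicator A x * pot B (x - real n *\<^sub>R \<nu>)) \<longlonglongrightarrow> 0"
        using pt[of x] by (cases "x \<in> A") auto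
    qed
  qed measurable
  then show ?thesis by (simp add: coul_def pot_shift)
qed

text \<open>The attraction of the moved piece lowers the energy and is dropped from the upper bound;
  \<delta> pays for the interaction that remains at a finite distance.\<close>

lemma energy_split_to_infinity:
  assumes A: "borel_fin A" "A \<subseteq> {x. \<nu> \<bullet> x \<le> l}" and B: "borel_fin B" "B \<subseteq> {x. l < \<nu> \<bullet> x}" and \<nu>: "\<nu> \<noteq> 0"
    and Z: "Z \<ge> 0" and \<delta>: "\<delta> > 0"
  obtains t where "A \<inter> (+) t ` B = {}"
    "energy Z (A \<union> (+) t ` B) \<le> perimeter A + perimeter B + ereal (coulr A A / 2 - Z * attr A + coulr B B / 2 + \<delta>)"
proof -
  have "\<forall>\<^sub>F n in sequentially. coul A ((+) (real n *\<^sub>R \<nu>) ` B) < ennreal \<delta>"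
    using coul_separate_tendsto_0[OF A B \<nu>] \<delta> by (intro order_tendstoD) auto
  then obtain n where n: "coul A ((+) (real n *\<^sub>R \<nu>) ` B) < ennreal \<delta>"
    by (auto simp: eventually_sequentially)
  define t where "t = real n *\<^sub>R \<nu>"
  let ?B = "(+) t ` B"
  have B': "borel_fin ?B" using B(1) by (rule borel_fin_translate)
  have disj: "A \<inter> ?B = {}"
  proof -
    have "l < \<nu> \<bullet> (t + y)" if "y \<in> B" for y
    proof -
      have "0 \<le> \<nu> \<bullet> t" by (simp add: t_def)
      then show ?thesis using B(2) that by (auto simp: inner_add_right)
    qed
    then show ?thesis using A(2) by force
  qed
  have "coulr A ?B \<le> \<delta>"
    using n \<delta> enn2real_mono[of "coul A ?B" "ennreal \<delta>"] by (auto simp: t_def)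
  then have "coulr (A \<union> ?B) (A \<union> ?B) / 2 - Z * attr (A \<union> ?B) \<le> coulr A A / 2 - Z * attr A + coulr B B / 2 + \<delta>"
    using A(1) B B' disj mult_nonneg_nonneg[OF Z enn2real_nonneg, of "pot ?B 0"]
    by (simp add: coulr_Un_Un attr_Un coul_translate borel_finD distrib_left add_divide_distrib)
  moreover have "perimeter (A \<union> ?B) \<le> perimeter A + perimeter B"
    using perimeter_Un[OF borel_finD(1)[OF A(1)] borel_finD(1)[OF B'] disj] perimeter_translate[OF borel_finD(1)[OF B(1)], of t]
    by (meson add_left_mono order_trans)
  ultimately have "energy Z (A \<union> ?B) \<le> perimeter A + perimeter B + ereal (coulr A A / 2 - Z * attr A + coulr B B / 2 + \<delta>)"
    unfolding energy_borel[OF borel_fin_Un[OF A(1) B']] by (intro add_mono) auto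
  with disj show ?thesis by (rule that)
qed

text \<open>The Borel form of minimality. Finiteness of the perimeter is included so that it can be
  cancelled when competitors are compared.\<close>

definition volume_minimal :: "real \<Rightarrow> R3 set \<Rightarrow> bool" where
  "volume_minimal Z \<Omega> \<longleftrightarrow> borel_fin \<Omega> \<and> perimeter \<Omega> < \<infinity> \<and>
    (\<forall>A. borel_fin A \<longrightarrow> emeasure lborel A = emeasure lborel \<Omega> \<longrightarrow> energy Z \<Omega> \<le> energy Z A)"

text \<open>The competitor consists of the two halves far apart. It saves their mutual Coulomb
  energy; it pays for the cut surface and for the lost attraction of the half that moved.\<close>

lemma minimal_cut:
  assumes min: "volume_minimal Z \<Omega>" and Z: "Z \<ge> 0" and \<nu>: "norm \<nu> \<le> 1" "\<nu> \<noteq> 0"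
  shows "coul (\<Omega> \<inter> {x. l < \<nu> \<bullet> x}) (\<Omega> \<inter> {x. \<nu> \<bullet> x \<le> l})
    \<le> ennreal Z * pot (\<Omega> \<inter> {x. l < \<nu> \<bullet> x}) 0 + liminf (\<lambda>n. ennreal (4 * (real (Suc n) * vol (\<Omega> \<inter> slab \<nu> l n))))"
proof -
  have \<Omega>: "borel_fin \<Omega>" using min by (simp add: volume_minimal_def)
  note [measurable] = borel_finD(1)[OF \<Omega>]
  let ?P = "\<Omega> \<inter> {x. l < \<nu> \<bullet> x}" and ?M = "\<Omega> \<inter> {x. \<nu> \<bullet> x \<le> l}"
  let ?s = "\<lambda>n. 4 * (real (Suc n) * vol (\<Omega> \<inter> slab \<nu> l n))"
  have P: "borel_fin ?P" and M: "borel_fin ?M" using \<Omega> by (rule borel_fin_subset; measurable; auto)+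
  have U: "?M \<union> ?P = \<Omega>" and D: "?M \<inter> ?P = {}" by auto
  define L where "L = liminf (\<lambda>n. ereal (?s n))"
  have L0: "0 \<le> L" unfolding L_def by (intro Liminf_bounded always_eventually) auto
  have cut: "perimeter ?P + perimeter ?M \<le> perimeter \<Omega> + L"
    unfolding L_def by (rule perimeter_cut) (use \<Omega> \<nu> in \<open>auto simp: borel_fin_def\<close>)
  have eL: "liminf (\<lambda>n. ennreal (?s n)) = e2ennreal L"
    unfolding L_def
    by (subst Liminf_compose_continuous_mono[of e2ennreal, symmetric])
       (auto simp: continuous_on_e2ennreal mono_def e2ennreal_mono)
  obtain p where p: "perimeter \<Omega> = ereal p"
    using min perimeter_nonneg[of \<Omega>] by (cases "perimeter \<Omega>") (auto simp: volume_minimal_def)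
  show ?thesis
  proof (cases L)
    case (real q)
    have q: "q \<ge> 0" using L0 real by simp
    obtain pP pM where pp: "perimeter ?P = ereal pP" "perimeter ?M = ereal pM"
      using cut perimeter_nonneg[of ?P] perimeter_nonneg[of ?M] unfolding p real
      by (cases "perimeter ?P"; cases "perimeter ?M") auto
    have "coulr ?M ?P \<le> Z * attr ?P + q + \<delta>" if \<delta>: "\<delta> > 0" for \<delta>
    proof -
      obtain t where t: "?M \<inter> (+) t ` ?P = {}"
        "energy Z (?M \<union> (+) t ` ?P) \<le> perimeter ?M + perimeter ?P + ereal (coulr ?M ?M / 2 - Z * attr ?M + coulr ?P ?P / 2 + \<delta>)"
        by (rule energy_split_to_infinity[OF M _ P _ \<nu>(2) Z \<delta>, of l]) auto
      have P': "borel_fin ((+) t ` ?P)" by (rule borel_fin_translate[OF P])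
      have "emeasure lborel (?M \<union> (+) t ` ?P) = emeasure lborel ?M + emeasure lborel ?P"
        using t(1) P P' M by (subst plus_emeasure[symmetric]) (auto simp: borel_fin_def emeasure_translate)
      also have "\<dots> = emeasure lborel \<Omega>"
        using D P M by (subst plus_emeasure) (auto simp: borel_fin_def U)
      finally have "energy Z \<Omega> \<le> energy Z (?M \<union> (+) t ` ?P)"
        using min borel_fin_Un[OF M P'] by (simp add: volume_minimal_def)
      from order_trans[OF this t(2)]
      have "p + (coulr \<Omega> \<Omega> / 2 - Z * attr \<Omega>) \<le> pM + pP + (coulr ?M ?M / 2 - Z * attr ?M + coulr ?P ?P / 2 + \<delta>)"
        by (simp add: energy_borel[OF \<Omega>] p pp)
      moreover have "coulr \<Omega> \<Omega> = coulr ?M ?M + coulr ?P ?P + 2 * coulr ?M ?P"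
        using coulr_Un_Un[OF M P D] unfolding U .
      moreover have "attr \<Omega> = attr ?M + attr ?P"
        using attr_Un[OF M P D] unfolding U .
      moreover have "pP + pM \<le> p + q" using cut unfolding pp p real by simp
      ultimately show ?thesis by (simp add: distrib_left add_divide_distrib)
    qed
    then have "coulr ?M ?P \<le> Z * attr ?P + q" by (rule field_le_epsilon)
    then have "ennreal (coulr ?P ?M) \<le> ennreal (Z * attr ?P + q)"
      using coulr_sym[OF M P] by (intro ennreal_leI) simp
    also have "\<dots> = ennreal Z * pot ?P 0 + e2ennreal L"
      using Z q real pot_finite[of ?P 0] P by (simp add: ennreal_mult ennreal_enn2real borel_fin_def)
    also have "ennreal (coulr ?P ?M) = coul ?P ?M" using coul_finite[OF P M] by (simp add: ennreal_enn2real)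
    finally show ?thesis unfolding eL .
  next
    case PInf
    then show ?thesis unfolding eL by simp
  qed (use L0 in simp)
qed

section \<open>Averaging over parallel cuts that miss a ball\<close>

text \<open>This is the length of the set of levels l > r with l < \<nu> . x, hence the weight that
  x receives when half-spaces are integrated over l > r.\<close>

definition excess :: "R3 \<Rightarrow> real \<Rightarrow> R3 \<Rightarrow> real" where
  "excess \<nu> r x = max 0 (\<nu> \<bullet> x - r)"

lemma excess_measurable [measurable]: "excess \<nu> r \<in> borel_measurable borel"
  unfolding excess_def by measurable

lemma emeasure_Ico_Ioi: "emeasure lborel ({a..<b} \<inter> {r<..}) = ennreal (max 0 (b - r) - max 0 (a - r))" if "a \<le> b" for a b r :: real
proof -
  have "emeasure lborel ({a..<b} \<inter> {r<..}) = emeasure lborel {max a r..<max b r}"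
    by (rule emeasure_eq_AE) (use AE_lborel_singleton[of r] in \<open>auto elim!: eventually_mono\<close>)
  also have "\<dots> = ennreal (max b r - max a r)" using that by (subst emeasure_lborel_Ico) auto
  also have "max b r - max a r = max 0 (b - r) - max 0 (a - r)" by auto
  finally show ?thesis .
qed


text \<open>The integral of \<open>minimal_cut\<close> over the levels l > r. By Tonelli, a pair is
  weighted by the length of the set of levels that leave x above and y below, which is the positive
  part of the difference of their excesses. Fatou's lemma turns the slab terms into a
  volume.\<close>

lemma minimal_cut_integrated:
  assumes min: "volume_minimal Z \<Omega>" and Z: "Z \<ge> 0" and \<nu>: "norm \<nu> \<le> 1" "\<nu> \<noteq> 0"
  shows "(\<integral>\<^sup>+x. \<integral>\<^sup>+y. indicator \<Omega> x * indicator \<Omega> y * ennreal (max 0 (excess \<nu> r x - excess \<nu> r y) / norm (x - y)) \<partial>lborel \<partial>lborel)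
    \<le> ennreal Z * (\<integral>\<^sup>+x. indicator \<Omega> x * ennreal (excess \<nu> r x / norm x) \<partial>lborel)
      + 4 * emeasure lborel (\<Omega> \<inter> {x. r < \<nu> \<bullet> x})"
proof -
  have \<Omega>: "borel_fin \<Omega>" using min by (simp add: volume_minimal_def)
  note [measurable] = borel_finD(1)[OF \<Omega>]
  let ?K = "\<lambda>x y. ennreal (1 / norm (x - y))"
  let ?P = "\<lambda>l. \<Omega> \<inter> {x. l < \<nu> \<bullet> x}" and ?M = "\<lambda>l. \<Omega> \<inter> {x. \<nu> \<bullet> x \<le> l}"
  let ?s = "\<lambda>n l. ennreal (4 * (real (Suc n) * vol (\<Omega> \<inter> slab \<nu> l n)))"
  have ind: "(\<integral>\<^sup>+l. indicator {r<..} l * (indicator {l. l < b} l * indicator {l. a \<le> l} l) \<partial>lborel)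
      = ennreal (max 0 (max 0 (b - r) - max 0 (a - r)))" for a b :: real
  proof (cases "a \<le> b")
    case True
    have "(\<integral>\<^sup>+l. indicator {r<..} l * (indicator {l. l < b} l * indicator {l. a \<le> l} l) \<partial>lborel)
      = (\<integral>\<^sup>+l. indicator ({a..<b} \<inter> {r<..}) l \<partial>lborel)"
      by (intro nn_integral_cong) (auto split: split_indicator)
    also have "\<dots> = ennreal (max 0 (b - r) - max 0 (a - r))" using emeasure_Ico_Ioi[OF True, of r] by simp
    finally show ?thesis using True by (simp add: max_def)
  next
    case False
    then have "(\<integral>\<^sup>+l. indicator {r<..} l * (indicator {l. l < b} l * indicator {l. a \<le> l} l) \<partial>lborel) = (\<integral>\<^sup>+(l::real). 0 \<partial>lborel)"
      by (intro nn_integral_cong) (auto split: split_indicator)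
    also have "\<dots> = ennreal (max 0 (max 0 (b - r) - max 0 (a - r)))" using False by (simp add: max_def)
    finally show ?thesis .
  qed
  have lhs: "(\<integral>\<^sup>+l. indicator {r<..} l * coul (?P l) (?M l) \<partial>lborel)
    = (\<integral>\<^sup>+x. \<integral>\<^sup>+y. indicator \<Omega> x * indicator \<Omega> y * ennreal (max 0 (excess \<nu> r x - excess \<nu> r y) / norm (x - y)) \<partial>lborel \<partial>lborel)"
  proof -
    let ?F = "\<lambda>l x y. (indicator \<Omega> x * indicator \<Omega> y * ?K x y) * (indicator {r<..} l * (indicator {l. l < \<nu> \<bullet> x} l * indicator {l. \<nu> \<bullet> y \<le> l} l)) :: ennreal"
    have [measurable]: "(\<lambda>(l,x,y). ?F l x y) \<in> borel_measurable (borel \<Otimes>\<^sub>M (borel \<Otimes>\<^sub>M borel))"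
      unfolding indicator_def by measurable
    have "(\<integral>\<^sup>+l. indicator {r<..} l * coul (?P l) (?M l) \<partial>lborel) = (\<integral>\<^sup>+l. \<integral>\<^sup>+x. \<integral>\<^sup>+y. ?F l x y \<partial>lborel \<partial>lborel \<partial>lborel)"
      unfolding coul_def pot_def
      by (intro nn_integral_cong) (auto simp: nn_integral_cmult[symmetric] intro!: nn_integral_cong split: split_indicator)
    also have "\<dots> = (\<integral>\<^sup>+x. \<integral>\<^sup>+l. \<integral>\<^sup>+y. ?F l x y \<partial>lborel \<partial>lborel \<partial>lborel)"
      by (rule lborel_pair.Fubini') measurable
    also have "\<dots> = (\<integral>\<^sup>+x. \<integral>\<^sup>+y. \<integral>\<^sup>+l. ?F l x y \<partial>lborel \<partial>lborel \<partial>lborel)"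
      by (intro nn_integral_cong, rule lborel_pair.Fubini') measurable
    also have "\<dots> = (\<integral>\<^sup>+x. \<integral>\<^sup>+y. (indicator \<Omega> x * indicator \<Omega> y * ?K x y) * ennreal (max 0 (excess \<nu> r x - excess \<nu> r y)) \<partial>lborel \<partial>lborel)"
      unfolding excess_def ind[symmetric] by (intro nn_integral_cong nn_integral_cmult) measurable
    also have "\<dots> = (\<integral>\<^sup>+x. \<integral>\<^sup>+y. indicator \<Omega> x * indicator \<Omega> y * ennreal (max 0 (excess \<nu> r x - excess \<nu> r y) / norm (x - y)) \<partial>lborel \<partial>lborel)"
      by (intro nn_integral_cong) (simp add: mult.assoc ennreal_mult'[symmetric])
    finally show ?thesis .
  qed
  have attr: "(\<integral>\<^sup>+l. indicator {r<..} l * pot (?P l) 0 \<partial>lborel) = (\<integral>\<^sup>+x. indicator \<Omega> x * ennreal (excess \<nu> r x / norm x) \<partial>lborel)"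
  proof -
    \<comment> \<open>With the factor for r \<le> l, which follows from r < l, the inner integral
      becomes an instance of \<open>ind\<close> with a = r.\<close>
    let ?F = "\<lambda>l x. (indicator \<Omega> x * ?K 0 x) * (indicator {r<..} l * (indicator {l. l < \<nu> \<bullet> x} l * indicator {l. r \<le> l} l)) :: ennreal"
    have [measurable]: "(\<lambda>(l,x). ?F l x) \<in> borel_measurable (borel \<Otimes>\<^sub>M borel)"
      unfolding indicator_def by measurable
    have "(\<integral>\<^sup>+l. indicator {r<..} l * pot (?P l) 0 \<partial>lborel) = (\<integral>\<^sup>+l. \<integral>\<^sup>+x. ?F l x \<partial>lborel \<partial>lborel)"
      unfolding pot_def
      by (intro nn_integral_cong) (auto simp: nn_integral_cmult[symmetric] intro!: nn_integral_cong split: split_indicator)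
    also have "\<dots> = (\<integral>\<^sup>+x. \<integral>\<^sup>+l. ?F l x \<partial>lborel \<partial>lborel)"
      by (rule lborel_pair.Fubini') measurable
    also have "\<dots> = (\<integral>\<^sup>+x. (indicator \<Omega> x * ?K 0 x) * ennreal (excess \<nu> r x) \<partial>lborel)"
      by (intro nn_integral_cong, subst nn_integral_cmult) (measurable, simp add: ind excess_def)
    also have "\<dots> = (\<integral>\<^sup>+x. indicator \<Omega> x * ennreal (excess \<nu> r x / norm x) \<partial>lborel)"
      by (intro nn_integral_cong) (simp add: mult.assoc ennreal_mult'[symmetric] excess_def)
    finally show ?thesis .
  qed
  have sl: "?s n l = (\<integral>\<^sup>+x. ennreal (4 * real (Suc n)) * (indicator \<Omega> x * indicator {l. l < \<nu> \<bullet> x \<and> \<nu> \<bullet> x < l + 1 / Suc n} l) \<partial>lborel)" for n l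
  proof -
    have f: "borel_fin (\<Omega> \<inter> slab \<nu> l n)" by (rule borel_fin_subset[OF \<Omega>]) auto
    have "?s n l = ennreal (4 * real (Suc n)) * emeasure lborel (\<Omega> \<inter> slab \<nu> l n)"
      unfolding borel_finD(3)[OF f] by (subst ennreal_mult[symmetric]) (auto simp: mult.assoc)
    also have "\<dots> = (\<integral>\<^sup>+x. ennreal (4 * real (Suc n)) * indicator (\<Omega> \<inter> slab \<nu> l n) x \<partial>lborel)"
      by (simp add: nn_integral_cmult)
    also have "\<dots> = (\<integral>\<^sup>+x. ennreal (4 * real (Suc n)) * (indicator \<Omega> x * indicator {l. l < \<nu> \<bullet> x \<and> \<nu> \<bullet> x < l + 1 / Suc n} l) \<partial>lborel)"
      by (intro nn_integral_cong) (auto simp: slab_def split: split_indicator)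
    finally show ?thesis .
  qed
  have sm [measurable]: "?s n \<in> borel_measurable borel" for n
    unfolding sl indicator_def by measurable
  \<comment> \<open>For fixed x the levels whose slab contains x form an interval of length 1 /
    \<open>Suc n\<close>. This cancels the factor \<open>Suc n\<close> and leaves only the
    4.\<close>
  have fatou: "(\<integral>\<^sup>+l. indicator {r<..} l * liminf (\<lambda>n. ?s n l) \<partial>lborel) \<le> 4 * emeasure lborel (\<Omega> \<inter> {x. r < \<nu> \<bullet> x})"
  proof -
    have "(\<integral>\<^sup>+l. indicator {r<..} l * liminf (\<lambda>n. ?s n l) \<partial>lborel) = (\<integral>\<^sup>+l. liminf (\<lambda>n. indicator {r<..} l * ?s n l) \<partial>lborel)"
      by (intro nn_integral_cong) (auto simp: Liminf_const split: split_indicator)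
    also have "\<dots> \<le> liminf (\<lambda>n. \<integral>\<^sup>+l. indicator {r<..} l * ?s n l \<partial>lborel)"
      by (rule nn_integral_liminf) measurable
    also have "\<dots> \<le> liminf (\<lambda>n. 4 * emeasure lborel (\<Omega> \<inter> {x. r < \<nu> \<bullet> x}))"
    proof (intro Liminf_mono always_eventually allI)
      fix n
      let ?G = "\<lambda>l x. (ennreal (4 * real (Suc n)) * indicator \<Omega> x) * (indicator {r<..} l * indicator {l. l < \<nu> \<bullet> x \<and> \<nu> \<bullet> x < l + 1 / Suc n} l)"
      have [measurable]: "(\<lambda>(l,x). ?G l x) \<in> borel_measurable (borel \<Otimes>\<^sub>M borel)"
        unfolding indicator_def by measurable
      have "(\<integral>\<^sup>+l. indicator {r<..} l * ?s n l \<partial>lborel) = (\<integral>\<^sup>+l. \<integral>\<^sup>+x. ?G l x \<partial>lborel \<partial>lborel)"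
        unfolding sl by (intro nn_integral_cong) (auto simp: nn_integral_cmult[symmetric] intro!: nn_integral_cong split: split_indicator)
      also have "\<dots> = (\<integral>\<^sup>+x. \<integral>\<^sup>+l. ?G l x \<partial>lborel \<partial>lborel)"
        by (rule lborel_pair.Fubini') measurable
      also have "\<dots> \<le> (\<integral>\<^sup>+x. (ennreal (4 * real (Suc n)) * indicator \<Omega> x) * (indicator {x. r < \<nu> \<bullet> x} x * ennreal (1 / real (Suc n))) \<partial>lborel)"
      proof (intro nn_integral_mono)
        fix x
        have "(\<integral>\<^sup>+l. ?G l x \<partial>lborel) = (ennreal (4 * real (Suc n)) * indicator \<Omega> x) * (\<integral>\<^sup>+l. indicator {r<..} l * indicator {l. l < \<nu> \<bullet> x \<and> \<nu> \<bullet> x < l + 1 / Suc n} l \<partial>lborel)"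
          by (rule nn_integral_cmult) measurable
        also have "\<dots> \<le> (ennreal (4 * real (Suc n)) * indicator \<Omega> x) * (\<integral>\<^sup>+l. indicator {x. r < \<nu> \<bullet> x} x * indicator {\<nu> \<bullet> x - 1 / Suc n..\<nu> \<bullet> x} l \<partial>lborel)"
          by (intro mult_left_mono nn_integral_mono) (auto split: split_indicator)
        also have "(\<integral>\<^sup>+l. indicator {x. r < \<nu> \<bullet> x} x * indicator {\<nu> \<bullet> x - 1 / Suc n..\<nu> \<bullet> x} l \<partial>lborel) = indicator {x. r < \<nu> \<bullet> x} x * ennreal (1 / real (Suc n))"
          by (subst nn_integral_cmult) auto
        finally show "(\<integral>\<^sup>+l. ?G l x \<partial>lborel) \<le> (ennreal (4 * real (Suc n)) * indicator \<Omega> x) * (indicator {x. r < \<nu> \<bullet> x} x * ennreal (1 / real (Suc n)))" .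
      qed
      also have "\<dots> = (\<integral>\<^sup>+x. 4 * indicator (\<Omega> \<inter> {x. r < \<nu> \<bullet> x}) x \<partial>lborel)"
      proof (intro nn_integral_cong)
        fix x
        have "4 * real (Suc n) * (1 / real (Suc n)) = 4" by (simp del: of_nat_Suc)
        then have "ennreal (4 * real (Suc n)) * ennreal (1 / real (Suc n)) = 4"
          by (subst ennreal_mult[symmetric]) (simp_all del: of_nat_Suc)
        then show "(ennreal (4 * real (Suc n)) * indicator \<Omega> x) * (indicator {x. r < \<nu> \<bullet> x} x * ennreal (1 / real (Suc n))) = 4 * indicator (\<Omega> \<inter> {x. r < \<nu> \<bullet> x}) x"
          by (auto split: split_indicator)
      qed
      also have "\<dots> = 4 * emeasure lborel (\<Omega> \<inter> {x. r < \<nu> \<bullet> x})" by (simp add: nn_integral_cmult)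
      finally show "(\<integral>\<^sup>+l. indicator {r<..} l * ?s n l \<partial>lborel) \<le> 4 * emeasure lborel (\<Omega> \<inter> {x. r < \<nu> \<bullet> x})" .
    qed
    also have "\<dots> = 4 * emeasure lborel (\<Omega> \<inter> {x. r < \<nu> \<bullet> x})" by (simp add: Liminf_const)
    finally show ?thesis .
  qed
  have pm [measurable]: "(\<lambda>l. pot (?P l) 0) \<in> borel_measurable borel"
  proof -
    have "(\<lambda>(l,x). indicator \<Omega> x * (indicator {l. l < \<nu> \<bullet> x} l * ?K 0 x)) \<in> borel_measurable (borel \<Otimes>\<^sub>M borel)"
      unfolding indicator_def by measurable
    then have "(\<lambda>l. \<integral>\<^sup>+x. indicator \<Omega> x * (indicator {l. l < \<nu> \<bullet> x} l * ?K 0 x) \<partial>lborel) \<in> borel_measurable borel"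
      by measurable
    also have "(\<lambda>l. \<integral>\<^sup>+x. indicator \<Omega> x * (indicator {l. l < \<nu> \<bullet> x} l * ?K 0 x) \<partial>lborel) = (\<lambda>l. pot (?P l) 0)"
      unfolding pot_def by (intro ext nn_integral_cong) (auto split: split_indicator)
    finally show ?thesis .
  qed
  have "(\<integral>\<^sup>+l. indicator {r<..} l * coul (?P l) (?M l) \<partial>lborel)
    \<le> (\<integral>\<^sup>+l. ennreal Z * (indicator {r<..} l * pot (?P l) 0) + indicator {r<..} l * liminf (\<lambda>n. ?s n l) \<partial>lborel)"
    using minimal_cut[OF min Z \<nu>] by (intro nn_integral_mono) (auto split: split_indicator)
  also have "\<dots> = (\<integral>\<^sup>+l. ennreal Z * (indicator {r<..} l * pot (?P l) 0) \<partial>lborel) + (\<integral>\<^sup>+l. indicator {r<..} l * liminf (\<lambda>n. ?s n l) \<partial>lborel)"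
    by (rule nn_integral_add) measurable
  also have "(\<integral>\<^sup>+l. ennreal Z * (indicator {r<..} l * pot (?P l) 0) \<partial>lborel) = ennreal Z * (\<integral>\<^sup>+l. indicator {r<..} l * pot (?P l) 0 \<partial>lborel)"
    by (rule nn_integral_cmult) measurable
  also have "ennreal Z * (\<integral>\<^sup>+l. indicator {r<..} l * pot (?P l) 0 \<partial>lborel) + (\<integral>\<^sup>+l. indicator {r<..} l * liminf (\<lambda>n. ?s n l) \<partial>lborel)
    \<le> ennreal Z * (\<integral>\<^sup>+x. indicator \<Omega> x * ennreal (excess \<nu> r x / norm x) \<partial>lborel) + 4 * emeasure lborel (\<Omega> \<inter> {x. r < \<nu> \<bullet> x})"
    unfolding attr by (intro add_left_mono fatou)
  finally show ?thesis unfolding lhs .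
qed

lemma excess_zero: "norm \<nu> \<le> 1 \<Longrightarrow> norm x \<le> r \<Longrightarrow> excess \<nu> r x = 0"
  using norm_cauchy_schwarz[of \<nu> x] mult_right_mono[of "norm \<nu>" 1 "norm x"] by (simp add: excess_def)

lemma excess_nonneg: "0 \<le> excess \<nu> r x"
  by (simp add: excess_def)

lemma excess_le: "norm \<nu> \<le> 1 \<Longrightarrow> r < norm x \<Longrightarrow> excess \<nu> r x \<le> norm x - r"
  using norm_cauchy_schwarz[of \<nu> x] mult_right_mono[of "norm \<nu>" 1 "norm x"] by (simp add: excess_def)

text \<open>By \<open>pot_cball\<close> the nucleus acts at x like the ball of radius R, and this
  ball is covered by the part of \<Omega> within radius r together with the hole. Points of the hole
  are at distance at least norm x - r from x. For R = 0 the left side vanishes.\<close>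

lemma screened_attraction:
  assumes \<Omega>: "borel_fin \<Omega>" and R: "R \<ge> 0" and Z: "Z = 4/3 * pi * R^3" and r: "R \<le> r" "0 < r" and x: "r < norm x"
  shows "ennreal (Z / norm x) \<le> pot (\<Omega> \<inter> cball 0 r) x + ennreal (vol (cball 0 R - \<Omega>) / (norm x - r))"
proof (cases "R = 0")
  case False
  note [measurable] = borel_finD(1)[OF \<Omega>]
  have x0: "x \<noteq> 0" using x r by auto
  let ?h = "cball 0 R - \<Omega>"
  have h: "borel_fin ?h" by (rule borel_fin_subset[OF borel_fin_cball]) auto
  have "ennreal (Z / norm x) = pot (cball 0 R) x"
    unfolding Z using pot_cball[OF x0, of R] R False r x by simp
  also have "\<dots> \<le> pot ((\<Omega> \<inter> cball 0 r) \<union> (?h - \<Omega> \<inter> cball 0 r)) x" using r by (intro pot_mono) auto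
  also have "\<dots> = pot (\<Omega> \<inter> cball 0 r) x + pot (?h - \<Omega> \<inter> cball 0 r) x" by (intro pot_Un) auto
  also have "\<dots> \<le> pot (\<Omega> \<inter> cball 0 r) x + pot ?h x" by (intro add_left_mono pot_mono) auto
  also have "pot ?h x \<le> ennreal (1 / (norm x - r)) * emeasure lborel ?h"
  proof (rule pot_far)
    fix y assume "y \<in> ?h"
    then show "norm x - r \<le> norm (x - y)" using norm_triangle_ineq2[of x y] r by simp
  qed (use x in auto)
  also have "\<dots> = ennreal (vol ?h / (norm x - r))"
    unfolding borel_finD(3)[OF h] using x by (subst ennreal_mult[symmetric]) auto
  finally show ?thesis by (simp add: add_left_mono)
qed (use Z in simp)

text \<open>Pairs with y within radius r have excess 0 at y and contribute \<open>S\<close>, the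
  inner potential weighted by the excess. By screening, \<open>S\<close> offsets the attraction of
  the nucleus except for the hole; there the kernel 1 / (norm x - r) meets an excess of at most norm
  x - r, so the hole costs at most its volume per unit volume of \<open>N\<close>.\<close>

lemma outer_pairs_bound:
  assumes min: "volume_minimal Z \<Omega>" and \<nu>: "norm \<nu> \<le> 1" "\<nu> \<noteq> 0"
    and R: "R \<ge> 0" and Z: "Z = 4/3 * pi * R^3" and r: "R \<le> r" "0 < r"
  defines "N \<equiv> \<Omega> - cball 0 r"
  shows "(\<integral>\<^sup>+x. \<integral>\<^sup>+y. indicator N x * indicator N y * ennreal (max 0 (excess \<nu> r x - excess \<nu> r y) / norm (x - y)) \<partial>lborel \<partial>lborel)
    \<le> ennreal (4 + vol (cball 0 R - \<Omega>)) * emeasure lborel N"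
proof -
  have \<Omega>: "borel_fin \<Omega>" using min by (simp add: volume_minimal_def)
  have Z0: "Z \<ge> 0" unfolding Z using R by simp
  note [measurable] = borel_finD(1)[OF \<Omega>]
  have Nm [measurable]: "N \<in> sets borel" unfolding N_def by measurable
  let ?I = "\<Omega> \<inter> cball 0 r" and ?h = "vol (cball 0 R - \<Omega>)"
  have I: "borel_fin ?I" by (rule borel_fin_subset[OF \<Omega>]) auto
  have N: "borel_fin N" by (rule borel_fin_subset[OF \<Omega>]) (auto simp: N_def)
  let ?f = "excess \<nu> r"
  let ?k = "\<lambda>x y. ennreal (max 0 (?f x - ?f y) / norm (x - y))"
  define S where "S = (\<integral>\<^sup>+x. indicator N x * (ennreal (?f x) * pot ?I x) \<partial>lborel)"
  define L where "L = (\<integral>\<^sup>+x. \<integral>\<^sup>+y. indicator N x * indicator N y * ?k x y \<partial>lborel \<partial>lborel)"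
  have far: "?f x * (1 / norm (x - y)) \<le> 1" if "x \<in> N" "y \<in> ?I" for x y
  proof -
    have "?f x \<le> norm x - r" using that \<nu> by (intro excess_le) (auto simp: N_def)
    also have "\<dots> \<le> norm (x - y)" using that norm_triangle_ineq2[of x y] by auto
    finally show ?thesis by (simp add: divide_le_eq_1)
  qed
  \<comment> \<open>\<open>S\<close> will appear on both sides of an inequality in the extended
    reals, where only finite terms cancel.\<close>
  have S_fin: "S < \<infinity>"
  proof -
    have "ennreal (?f x) * pot ?I x \<le> emeasure lborel ?I" if "x \<in> N" for x
    proof -
      have "ennreal (?f x) * pot ?I x = (\<integral>\<^sup>+y. indicator ?I y * ennreal (?f x * (1 / norm (x - y))) \<partial>lborel)"
        unfolding pot_def
        by (subst nn_integral_cmult[symmetric])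
           (auto intro!: nn_integral_cong simp: excess_nonneg ennreal_mult'[symmetric] split: split_indicator)
      also have "\<dots> \<le> (\<integral>\<^sup>+y. indicator ?I y \<partial>lborel)"
      proof (rule nn_integral_mono)
        fix y show "indicator ?I y * ennreal (?f x * (1 / norm (x - y))) \<le> indicator ?I y"
          using far[OF that, of y] ennreal_leI[of "?f x * (1 / norm (x - y))" 1] by (cases "y \<in> ?I") auto
      qed
      finally show ?thesis by simp
    qed
    then have "S \<le> (\<integral>\<^sup>+x. emeasure lborel ?I * indicator N x \<partial>lborel)"
      unfolding S_def by (intro nn_integral_mono) (auto split: split_indicator)
    also have "\<dots> = emeasure lborel ?I * emeasure lborel N" by (simp add: nn_integral_cmult)
    also have "\<dots> < \<infinity>" using I N by (auto simp: borel_fin_def ennreal_mult_less_top)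
    finally show ?thesis .
  qed
  have lower: "S + L \<le> (\<integral>\<^sup>+x. \<integral>\<^sup>+y. indicator \<Omega> x * indicator \<Omega> y * ?k x y \<partial>lborel \<partial>lborel)"
  proof -
    have "S + L = (\<integral>\<^sup>+x. indicator N x * (ennreal (?f x) * pot ?I x) + (\<integral>\<^sup>+y. indicator N x * indicator N y * ?k x y \<partial>lborel) \<partial>lborel)"
      unfolding S_def L_def by (subst nn_integral_add) auto
    also have "\<dots> = (\<integral>\<^sup>+x. \<integral>\<^sup>+y. indicator N x * (ennreal (?f x) * (indicator ?I y * ennreal (1 / norm (x - y)))) + indicator N x * indicator N y * ?k x y \<partial>lborel \<partial>lborel)"
      unfolding pot_def by (intro nn_integral_cong, subst nn_integral_add) (auto simp: nn_integral_cmult)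
    also have "\<dots> \<le> (\<integral>\<^sup>+x. \<integral>\<^sup>+y. indicator \<Omega> x * indicator \<Omega> y * ?k x y \<partial>lborel \<partial>lborel)"
    proof (intro nn_integral_mono)
      fix x y
      have "?f y = 0" if "y \<in> ?I" using that \<nu> by (intro excess_zero) auto
      then show "indicator N x * (ennreal (?f x) * (indicator ?I y * ennreal (1 / norm (x - y)))) + indicator N x * indicator N y * ?k x y
        \<le> indicator \<Omega> x * indicator \<Omega> y * ?k x y"
        by (auto simp: N_def excess_nonneg ennreal_mult[symmetric] max_def split: split_indicator)
    qed
    finally show ?thesis .
  qed
  have upper: "ennreal Z * (\<integral>\<^sup>+x. indicator \<Omega> x * ennreal (?f x / norm x) \<partial>lborel) \<le> S + ennreal ?h * emeasure lborel N"
  proof -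
    have "ennreal Z * (\<integral>\<^sup>+x. indicator \<Omega> x * ennreal (?f x / norm x) \<partial>lborel) = (\<integral>\<^sup>+x. ennreal Z * (indicator \<Omega> x * ennreal (?f x / norm x)) \<partial>lborel)"
      by (simp add: nn_integral_cmult)
    also have "\<dots> \<le> (\<integral>\<^sup>+x. indicator N x * (ennreal (?f x) * pot ?I x) + ennreal ?h * indicator N x \<partial>lborel)"
    proof (intro nn_integral_mono)
      fix x
      show "ennreal Z * (indicator \<Omega> x * ennreal (?f x / norm x)) \<le> indicator N x * (ennreal (?f x) * pot ?I x) + ennreal ?h * indicator N x"
      proof (cases "x \<in> N")
        case True
        then have xr: "r < norm x" "x \<in> \<Omega>" by (auto simp: N_def)
        have "ennreal Z * ennreal (?f x / norm x) = ennreal (?f x) * ennreal (Z / norm x)"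
          using Z0 by (simp add: ennreal_mult'[symmetric] excess_nonneg)
        also have "\<dots> \<le> ennreal (?f x) * (pot ?I x + ennreal (?h / (norm x - r)))"
          by (intro mult_left_mono screened_attraction[OF \<Omega> R Z r xr(1)]) auto
        also have "\<dots> = ennreal (?f x) * pot ?I x + ennreal (?f x * (?h / (norm x - r)))"
          by (simp add: distrib_left ennreal_mult'[symmetric] excess_nonneg)
        also have "\<dots> \<le> ennreal (?f x) * pot ?I x + ennreal ?h"
        proof (intro add_left_mono ennreal_leI)
          have "?f x * ?h \<le> (norm x - r) * ?h" using excess_le[OF \<nu>(1) xr(1)] by (intro mult_right_mono) auto
          then show "?f x * (?h / (norm x - r)) \<le> ?h" using xr(1) by (simp add: divide_le_eq mult.commute)
        qed
        finally show ?thesis using True xr by simp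
      next
        case False
        then have "?f x = 0" if "x \<in> \<Omega>" using that \<nu> by (intro excess_zero) (auto simp: N_def)
        then show ?thesis by (auto split: split_indicator)
      qed
    qed
    also have "\<dots> = S + ennreal ?h * emeasure lborel N"
      unfolding S_def by (subst nn_integral_add) (auto simp: nn_integral_cmult)
    finally show ?thesis .
  qed
  have "emeasure lborel (\<Omega> \<inter> {x. r < \<nu> \<bullet> x}) \<le> emeasure lborel N"
  proof (rule emeasure_mono)
    have "r < norm x" if "r < \<nu> \<bullet> x" for x
      using that norm_cauchy_schwarz[of \<nu> x] mult_right_mono[OF \<nu>(1), of "norm x"] by simp
    then show "\<Omega> \<inter> {x. r < \<nu> \<bullet> x} \<subseteq> N" by (force simp: N_def)
  qed auto
  then have "S + L \<le> S + ennreal ?h * emeasure lborel N + 4 * emeasure lborel N"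
    using order_trans[OF lower minimal_cut_integrated[OF min Z0 \<nu>, of r]] upper
    by (meson add_mono mult_left_mono order_trans zero_le)
  then have "S + L \<le> S + (ennreal ?h * emeasure lborel N + 4 * emeasure lborel N)" by (simp add: add.assoc)
  then have "L \<le> ennreal ?h * emeasure lborel N + 4 * emeasure lborel N"
    using S_fin by (subst (asm) ennreal_add_left_cancel_le) auto
  also have "\<dots> = ennreal (4 + ?h) * emeasure lborel N"
    by (simp add: distrib_right add.commute)
  finally show ?thesis unfolding L_def .
qed

subsection \<open>Finitely many directions\<close>

text \<open>If coordinate i of x is the largest in absolute value and s is its sign, then the inner
  product with x is at least |x_i| / 3 for every j and both signs t, so the other coordinates are
  tested without leaving the half-space. For i = j and s = t the vector is s e_i. The division by 3
  keeps the norms at most 1.\<close>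

definition dir :: "3 \<times> 3 \<times> real \<times> real \<Rightarrow> R3" where
  "dir = (\<lambda>(i,j,s,t). (2 * s / 3) *\<^sub>R axis i 1 + (t / 3) *\<^sub>R axis j 1)"

definition dirs :: "(3 \<times> 3 \<times> real \<times> real) set" where
  "dirs = UNIV \<times> UNIV \<times> {-1,1} \<times> {-1,1}"

lemma finite_dirs: "finite dirs" and card_dirs: "card dirs = 36"
  by (simp_all add: dirs_def card_cartesian_product)

lemma dir_inner: "dir (i,j,s,t) \<bullet> x = (2 * s * x $ i + t * x $ j) / 3"
  by (simp add: dir_def inner_add_left inner_axis' add_divide_distrib)

lemma dir_norm: "p \<in> dirs \<Longrightarrow> norm (dir p) \<le> 1"
proof -
  assume "p \<in> dirs"
  then obtain i j s t where p: "p = (i,j,s,t)" "\<bar>s\<bar> = 1" "\<bar>t\<bar> = 1" by (auto simp: dirs_def)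
  have "norm (dir p) \<le> norm ((2 * s / 3) *\<^sub>R (axis i 1 :: R3)) + norm ((t / 3) *\<^sub>R (axis j 1 :: R3))"
    unfolding p dir_def prod.case by (rule norm_triangle_ineq)
  also have "\<dots> = 1" using p by (simp add: norm_axis_1 abs_mult)
  finally show ?thesis .
qed

lemma dir_nonzero: "p \<in> dirs \<Longrightarrow> dir p \<noteq> 0"
proof
  assume "p \<in> dirs" "dir p = 0"
  then obtain i j s t where p: "p = (i,j,s,t)" "\<bar>s\<bar> = 1" "\<bar>t\<bar> = 1" by (auto simp: dirs_def)
  have "2 * s * axis i 1 $ i + t * axis i 1 $ j = 0"
    using dir_inner[of i j s t "axis i 1"] \<open>dir p = 0\<close> p(1) by simp
  with p(2,3) show False by (cases "j = i") (auto simp: axis_def)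
qed

text \<open>Far from the origin some coordinate dominates the others, and then the three directions
  \<open>e\<^sub>i\<close> and \<open>2 e\<^sub>i + e\<^sub>j\<close>, up to signs, all lie in the range where the excess is affine.\<close>

lemma excess_separates:
  fixes x y :: R3
  assumes r: "r > 0" and x: "100 * r \<le> norm x" and y: "100 * r \<le> norm y"
  shows "norm (x - y) / 15 \<le> (\<Sum>p\<in>dirs. \<bar>excess (dir p) r x - excess (dir p) r y\<bar>)"
proof -
  define a where "a = x - y"
  define G where "G p = \<bar>excess (dir p) r x - excess (dir p) r y\<bar>" for p
  have G0: "0 \<le> G p" for p by (simp add: G_def)
  have U: "(UNIV :: 3 set) = {1,2,3}" using exhaust_3 by auto
  have l1: "norm z \<le> (\<Sum>k\<in>UNIV. \<bar>z $ k\<bar>)" for z :: R3 by (rule norm_le_l1_cart)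
  have maxc: "\<exists>i. (\<forall>k. \<bar>z $ k\<bar> \<le> \<bar>z $ i\<bar>) \<and> norm z / 3 \<le> \<bar>z $ i\<bar>" for z :: R3
  proof -
    obtain i where i: "\<And>k. \<bar>z $ k\<bar> \<le> \<bar>z $ i\<bar>"
    proof -
      have "Max (range (\<lambda>k. \<bar>z $ k\<bar>)) \<in> range (\<lambda>k. \<bar>z $ k\<bar>)" by (rule Max_in) auto
      then obtain i where "Max (range (\<lambda>k. \<bar>z $ k\<bar>)) = \<bar>z $ i\<bar>"
        unfolding image_iff by blast
      moreover have "\<bar>z $ k\<bar> \<le> Max (range (\<lambda>k. \<bar>z $ k\<bar>))" for k by (rule Max_ge) auto
      ultimately show ?thesis using that[of i] by simp
    qed
    have "(\<Sum>k\<in>UNIV. \<bar>z $ k\<bar>) \<le> (\<Sum>k\<in>(UNIV::3 set). \<bar>z $ i\<bar>)" by (intro sum_mono i)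
    with l1[of z] i show ?thesis by (intro exI[of _ i]) auto
  qed
  have single: "G p \<le> sum G dirs" if "p \<in> dirs" for p
    using that G0 by (intro member_le_sum finite_dirs) auto
  show ?thesis
  proof (cases "8 * r \<le> norm a")
    case True
    obtain m where m: "norm a / 3 \<le> \<bar>a $ m\<bar>" using maxc by blast
    have two: "G (m,m,1,1) + G (m,m,-1,-1) \<le> sum G dirs"
    proof -
      have "sum G {(m,m,1,1), (m,m,-1,-1)} \<le> sum G dirs"
        by (rule sum_mono2[OF finite_dirs]) (auto simp: dirs_def G0)
      then show ?thesis by simp
    qed
    have e: "dir (m,m,1,1) \<bullet> z = z $ m" "dir (m,m,-1,-1) \<bullet> z = - z $ m" for z by (simp_all add: dir_inner)
    \<comment> \<open>The function max 0 (u - r) - max 0 (- u - r) differs from u by at most r, so 2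
      r is lost in total. As 8 r <= norm a, at least norm a / 3 - norm a / 4 = norm a / 12
      remains.\<close>
    have "\<bar>a $ m\<bar> - 2 * r \<le> G (m,m,1,1) + G (m,m,-1,-1)"
      unfolding G_def excess_def e using r by (simp add: a_def max_def abs_if)
    with two m True r show ?thesis unfolding a_def[symmetric] G_def[symmetric] by simp
  next
    case False
    then have d: "\<bar>a $ k\<bar> \<le> 8 * r" for k using component_le_norm_cart[of a k] by simp
    obtain i where i: "\<And>k. \<bar>x $ k\<bar> \<le> \<bar>x $ i\<bar>" "norm x / 3 \<le> \<bar>x $ i\<bar>" using maxc by blast
    define s :: real where "s = (if x $ i \<ge> 0 then 1 else -1)"
    have s: "s \<in> {-1,1}" "s * x $ i = \<bar>x $ i\<bar>" by (auto simp: s_def)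
    \<comment> \<open>33 lies just below 100 / 3. As y differs from x by at most 8 r in each
      coordinate, the inner products of y with the mixed directions are still at least (33 - 2 * 8 -
      8) r / 3 = 3 r, in the affine range of the excess.\<close>
    have big: "33 * r \<le> \<bar>x $ i\<bar>" using i(2) x r by simp
    have yi: "s * y $ i \<ge> \<bar>x $ i\<bar> - 8 * r" using d[of i] s unfolding a_def by (auto simp: s_def split: if_splits)
    have yk: "\<bar>y $ k\<bar> \<le> \<bar>x $ i\<bar> + 8 * r" for k using d[of k] i(1)[of k] unfolding a_def by simp
    have T: "\<bar>2 * s * a $ i + a $ j\<bar> / 3 = G (i,j,s,1)" for j
    proof -
      have "r \<le> dir (i,j,s,1) \<bullet> x" unfolding dir_inner using i(1)[of j] s(2) big r by (simp add: mult.assoc; linarith?)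
      moreover have "r \<le> dir (i,j,s,1) \<bullet> y" unfolding dir_inner using yi yk[of j] big r by (simp add: mult.assoc; linarith?)
      ultimately have "G (i,j,s,1) = \<bar>dir (i,j,s,1) \<bullet> x - dir (i,j,s,1) \<bullet> y\<bar>" by (simp add: G_def excess_def)
      also have "dir (i,j,s,1) \<bullet> x - dir (i,j,s,1) \<bullet> y = (2 * s * a $ i + a $ j) / 3"
        unfolding dir_inner a_def by (simp add: field_simps)
      also have "\<bar>\<dots>\<bar> = \<bar>2 * s * a $ i + a $ j\<bar> / 3" by simp
      finally show ?thesis ..
    qed
    have S: "\<bar>a $ i\<bar> = G (i,i,s,s)"
    proof -
      have e: "dir (i,i,s,s) \<bullet> z = s * z $ i" for z by (simp add: dir_inner)
      have "r \<le> dir (i,i,s,s) \<bullet> x" "r \<le> dir (i,i,s,s) \<bullet> y" unfolding e using s(2) big yi r by simp_all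
      then have "G (i,i,s,s) = \<bar>dir (i,i,s,s) \<bullet> x - dir (i,i,s,s) \<bullet> y\<bar>" by (simp add: G_def excess_def)
      also have "\<dots> = \<bar>s * a $ i\<bar>" unfolding e a_def by (simp add: right_diff_distrib)
      also have "\<dots> = \<bar>a $ i\<bar>" using s(1) by auto
      finally show ?thesis ..
    qed
    have Tsum: "(\<Sum>j\<in>UNIV. G (i,j,s,1)) \<le> sum G dirs"
    proof -
      have "(\<Sum>j\<in>UNIV. G (i,j,s,1)) = sum G ((\<lambda>j. (i,j,s,1)) ` UNIV)"
        by (subst sum.reindex) (auto simp: inj_on_def)
      also have "\<dots> \<le> sum G dirs"
        by (rule sum_mono2[OF finite_dirs]) (use s(1) G0 in \<open>auto simp: dirs_def\<close>)
      finally show ?thesis .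
    qed
    have Ssum: "\<bar>a $ i\<bar> \<le> sum G dirs" unfolding S by (rule single) (use s(1) in \<open>auto simp: dirs_def\<close>)
    have "\<bar>a $ j\<bar> \<le> 3 * G (i,j,s,1) + 2 * \<bar>a $ i\<bar>" for j
      unfolding T[symmetric] using s(1) by auto
    then have "(\<Sum>j\<in>UNIV. \<bar>a $ j\<bar>) \<le> (\<Sum>j\<in>UNIV. 3 * G (i,j,s,1) + 2 * \<bar>a $ i\<bar>)" by (intro sum_mono)
    also have "\<dots> = 3 * (\<Sum>j\<in>UNIV. G (i,j,s,1)) + 6 * \<bar>a $ i\<bar>" by (simp add: sum.distrib sum_distrib_left)
    \<comment> \<open>The mixed directions account for 3 and the direction s e_i for 6; together
      with the 12 of the first case this explains the 15 in the statement.\<close>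
    finally have "norm a \<le> 9 * sum G dirs" using l1[of a] Tsum Ssum by linarith
    moreover have "0 \<le> sum G dirs" using G0 by (intro sum_nonneg)
    ultimately show ?thesis unfolding a_def[symmetric] G_def[symmetric] by linarith
  qed
qed

text \<open>Summed over the directions, the differences of excesses are comparable to norm (x - y)
  for pairs of distant points. This cancels the Coulomb kernel and leaves the square of a volume.
  Each of the 36 directions is used twice, once for each sign of the difference: 15 * 2 * 36 =
  1080.\<close>

lemma outer_volume_bound:
  assumes min: "volume_minimal Z \<Omega>"
    and R: "R \<ge> 0" and Z: "Z = 4/3 * pi * R^3" and r: "R \<le> r" "0 < r"
  shows "(vol (\<Omega> - cball 0 (100 * r)))\<^sup>2
    \<le> 1080 * (4 + vol (cball 0 R - \<Omega>)) * vol (\<Omega> - cball 0 r)"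
proof -
  have \<Omega>: "borel_fin \<Omega>" using min by (simp add: volume_minimal_def)
  note [measurable] = borel_finD(1)[OF \<Omega>]
  let ?N = "\<Omega> - cball 0 r" and ?N' = "\<Omega> - cball 0 (100 * r)" and ?h = "vol (cball 0 R - \<Omega>)"
  let ?f = "\<lambda>p. excess (dir p) r"
  let ?k = "\<lambda>p x y. ennreal (max 0 (?f p x - ?f p y) / norm (x - y))"
  have N: "borel_fin ?N" and N': "borel_fin ?N'" by (rule borel_fin_subset[OF \<Omega>]; auto)+
  have sub: "?N' \<subseteq> ?N" using r by (intro Diff_mono cball_subset_cball_iff[THEN iffD2] order_refl) auto
  define L where "L p = (\<integral>\<^sup>+x. \<integral>\<^sup>+y. indicator ?N x * indicator ?N y * ?k p x y \<partial>lborel \<partial>lborel)" for p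
  have L: "L p \<le> ennreal (4 + ?h) * emeasure lborel ?N" if "p \<in> dirs" for p
    unfolding L_def by (rule outer_pairs_bound[OF min dir_norm[OF that] dir_nonzero[OF that] R Z r])
  have sym: "L p = (\<integral>\<^sup>+x. \<integral>\<^sup>+y. indicator ?N x * indicator ?N y * ?k p y x \<partial>lborel \<partial>lborel)" for p
    unfolding L_def by (subst lborel_pair.Fubini') (auto intro!: nn_integral_cong simp: mult_ac norm_minus_commute)
  have "ennreal (1/15) * (emeasure lborel ?N' * emeasure lborel ?N')
      = (\<integral>\<^sup>+x. \<integral>\<^sup>+y. indicator ?N' x * indicator ?N' y * ennreal (1/15) \<partial>lborel \<partial>lborel)"
    by (simp add: nn_integral_cmult nn_integral_multc mult_ac)
  also have "\<dots> \<le> (\<integral>\<^sup>+x. \<integral>\<^sup>+y. (\<Sum>p\<in>dirs. indicator ?N x * indicator ?N y * ?k p x y + indicator ?N x * indicator ?N y * ?k p y x) \<partial>lborel \<partial>lborel)"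
  proof (rule nn_integral_mono, rule nn_integral_mono_AE, rule AE_mp[OF AE_lborel_singleton], rule AE_I2, rule impI)
    fix x y :: R3 assume xy: "y \<noteq> x"
    show "indicator ?N' x * indicator ?N' y * ennreal (1/15)
      \<le> (\<Sum>p\<in>dirs. indicator ?N x * indicator ?N y * ?k p x y + indicator ?N x * indicator ?N y * ?k p y x)"
    proof (cases "x \<in> ?N' \<and> y \<in> ?N'")
      case True
      then have n: "100 * r \<le> norm x" "100 * r \<le> norm y" "x \<in> ?N" "y \<in> ?N" using sub[THEN subsetD, of x] sub[THEN subsetD, of y] by auto
      have d: "norm (x - y) > 0" using xy by simp
      have "1/15 = (norm (x - y) / 15) / norm (x - y)" using d by simp
      also have "\<dots> \<le> (\<Sum>p\<in>dirs. \<bar>?f p x - ?f p y\<bar>) / norm (x - y)"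
        by (intro divide_right_mono excess_separates r n) auto
      also have "\<dots> = (\<Sum>p\<in>dirs. max 0 (?f p x - ?f p y) / norm (x - y) + max 0 (?f p y - ?f p x) / norm (y - x))"
        unfolding sum_divide_distrib by (intro sum.cong) (auto simp: norm_minus_commute max_def add_divide_distrib[symmetric])
      finally have "ennreal (1/15) \<le> ennreal (\<Sum>p\<in>dirs. max 0 (?f p x - ?f p y) / norm (x - y) + max 0 (?f p y - ?f p x) / norm (y - x))"
        by (rule ennreal_leI)
      also have "\<dots> = (\<Sum>p\<in>dirs. ?k p x y + ?k p y x)"
        by (subst sum_ennreal[symmetric]) auto
      finally show ?thesis using True n by simp
    qed auto
  qed
  also have "\<dots> = (\<Sum>p\<in>dirs. L p + L p)"
  proof -
    have "(\<integral>\<^sup>+x. \<integral>\<^sup>+y. (\<Sum>p\<in>dirs. indicator ?N x * indicator ?N y * ?k p x y + indicator ?N x * indicator ?N y * ?k p y x) \<partial>lborel \<partial>lborel)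
      = (\<Sum>p\<in>dirs. \<integral>\<^sup>+x. (\<integral>\<^sup>+y. indicator ?N x * indicator ?N y * ?k p x y \<partial>lborel) + (\<integral>\<^sup>+y. indicator ?N x * indicator ?N y * ?k p y x \<partial>lborel) \<partial>lborel)"
      by (subst nn_integral_sum[symmetric]) (auto intro!: nn_integral_cong simp: nn_integral_sum nn_integral_add)
    also have "\<dots> = (\<Sum>p\<in>dirs. L p + L p)"
      by (subst (2) sym, intro sum.cong refl, subst nn_integral_add) (auto simp: L_def)
    finally show ?thesis .
  qed
  also have "\<dots> \<le> (\<Sum>p\<in>dirs. 2 * (ennreal (4 + ?h) * emeasure lborel ?N))"
    using add_mono[OF L L] by (intro sum_mono) (simp add: mult_2)
  also have "\<dots> = 72 * (ennreal (4 + ?h) * emeasure lborel ?N)" by (simp add: card_dirs mult.assoc[symmetric])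
  finally have "ennreal (1/15) * (emeasure lborel ?N' * emeasure lborel ?N') \<le> 72 * (ennreal (4 + ?h) * emeasure lborel ?N)" .
  moreover have "ennreal (1/15) * (emeasure lborel ?N' * emeasure lborel ?N') = ennreal (1/15 * (vol ?N' * vol ?N'))"
    unfolding borel_finD(3)[OF N'] by (simp add: ennreal_mult'[symmetric])
  moreover have "72 * (ennreal (4 + ?h) * emeasure lborel ?N) = ennreal (72 * ((4 + ?h) * vol ?N))"
    unfolding borel_finD(3)[OF N] by (simp add: ennreal_mult' del: ennreal_plus)
  ultimately have "ennreal (1/15 * (vol ?N' * vol ?N')) \<le> ennreal (72 * ((4 + ?h) * vol ?N))"
    by simp
  then have "1/15 * (vol ?N' * vol ?N') \<le> 72 * ((4 + ?h) * vol ?N)"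
    by (subst (asm) ennreal_le_iff) auto
  then show ?thesis by (simp add: power2_eq_square algebra_simps)
qed

subsection \<open>Comparison with a ball and many small droplets\<close>

text \<open>Only independence of a matters. With pi < 4 the volume is at most 6 and the potential at
  most 32 + 6, whence 38 * 6 = 228.\<close>

lemma coulr_droplet:
  assumes "0 < a" "a \<le> 1" shows "coulr (cball 0 a) (cball 0 a) \<le> 228"
proof -
  have b: "borel_fin (cball (0::R3) a)" by (rule borel_fin_cball)
  define v where "v = 4/3 * pi * a^3"
  have v: "0 \<le> v" "v \<le> 6"
  proof -
    have "pi * a^3 \<le> 4 * 1" using assms pi_less_4 by (intro mult_mono power_le_one) auto
    then show "v \<le> 6" by (simp add: v_def)
  qed (use assms in \<open>simp add: v_def\<close>)
  have "coul (cball 0 a) (cball 0 a) \<le> (ennreal (8 * pi) + ennreal v) * ennreal v"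
    using coul_le_volume[OF b b] assms by (simp add: emeasure_cball_R3 v_def)
  also have "\<dots> = ennreal ((8 * pi + v) * v)"
    using v by (simp add: ennreal_mult)
  finally have "coulr (cball 0 a) (cball 0 a) \<le> (8 * pi + v) * v"
    using v by (intro enn2real_leI) auto
  also have "\<dots> \<le> (32 + 6) * 6" using v pi_less_4 by (intro mult_mono) auto
  finally show ?thesis by simp
qed

text \<open>A droplet costs at most 128 for its perimeter, 114 for its self-energy and 1 for its
  interaction with the rest, rounded up to 300. Boundedness is carried along so that a plane with
  the whole set on one side is available for the next droplet.\<close>

lemma add_droplets:
  assumes A: "borel_fin A" "bounded A" and a: "0 < a" "a \<le> 1" and Z: "Z \<ge> 0"
  shows "\<exists>A'. borel_fin A' \<and> bounded A' \<and> vol A' = vol A + real k * (4/3 * pi * a^3)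
    \<and> energy Z A' \<le> energy Z A + ereal (300 * real k)"
proof (induction k)
  case 0
  then show ?case using A by (intro exI[of _ A]) auto
next
  case (Suc k)
  then obtain A' where A': "borel_fin A'" "bounded A'" "vol A' = vol A + real k * (4/3 * pi * a^3)"
    "energy Z A' \<le> energy Z A + ereal (300 * real k)" by blast
  obtain l where l: "\<And>x. x \<in> A' \<Longrightarrow> norm x \<le> l" using A'(2) by (auto simp: bounded_iff)
  define \<nu> :: R3 where "\<nu> = axis 1 1"
  have \<nu>: "norm \<nu> = 1" "\<nu> \<noteq> 0" by (auto simp: \<nu>_def norm_axis_1)
  \<comment> \<open>Places the droplet strictly beyond the plane \<nu> . x = l; from there it is
    sent away.\<close>
  define c where "c = (l + a + 1) *\<^sub>R \<nu>"
  let ?C = "cball (0::R3) a"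
  let ?b = "(+) c ` ?C"
  have C: "borel_fin ?C" by (rule borel_fin_cball)
  have b: "borel_fin ?b" by (rule borel_fin_translate[OF C])
  have A'l: "A' \<subseteq> {x. \<nu> \<bullet> x \<le> l}"
    using l norm_cauchy_schwarz[of \<nu>] \<nu> by (force intro: order_trans)
  have bl: "?b \<subseteq> {x. l < \<nu> \<bullet> x}"
  proof safe
    fix z :: R3 assume "z \<in> ?C"
    then have "\<nu> \<bullet> (- z) \<le> a" using norm_cauchy_schwarz[of \<nu> "- z"] \<nu> by simp
    moreover have "\<nu> \<bullet> (c + z) = l + a + 1 - \<nu> \<bullet> (- z)"
      using \<nu> by (simp add: c_def inner_add_right power2_norm_eq_inner[symmetric])
    ultimately show "l < \<nu> \<bullet> (c + z)" by linarith
  qed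
  obtain t where t: "A' \<inter> (+) t ` ?b = {}"
    "energy Z (A' \<union> (+) t ` ?b) \<le> perimeter A' + perimeter ?b + ereal (coulr A' A' / 2 - Z * attr A' + coulr ?b ?b / 2 + 1)"
    by (rule energy_split_to_infinity[OF A'(1) A'l b bl \<nu>(2) Z zero_less_one])
  let ?A = "A' \<union> (+) t ` ?b"
  have b': "borel_fin ((+) t ` ?b)" by (rule borel_fin_translate[OF b])
  have meas: "vol ?A = vol A' + 4/3 * pi * a^3"
  proof -
    have "vol ?A = vol A' + vol ((+) t ` ?b)"
      using A'(1) b' t(1) by (intro measure_Un3[THEN trans]) (auto simp: borel_fin_def fmeasurable_def)
    also have "vol ((+) t ` ?b) = 4/3 * pi * a^3"
      using a by (simp add: measure_def emeasure_translate borel_finD[OF b] borel_finD[OF C] emeasure_cball_R3)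
    finally show ?thesis .
  qed
  have "perimeter ?b \<le> ereal (32 * pi * a\<^sup>2)"
    using perimeter_translate[OF borel_finD(1)[OF C]] perimeter_cball[OF a(1)] by (rule order_trans)
  also have "\<dots> \<le> ereal 128"
  proof -
    have "pi * a\<^sup>2 \<le> 4 * 1" using a pi_less_4 by (intro mult_mono power_le_one) auto
    then show ?thesis by simp
  qed
  finally have "perimeter ?b \<le> ereal 128" .
  moreover have "coulr ?b ?b \<le> 228"
    using coulr_droplet[OF a] by (simp only: coul_translate[OF borel_finD(1)[OF C] borel_finD(1)[OF C]])
  ultimately have "energy Z ?A \<le> perimeter A' + ereal 128 + ereal (coulr A' A' / 2 - Z * attr A' + 228 / 2 + 1)"
    by (intro order_trans[OF t(2)] add_mono order_refl) simp_all
  also have "\<dots> \<le> energy Z A' + ereal 300"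
    unfolding energy_borel[OF A'(1)] by (cases "perimeter A'") auto
  also have "\<dots> \<le> energy Z A + ereal (300 * real k) + ereal 300" by (intro add_right_mono A')
  also have "\<dots> = energy Z A + ereal (300 * real (Suc k))" by (simp add: add.assoc algebra_simps)
  finally have "energy Z ?A \<le> energy Z A + ereal (300 * real (Suc k))" .
  moreover have "bounded ?A"
    using A'(2) by (auto intro!: bounded_translation)
  moreover have "vol ?A = vol A + real (Suc k) * (4/3 * pi * a^3)"
    unfolding meas A'(3) by (simp add: algebra_simps)
  ultimately show ?case using borel_fin_Un[OF A'(1) b'] by blast
qed

text \<open>The competitor is the ball of volume Z with droplets of total volume Q. The perimeter of
  \<Omega> on the other side is nonnegative and is discarded, so the conclusion concerns only
  Coulomb and attraction terms.\<close>

lemma minimal_energy_le: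
  assumes min: "volume_minimal Z \<Omega>" and R: "R > 0" and Z: "Z = 4/3 * pi * R^3"
    and V: "vol \<Omega> = Z + Q" and Q: "Q \<ge> 1"
  shows "coulr \<Omega> \<Omega> / 2 - Z * attr \<Omega> \<le> 32 * pi * R\<^sup>2 + 600 * Q + coulr (cball 0 R) (cball 0 R) / 2 - Z * attr (cball 0 R)"
proof -
  have \<Omega>: "borel_fin \<Omega>" using min by (simp add: volume_minimal_def)
  let ?B = "cball (0::R3) R"
  have B: "borel_fin ?B" by (rule borel_fin_cball)
  have Z0: "Z \<ge> 0" unfolding Z using R by simp
  \<comment> \<open>Rounding up makes each droplet of volume Q / k at most 1, and Q >= 1 gives k <=
    2 Q, so that 300 per droplet becomes 600 Q.\<close>
  define k where "k = nat \<lceil>Q\<rceil>"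
  have k: "Q \<le> real k" "real k \<le> 2 * Q" "real k > 0" unfolding k_def using Q by linarith+
  \<comment> \<open>Chosen so that the k droplets have total volume exactly Q.\<close>
  define a where "a = root 3 (3 * Q / (4 * pi * real k))"
  have a3: "a^3 = 3 * Q / (4 * pi * real k)" unfolding a_def using Q k by (intro real_root_pow_pos2) auto
  have a0: "a > 0" unfolding a_def using Q k by (intro real_root_gt_zero) auto
  have "a^3 \<le> 1^3"
  proof -
    have "3 * Q \<le> 12 * real k" using k Q by linarith
    also have "\<dots> \<le> 4 * pi * real k" using pi_gt3 k by simp
    finally show ?thesis unfolding a3 using k by (simp add: divide_le_eq_1)
  qed
  then have a1: "a \<le> 1" using a0 by (simp add: power_le_one_iff)
  obtain A where A: "borel_fin A" "vol A = vol ?B + real k * (4/3 * pi * a^3)"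
    "energy Z A \<le> energy Z ?B + ereal (300 * real k)"
    using add_droplets[OF B bounded_cball a0 a1 Z0, of k] by blast
  have "vol ?B = Z" using R by (simp add: measure_def emeasure_cball_R3 Z)
  moreover have "real k * (4/3 * pi * a^3) = Q" unfolding a3 using k by simp
  ultimately have "emeasure lborel A = emeasure lborel \<Omega>"
    using A(2) V by (simp add: borel_finD(3)[OF A(1)] borel_finD(3)[OF \<Omega>])
  then have "energy Z \<Omega> \<le> energy Z A" using min A(1) by (simp add: volume_minimal_def)
  also note A(3)
  also have "energy Z ?B + ereal (300 * real k) \<le> ereal (32 * pi * R\<^sup>2) + ereal (coulr ?B ?B / 2 - Z * attr ?B) + ereal (600 * Q)"
    unfolding energy_borel[OF B] using k by (intro add_mono perimeter_cball R) auto
  finally have "energy Z \<Omega> \<le> ereal (32 * pi * R\<^sup>2 + (coulr ?B ?B / 2 - Z * attr ?B) + 600 * Q)" by simp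
  moreover have "ereal (coulr \<Omega> \<Omega> / 2 - Z * attr \<Omega>) \<le> energy Z \<Omega>"
    unfolding energy_borel[OF \<Omega>] using add_right_mono[OF perimeter_nonneg[of \<Omega>]] by simp
  ultimately have "ereal (coulr \<Omega> \<Omega> / 2 - Z * attr \<Omega>) \<le> ereal (32 * pi * R\<^sup>2 + (coulr ?B ?B / 2 - Z * attr ?B) + 600 * Q)"
    by (rule order_trans[rotated])
  then show ?thesis by simp
qed

text \<open>The net potential of the nucleus and a ball of opposite charge, by Newton's theorem.\<close>

definition screened :: "real \<Rightarrow> R3 \<Rightarrow> real" where
  "screened R x = (if norm x \<ge> R then 0 else 4/3 * pi * R^3 / norm x - 2 * pi * (R\<^sup>2 - (norm x)\<^sup>2/3))"

text \<open>With s = norm x the difference of the two sides is 4 pi (R - s)^3 / (3 s). The quadratic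
  growth in the depth R - s is what makes deep holes expensive in \<open>hole_bound\<close>.\<close>

lemma screened_ge:
  assumes "x \<noteq> 0" "norm x \<le> R" shows "2 * pi * (R - norm x)\<^sup>2 \<le> screened R x"
proof (cases "norm x = R")
  case False
  define s where "s = norm x"
  have s: "0 < s" "s < R" using assms False by (auto simp: s_def)
  have "4/3 * pi * R^3 / s - 2 * pi * (R\<^sup>2 - s\<^sup>2/3) - 2 * pi * (R - s)\<^sup>2 = 4 * pi / (3 * s) * (R - s)^3"
    using s by (simp add: field_simps power2_eq_square power3_eq_cube)
  moreover have "0 \<le> 4 * pi / (3 * s) * (R - s)^3" using s by simp
  ultimately have "2 * pi * (R - s)\<^sup>2 \<le> 4/3 * pi * R^3 / s - 2 * pi * (R\<^sup>2 - s\<^sup>2/3)" by linarith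
  moreover have "(R \<le> norm x) = False" using s by (simp add: s_def)
  ultimately show ?thesis unfolding screened_def s_def by (simp only: if_False)
qed (simp add: screened_def)

lemma screened_measurable [measurable]: "screened R \<in> borel_measurable borel"
  unfolding screened_def by measurable

text \<open>Measures how much more the nucleus attracts A than a ball of the same charge would. For
  R > 0 the value of \<open>screened\<close> at the origin is negative because 1/0 = 0;
  \<open>ennreal\<close> replaces it by 0 on this null set.\<close>

definition deficit :: "real \<Rightarrow> R3 set \<Rightarrow> ennreal" where
  "deficit R A = (\<integral>\<^sup>+x. indicator A x * ennreal (screened R x) \<partial>lborel)"

lemma attraction_eq:
  assumes A: "borel_fin A" and R: "R > 0"
  shows "ennreal (4/3 * pi * R^3) * pot A 0 = coul A (cball 0 R) + deficit R A"
proof -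
  note [measurable] = borel_finD(1)[OF A]
  have "ennreal (4/3 * pi * R^3) * pot A 0 = (\<integral>\<^sup>+x. indicator A x * ennreal (4/3 * pi * R^3 / norm x) \<partial>lborel)"
    unfolding pot_def using R
    by (subst nn_integral_cmult[symmetric]) (auto intro!: nn_integral_cong simp: ennreal_mult'[symmetric] split: split_indicator)
  also have "\<dots> = (\<integral>\<^sup>+x. indicator A x * pot (cball 0 R) x + indicator A x * ennreal (screened R x) \<partial>lborel)"
  proof (rule nn_integral_cong_AE, rule AE_mp[OF AE_lborel_singleton[of 0]], rule AE_I2, rule impI)
    fix x :: R3 assume x: "x \<noteq> 0"
    have "ennreal (4/3 * pi * R^3 / norm x) = pot (cball 0 R) x + ennreal (screened R x)"
    proof (cases "norm x \<ge> R")
      case True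
      then show ?thesis by (simp add: pot_cball[OF x R] screened_def)
    next
      case False
      have "(norm x)\<^sup>2 \<le> R\<^sup>2" using False by (intro power_mono) auto
      then have "(norm x)\<^sup>2/3 \<le> R\<^sup>2" using zero_le_power2[of "norm x"] by linarith
      then have "0 \<le> 2 * pi * (R\<^sup>2 - (norm x)\<^sup>2/3)" by simp
      moreover have "0 \<le> screened R x" using screened_ge[OF x] False
        by (meson less_imp_le not_le order_trans pi_ge_zero mult_nonneg_nonneg zero_le_numeral zero_le_power2)
      moreover have "4/3 * pi * R^3 / norm x = 2 * pi * (R\<^sup>2 - (norm x)\<^sup>2/3) + screened R x"
        using False by (simp add: screened_def)
      ultimately show ?thesis using False by (simp only: pot_cball[OF x R] if_False ennreal_plus)
    qed
    then show "indicator A x * ennreal (4/3 * pi * R^3 / norm x) = indicator A x * pot (cball 0 R) x + indicator A x * ennreal (screened R x)"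
      by (simp add: distrib_left)
  qed
  also have "\<dots> = coul A (cball 0 R) + deficit R A"
    unfolding coul_def deficit_def by (rule nn_integral_add) measurable
  finally show ?thesis .
qed

lemma deficit_finite:
  assumes A: "borel_fin A" and R: "R > 0" shows "deficit R A < \<infinity>"
proof -
  have "deficit R A \<le> ennreal (4/3 * pi * R^3) * pot A 0" unfolding attraction_eq[OF A R] by simp
  also have "\<dots> < \<infinity>" using pot_finite[of A 0] A by (simp add: borel_fin_def ennreal_mult_less_top)
  finally show ?thesis .
qed

lemma attr_eq:
  assumes A: "borel_fin A" and R: "R > 0"
  shows "4/3 * pi * R^3 * attr A = coulr A (cball 0 R) + enn2real (deficit R A)"
proof -
  have "4/3 * pi * R^3 * attr A = enn2real (ennreal (4/3 * pi * R^3) * pot A 0)"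
    using R by (simp add: enn2real_mult)
  also have "\<dots> = coulr A (cball 0 R) + enn2real (deficit R A)"
    unfolding attraction_eq[OF A R] using coul_finite[OF A borel_fin_cball] deficit_finite[OF A R]
    by (intro enn2real_plus) auto
  finally show ?thesis .
qed

lemma deficit_Un:
  assumes "borel_fin A" "borel_fin B" "A \<inter> B = {}" "R > 0"
  shows "enn2real (deficit R (A \<union> B)) = enn2real (deficit R A) + enn2real (deficit R B)"
proof -
  note [measurable] = borel_finD(1)[OF assms(1)] borel_finD(1)[OF assms(2)]
  have "deficit R (A \<union> B) = deficit R A + deficit R B"
    unfolding deficit_def using assms(3)
    by (subst nn_integral_add[symmetric]) (auto intro!: nn_integral_cong split: split_indicator)
  then show ?thesis using deficit_finite assms by (simp add: enn2real_plus)
qed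

lemma deficit_outside: "deficit R (A - cball 0 R) = 0"
proof -
  have "indicator (A - cball 0 R) x * ennreal (screened R x) = 0" for x
    by (auto simp: screened_def split: split_indicator)
  then show ?thesis by (simp only: deficit_def nn_integral_const mult_zero_left)
qed

section \<open>Bounds for the hole and for the charge near the ball\<close>

lemma coulr_pos_def:
  assumes "borel_fin A" "borel_fin B" "borel_fin T" and c: "c \<ge> 0"
  shows "2 * (coulr A B + c * coulr A T) \<le> coulr A A + coulr B B + 2 * c * coulr B T + c\<^sup>2 * coulr T T"
proof -
  have e: "ennreal (coulr X Y) = coul X Y" if "borel_fin X" "borel_fin Y" for X Y
    using coul_finite[OF that] by (simp add: ennreal_enn2real)
  have "2 * (coul A B + ennreal c * coul A T) \<le> coul A A + (coul B B + 2 * ennreal c * coul B T + ennreal c * ennreal c * coul T T)"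
    using assms by (intro coul_pos_def) (auto simp: borel_fin_def)
  moreover have "2 * (coul A B + ennreal c * coul A T) = ennreal (2 * (coulr A B + c * coulr A T))"
    using c by (simp add: e assms ennreal_mult')
  moreover have "coul A A + (coul B B + 2 * ennreal c * coul B T + ennreal c * ennreal c * coul T T)
      = ennreal (coulr A A + (coulr B B + 2 * c * coulr B T + c * c * coulr T T))"
    using c by (simp add: e assms ennreal_mult' )
  ultimately have "ennreal (2 * (coulr A B + c * coulr A T)) \<le> ennreal (coulr A A + (coulr B B + 2 * c * coulr B T + c * c * coulr T T))"
    by simp
  then show ?thesis using c by (subst (asm) ennreal_le_iff) (auto simp: power2_eq_square intro!: add_nonneg_nonneg mult_nonneg_nonneg)
qed

text \<open>Let D be the Coulomb form and rho the charge of \<Omega> minus that of the ball. By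
  \<open>attr_eq\<close>, \<open>minimal_energy_le\<close> becomes D(rho, rho) / 2 + deficit of the
  hole <= 32 pi R^2 + 600 Q, since the deficits on the common part cancel and there is none outside
  the ball. Positive definiteness bounds D(rho, rho) / 2 from below by c D(rho, T) - c^2 D(T, T) /
  2.\<close>

lemma screening_inequality:
  assumes min: "volume_minimal Z \<Omega>" and R: "R > 0" and Z: "Z = 4/3 * pi * R^3"
    and V: "vol \<Omega> = Z + Q" and Q: "Q \<ge> 1" and T: "borel_fin T" and c: "c \<ge> 0"
  shows "enn2real (deficit R (cball 0 R - \<Omega>)) + c * (coulr (\<Omega> - cball 0 R) T - coulr (cball 0 R - \<Omega>) T) - c\<^sup>2 / 2 * coulr T T
    \<le> 32 * pi * R\<^sup>2 + 600 * Q"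
proof -
  have \<Omega>: "borel_fin \<Omega>" using min by (simp add: volume_minimal_def)
  let ?B = "cball (0::R3) R" and ?d = "\<lambda>A. enn2real (deficit R A)"
  have B: "borel_fin ?B" by (rule borel_fin_cball)
  have D: "borel_fin (?B - \<Omega>)" "borel_fin (\<Omega> - ?B)" "borel_fin (\<Omega> \<inter> ?B)"
    using borel_fin_subset[OF B, of "?B - \<Omega>"] borel_fin_subset[OF \<Omega>, of "\<Omega> - ?B"] borel_fin_subset[OF \<Omega>, of "\<Omega> \<inter> ?B"] borel_finD(1)[OF \<Omega>]
    by auto
  have U: "(\<Omega> \<inter> ?B) \<union> (?B - \<Omega>) = ?B" "(\<Omega> \<inter> ?B) \<union> (\<Omega> - ?B) = \<Omega>" by auto
  have "?d ?B = ?d (\<Omega> \<inter> ?B) + ?d (?B - \<Omega>)"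
    using deficit_Un[OF D(3) D(1) _ R] unfolding U by auto
  moreover have "?d \<Omega> = ?d (\<Omega> \<inter> ?B)"
    using deficit_Un[OF D(3) D(2) _ R] unfolding U by (auto simp: deficit_outside)
  moreover have "coulr ?B T = coulr (\<Omega> \<inter> ?B) T + coulr (?B - \<Omega>) T"
    using coulr_Un_left[OF D(3) D(1) T] unfolding U by auto
  moreover have "coulr \<Omega> T = coulr (\<Omega> \<inter> ?B) T + coulr (\<Omega> - ?B) T"
    using coulr_Un_left[OF D(3) D(2) T] unfolding U by auto
  moreover have "Z * attr \<Omega> = coulr \<Omega> ?B + ?d \<Omega>" "Z * attr ?B = coulr ?B ?B + ?d ?B"
    unfolding Z by (rule attr_eq[OF _ R]; fact)+
  moreover note minimal_energy_le[OF min R Z V Q] coulr_pos_def[OF \<Omega> B T c]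
  ultimately show ?thesis by (simp add: algebra_simps)
qed

text \<open>The part of the hole at depth at least \<delta> is controlled by its deficit, the rest
  by the volume of a shell. The depth stays free: a large \<delta> makes the coefficient of Q small
  at the price of a large multiple of R^2.\<close>

lemma hole_bound:
  assumes min: "volume_minimal Z \<Omega>" and R: "R > 0" and Z: "Z = 4/3 * pi * R^3"
    and V: "vol \<Omega> = Z + Q" and Q: "Q \<ge> 1" and \<delta>: "\<delta> > 0"
  shows "vol (cball 0 R - \<Omega>) \<le> 4 * pi * R\<^sup>2 * \<delta> + (32 * pi * R\<^sup>2 + 600 * Q) / (2 * pi * \<delta>\<^sup>2)"
proof -
  have \<Omega>: "borel_fin \<Omega>" using min by (simp add: volume_minimal_def)
  note [measurable] = borel_finD(1)[OF \<Omega>]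
  let ?B = "cball (0::R3) R"
  let ?h = "?B - \<Omega>"
  let ?s = "cball (0::R3) (R - \<delta>)"
  have h: "borel_fin ?h" by (rule borel_fin_subset[OF borel_fin_cball]) auto
  have h1: "borel_fin (?h \<inter> ?s)" and h2: "borel_fin (?h - ?s)" by (rule borel_fin_subset[OF h]; auto)+
  have "vol (?h - ?s) \<le> 4 * pi * R\<^sup>2 * \<delta>"
  proof (cases "\<delta> < R")
    case True
    have "borel_fin (?B - ?s)" by (rule borel_fin_subset[OF borel_fin_cball]) auto
    then have "vol (?h - ?s) \<le> vol (?B - ?s)"
      by (intro measure_mono_fmeasurable) (auto simp: borel_fin_def fmeasurable_def)
    also have "\<dots> \<le> 4 * pi * R\<^sup>2 * (R - (R - \<delta>))" using True \<delta> by (intro shell_volume) auto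
    finally show ?thesis by simp
  next
    case False
    have "vol (?h - ?s) \<le> vol ?B"
      using borel_fin_cball[of "0::R3" R] by (intro measure_mono_fmeasurable) (auto simp: borel_fin_def fmeasurable_def)
    also have "\<dots> = 4/3 * pi * R\<^sup>2 * R" using R by (simp add: measure_def emeasure_cball_R3 power2_eq_square power3_eq_cube)
    also have "\<dots> \<le> 4 * pi * R\<^sup>2 * \<delta>" using False R by (intro mult_mono) auto
    finally show ?thesis .
  qed
  moreover have "vol (?h \<inter> ?s) \<le> (32 * pi * R\<^sup>2 + 600 * Q) / (2 * pi * \<delta>\<^sup>2)"
  proof -
    have "ennreal (2 * pi * \<delta>\<^sup>2 * vol (?h \<inter> ?s)) = (\<integral>\<^sup>+x. ennreal (2 * pi * \<delta>\<^sup>2) * indicator (?h \<inter> ?s) x \<partial>lborel)"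
      by (simp add: nn_integral_cmult borel_finD(3)[OF h1] ennreal_mult')
    also have "\<dots> \<le> deficit R ?h" unfolding deficit_def
    proof (rule nn_integral_mono_AE, rule AE_mp[OF AE_lborel_singleton[of 0]], rule AE_I2, rule impI)
      fix x :: R3 assume x: "x \<noteq> 0"
      show "ennreal (2 * pi * \<delta>\<^sup>2) * indicator (?h \<inter> ?s) x \<le> indicator ?h x * ennreal (screened R x)"
      proof (cases "x \<in> ?h \<inter> ?s")
        case True
        then have n: "norm x \<le> R - \<delta>" by simp
        then have "\<delta>\<^sup>2 \<le> (R - norm x)\<^sup>2" using \<delta> by (intro power_mono) auto
        then have "2 * pi * \<delta>\<^sup>2 \<le> 2 * pi * (R - norm x)\<^sup>2" by simp
        also have "\<dots> \<le> screened R x" using n \<delta> by (intro screened_ge x) auto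
        finally show ?thesis using True by (auto intro: ennreal_leI)
      qed simp
    qed
    also have "deficit R ?h = ennreal (enn2real (deficit R ?h))"
      using deficit_finite[OF h R] by (simp add: ennreal_enn2real)
    finally have "2 * pi * \<delta>\<^sup>2 * vol (?h \<inter> ?s) \<le> enn2real (deficit R ?h)"
      by (subst (asm) ennreal_le_iff) auto
    \<comment> \<open>Taking c = 0 in \<open>screening_inequality\<close> leaves the deficit
      alone.\<close>
    also have "\<dots> \<le> 32 * pi * R\<^sup>2 + 600 * Q"
      using screening_inequality[OF min R Z V Q borel_fin_cball[of 0 R] order_refl] by simp
    finally show ?thesis using \<delta> by (simp add: pos_le_divide_eq mult.commute)
  qed
  moreover have "vol ?h = vol (?h \<inter> ?s) + vol (?h - ?s)"
  proof -
    have "vol ((?h \<inter> ?s) \<union> (?h - ?s)) = vol (?h \<inter> ?s) + vol (?h - ?s)"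
      using h1 h2 by (intro measure_Union) (auto simp: borel_fin_def)
    then show ?thesis by (simp add: Int_Diff_Un)
  qed
  ultimately show ?thesis by linarith
qed

text \<open>The test charge is uniform on the ball of radius \<open>\<tau>\<close>, with the optimal density.\<close>

lemma near_charge_bound:
  assumes min: "volume_minimal Z \<Omega>" and R: "R > 0" and Z: "Z = 4/3 * pi * R^3"
    and V: "vol \<Omega> = Z + Q" and Q: "Q \<ge> 1" and \<tau>: "R \<le> \<tau>"
  defines "q \<equiv> vol (\<Omega> \<inter> cball 0 \<tau> - cball 0 R) - 3/2 * vol (cball 0 R - \<Omega>)"
  assumes q: "q \<ge> 0"
  shows "q\<^sup>2 \<le> 3 * \<tau> * (32 * pi * R\<^sup>2 + 600 * Q)"
proof -
  have \<Omega>: "borel_fin \<Omega>" using min by (simp add: volume_minimal_def)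
  note [measurable] = borel_finD(1)[OF \<Omega>]
  have \<tau>0: "\<tau> > 0" using R \<tau> by simp
  let ?T = "cball (0::R3) \<tau>" and ?B = "cball (0::R3) R"
  let ?h = "?B - \<Omega>" and ?N = "\<Omega> - ?B" and ?D = "\<Omega> \<inter> ?T - ?B"
  have T: "borel_fin ?T" by (rule borel_fin_cball)
  have h: "borel_fin ?h" by (rule borel_fin_subset[OF borel_fin_cball]) auto
  have N: "borel_fin ?N" and D: "borel_fin ?D" by (rule borel_fin_subset[OF \<Omega>]; auto)+
  have ND: "borel_fin (?N - ?D)" by (rule borel_fin_subset[OF N]) auto
  \<comment> \<open>Within its own ball the potential of the test charge ranges from 4/3 pi \<tau>^2
    at the surface to 2 pi \<tau>^2 towards the centre. The ratio 3/2 of these bounds is the weight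
    of the hole in \<open>q\<close>.\<close>
  have pot_upper: "pot ?T x \<le> ennreal (2 * pi * \<tau>\<^sup>2)" if x: "x \<noteq> 0" "norm x \<le> \<tau>" for x
    using x \<tau>0 by (auto simp: pot_cball[OF x(1) \<tau>0] power2_eq_square power3_eq_cube field_simps intro!: ennreal_leI)
  have pot_lower: "ennreal (4/3 * pi * \<tau>\<^sup>2) \<le> pot ?T x" if x: "x \<noteq> 0" "norm x \<le> \<tau>" for x
  proof -
    have "(norm x)\<^sup>2 \<le> \<tau>\<^sup>2" using x by (intro power_mono) auto
    then have "4/3 * pi * \<tau>\<^sup>2 \<le> 2 * pi * (\<tau>\<^sup>2 - (norm x)\<^sup>2/3)" by (simp add: field_simps)
    then show ?thesis using x \<tau>0
      by (auto simp: pot_cball[OF x(1) \<tau>0] intro!: ennreal_leI) (simp add: power2_eq_square power3_eq_cube)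
  qed
  have e: "ennreal (coulr X Y) = coul X Y" if "borel_fin X" "borel_fin Y" for X Y
    using coul_finite[OF that] by (simp add: ennreal_enn2real)
  have 1: "4/3 * pi * \<tau>\<^sup>2 * vol ?D \<le> coulr ?N ?T"
  proof -
    have "ennreal (4/3 * pi * \<tau>\<^sup>2) * emeasure lborel ?D \<le> coul ?D ?T"
      using pot_lower by (intro coul_ge) auto
    then have "ennreal (4/3 * pi * \<tau>\<^sup>2 * vol ?D) \<le> ennreal (coulr ?D ?T)"
      unfolding borel_finD(3)[OF D] e[OF D T] by (simp add: ennreal_mult'[symmetric])
    then have "4/3 * pi * \<tau>\<^sup>2 * vol ?D \<le> coulr ?D ?T"
      by (subst (asm) ennreal_le_iff) auto
    \<comment> \<open>The charge of \<Omega> beyond radius \<tau> only adds to the interaction with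
      the test charge.\<close>
    also have "\<dots> \<le> coulr ?D ?T + coulr (?N - ?D) ?T" by simp
    also have "\<dots> = coulr (?D \<union> (?N - ?D)) ?T" by (rule coulr_Un_left[symmetric]) (auto intro: D ND T)
    also have "?D \<union> (?N - ?D) = ?N" by auto
    finally show ?thesis .
  qed
  have 2: "coulr ?h ?T \<le> 2 * pi * \<tau>\<^sup>2 * vol ?h"
  proof -
    have "coul ?h ?T \<le> ennreal (2 * pi * \<tau>\<^sup>2) * emeasure lborel ?h"
      using pot_upper \<tau> by (intro coul_le) auto
    then have "ennreal (coulr ?h ?T) \<le> ennreal (2 * pi * \<tau>\<^sup>2 * vol ?h)"
      unfolding borel_finD(3)[OF h] e[OF h T] by (simp add: ennreal_mult'[symmetric])
    then show ?thesis by (subst (asm) ennreal_le_iff) auto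
  qed
  have 3: "coulr ?T ?T \<le> 2 * pi * \<tau>\<^sup>2 * (4/3 * pi * \<tau>^3)"
  proof -
    have "coul ?T ?T \<le> ennreal (2 * pi * \<tau>\<^sup>2) * emeasure lborel ?T"
      using pot_upper by (intro coul_le) auto
    then have "ennreal (coulr ?T ?T) \<le> ennreal (2 * pi * \<tau>\<^sup>2 * (4/3 * pi * \<tau>^3))"
      using \<tau>0 unfolding e[OF T T] by (simp add: emeasure_cball_R3 ennreal_mult'[symmetric])
    then show ?thesis using \<tau>0 by (subst (asm) ennreal_le_iff) auto
  qed
  \<comment> \<open>The maximiser of c * (4/3 pi \<tau>^2 q) - c^2 / 2 * (8/3 pi^2 \<tau>^5); the
    maximum is q^2 / (3 \<tau>).\<close>
  define c where "c = q / (2 * pi * \<tau>^3)"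
  have c: "c \<ge> 0" using q \<tau>0 by (simp add: c_def)
  have "q\<^sup>2 / (3 * \<tau>) = c * (4/3 * pi * \<tau>\<^sup>2 * q) - c\<^sup>2 / 2 * (2 * pi * \<tau>\<^sup>2 * (4/3 * pi * \<tau>^3))"
    using \<tau>0 unfolding c_def by (simp add: field_simps power2_eq_square power3_eq_cube)
  also have "4/3 * pi * \<tau>\<^sup>2 * q = 4/3 * pi * \<tau>\<^sup>2 * vol ?D - 2 * pi * \<tau>\<^sup>2 * vol ?h"
    unfolding q_def by (simp add: algebra_simps)
  also have "c * (4/3 * pi * \<tau>\<^sup>2 * vol ?D - 2 * pi * \<tau>\<^sup>2 * vol ?h) - c\<^sup>2 / 2 * (2 * pi * \<tau>\<^sup>2 * (4/3 * pi * \<tau>^3))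
    \<le> c * (coulr ?N ?T - coulr ?h ?T) - c\<^sup>2 / 2 * coulr ?T ?T"
    using 1 2 3 c by (intro diff_mono mult_left_mono) auto
  also have "\<dots> \<le> 32 * pi * R\<^sup>2 + 600 * Q"
    using screening_inequality[OF min R Z V Q T c] enn2real_nonneg[of "deficit R ?h"] by linarith
  finally show ?thesis using \<tau>0 by (simp add: divide_le_eq mult.commute)
qed

subsection \<open>Nonexistence\<close>

text \<open>Finite perimeter comes from the comparison with a ball of volume V, whose energy is
  finite.\<close>

lemma minimizer_imp_volume_minimal:
  assumes min: "is_minimizer Z V \<Omega>" and V: "V > 0"
  obtains A where "volume_minimal Z A" "vol A = V"
proof -
  have \<Omega>: "\<Omega> \<in> sets lebesgue" "emeasure lebesgue \<Omega> = ennreal V" "energy Z \<Omega> = E_Z Z V"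
    using min by (auto simp: is_minimizer_def)
  obtain A where A: "A \<in> sets borel" "emeasure lborel A = emeasure lebesgue \<Omega>" "\<And>Z. energy Z A = energy Z \<Omega>"
    using borel_representative[OF \<Omega>(1)] by metis
  have Af: "borel_fin A" using A \<Omega> by (simp add: borel_fin_def)
  have le: "energy Z A \<le> energy Z A'" if "borel_fin A'" "emeasure lborel A' = emeasure lborel A" for A'
    unfolding A(3) \<Omega>(3) E_Z_def
    using that A(2) \<Omega>(2) by (intro INF_lower) (auto simp: borel_fin_def)
  define R where "R = root 3 (3 * V / (4 * pi))"
  have R: "R > 0" "4/3 * pi * R^3 = V" unfolding R_def using V by (simp_all add: real_root_gt_zero)
  have B: "borel_fin (cball (0::R3) R)" by (rule borel_fin_cball)
  have "energy Z A \<le> energy Z (cball 0 R)"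
    using R A(2) \<Omega>(2) by (intro le B) (simp add: emeasure_cball_R3)
  also have "\<dots> < \<infinity>" unfolding energy_borel[OF B] using perimeter_cball[OF R(1)]
    by (cases "perimeter (cball (0::R3) R)") auto
  finally have "perimeter A < \<infinity>" unfolding energy_borel[OF Af] by (cases "perimeter A") auto
  then have "volume_minimal Z A" unfolding volume_minimal_def using Af le by auto
  moreover have "vol A = V" using A(2) \<Omega>(2) V by (simp add: measure_def)
  ultimately show ?thesis by (rule that)
qed

lemma measure_Diff_borel_fin:
  assumes "borel_fin A" "borel_fin B"
  shows "vol (A - B) = vol A - vol (A \<inter> B)"
proof -
  have I: "borel_fin (A \<inter> B)" "borel_fin (A - B)"
    by (rule borel_fin_subset[OF assms(1)]; use assms in \<open>auto simp: borel_fin_def\<close>)+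
  have "vol ((A \<inter> B) \<union> (A - B)) = vol (A \<inter> B) + vol (A - B)"
    using I by (intro measure_Union) (auto simp: borel_fin_def)
  then show ?thesis by (simp add: Int_Diff_Un)
qed

lemma measure_cball_R3: "r \<ge> 0 \<Longrightarrow> vol (cball (0::R3) r) = 4/3 * pi * r^3"
  by (simp add: measure_def emeasure_cball_R3)

lemma measure_mono_borel_fin:
  "borel_fin B \<Longrightarrow> A \<subseteq> B \<Longrightarrow> A \<in> sets borel \<Longrightarrow> vol A \<le> measure lborel B"
  by (intro measure_mono_fmeasurable) (auto simp: borel_fin_def fmeasurable_def)

text \<open>For Z <= 1 the hole is at most the whole ball, of volume Z. The cuts stay outside radius
  1 instead of R, which may be 0, and the ball of radius 100 holds at most half of the
  volume.\<close>

lemma no_minimal_small_charge: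
  assumes min: "volume_minimal Z \<Omega>" and Z: "0 \<le> Z" "Z \<le> 1" and V: "vol \<Omega> \<ge> 2 * 10^9"
  shows False
proof -
  have \<Omega>: "borel_fin \<Omega>" using min by (simp add: volume_minimal_def)
  note [measurable] = borel_finD(1)[OF \<Omega>]
  define V where "V = vol \<Omega>"
  define R where "R = root 3 (3 * Z / (4 * pi))"
  have R: "R \<ge> 0" "Z = 4/3 * pi * R^3" unfolding R_def using Z by (simp_all add: real_root_ge_zero)
  have "R \<le> 1"
  proof -
    have "3 * Z \<le> 4 * pi" using Z pi_gt3 by linarith
    then show ?thesis unfolding R_def by (simp add: divide_le_eq_1)
  qed
  have hole: "vol (cball 0 R - \<Omega>) \<le> 1"
    using measure_mono_borel_fin[OF borel_fin_cball, of "cball 0 R - \<Omega>" 0 R] Z R by (simp add: measure_cball_R3)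
  have "vol (\<Omega> - cball 0 1) \<le> V"
    unfolding V_def by (rule measure_mono_borel_fin[OF \<Omega>]) auto
  moreover have "V - vol (cball (0::R3) 100) \<le> vol (\<Omega> - cball 0 100)"
    using measure_Diff_borel_fin[OF \<Omega> borel_fin_cball, of 0 100] measure_mono_borel_fin[OF borel_fin_cball, of "\<Omega> \<inter> cball 0 100" 0 100]
    by (simp add: V_def)
  moreover have "vol (cball (0::R3) 100) \<le> V / 2"
    using V pi_less_4 by (simp add: measure_cball_R3 V_def)
  ultimately have "V / 2 \<le> vol (\<Omega> - cball 0 100)" by linarith
  then have "(V / 2)\<^sup>2 \<le> (vol (\<Omega> - cball 0 100))\<^sup>2" using V by (intro power_mono) (auto simp: V_def)
  also have "\<dots> \<le> 1080 * (4 + vol (cball 0 R - \<Omega>)) * vol (\<Omega> - cball 0 1)"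
    using outer_volume_bound[OF min R \<open>R \<le> 1\<close> zero_less_one] by simp
  also have "\<dots> \<le> 1080 * (4 + 1) * V"
    using hole \<open>vol (\<Omega> - cball 0 1) \<le> V\<close> by (intro mult_mono) auto
  finally have "V * V \<le> 21600 * V" by (simp add: power2_eq_square)
  with V show False by (simp add: V_def)
qed

text \<open>The contradiction comes from (Q / 2)^2 <= 1080 (4 + h) (Q + h). The fraction 1/17280 in
  the bound for h is chosen so that 1080 * h * 2 Q <= Q^2 / 8, which the left side Q^2 / 4
  absorbs.\<close>

lemma no_minimal_large_charge:
  assumes min: "volume_minimal Z \<Omega>" and R: "R > 0" and Z: "Z = 4/3 * pi * R^3"
    and V: "vol \<Omega> = Z + Q" and Q: "Q \<ge> 2 * 10^9" "Q \<ge> 2 * 10^9 * R\<^sup>2"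
  shows False
proof -
  have \<Omega>: "borel_fin \<Omega>" using min by (simp add: volume_minimal_def)
  note [measurable] = borel_finD(1)[OF \<Omega>]
  have Q1: "Q \<ge> 1" using Q by simp
  let ?B = "cball (0::R3) R" and ?T = "cball (0::R3) (100 * R)"
  define h where "h = vol (?B - \<Omega>)"
  define p where "p = vol (\<Omega> \<inter> ?T - ?B)"
  have h0: "0 \<le> h" by (simp add: h_def)
  have K: "32 * pi * R\<^sup>2 + 600 * Q \<le> 728 * Q"
  proof -
    have "pi * R\<^sup>2 \<le> 4 * Q" using Q pi_less_4 by (intro mult_mono) auto
    then show ?thesis by simp
  qed
  have h: "h \<le> Q / 17280"
  proof -
    \<comment> \<open>The depth 2048 is just large enough for 728 / (6 * 2048^2) <= 1/34560. The
      shell term then requires Q >= 16 * 2048 * 34560 R^2, about 1.13 * 10^9 R^2, which accounts for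
      the constant 2 * 10^9.\<close>
    have "h \<le> 4 * pi * R\<^sup>2 * 2048 + (32 * pi * R\<^sup>2 + 600 * Q) / (2 * pi * 2048\<^sup>2)"
      unfolding h_def by (rule hole_bound[OF min R Z V Q1]) simp
    also have "(32 * pi * R\<^sup>2 + 600 * Q) / (2 * pi * 2048\<^sup>2) \<le> (728 * Q) / (2 * 3 * 2048\<^sup>2)"
      using K Q pi_gt3 by (intro frac_le) auto
    also have "\<dots> \<le> Q / 34560" using Q by simp
    also have "4 * pi * R\<^sup>2 * 2048 \<le> Q / 34560"
    proof -
      have "pi * R\<^sup>2 \<le> 4 * R\<^sup>2" using pi_less_4 by (intro mult_right_mono) auto
      then show ?thesis using Q by simp
    qed
    finally show ?thesis by simp
  qed
  \<comment> \<open>If more than half of Q were near the ball, \<open>near_charge_bound\<close>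
    would give Q^2 <= C R Q, hence Q <= C R. Squaring and inserting R^2 <= Q / (2 * 10^9) bounds Q
    by 6106, too small.\<close>
  have p: "p \<le> Q / 2"
  proof (rule ccontr)
    assume "\<not> p \<le> Q / 2"
    then have q: "p - 3/2 * h > Q / 4" using h Q1 by simp
    have "(Q / 4)\<^sup>2 \<le> (p - 3/2 * h)\<^sup>2" using q Q1 by (intro power_mono) auto
    also have "\<dots> \<le> 3 * (100 * R) * (32 * pi * R\<^sup>2 + 600 * Q)"
      unfolding p_def h_def by (rule near_charge_bound[OF min R Z V Q1]) (use R q Q1 in \<open>auto simp: p_def h_def\<close>)
    also have "\<dots> \<le> 3 * (100 * R) * (728 * Q)" using K R by (intro mult_left_mono) auto
    finally have "Q * Q \<le> 3494400 * R * Q" by (simp add: power2_eq_square)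
    then have QR: "Q \<le> 3494400 * R" using Q1 by simp
    then have "Q\<^sup>2 \<le> (3494400 * R)\<^sup>2" using Q1 by (intro power_mono) auto
    also have "\<dots> \<le> 3494400\<^sup>2 * (Q / (2 * 10^9))" using Q by (simp add: power_mult_distrib)
    finally have "Q * Q \<le> 6106 * Q" using Q1 by (simp add: power2_eq_square)
    with Q Q1 show False by simp
  qed
  have \<Omega>B: "vol (\<Omega> \<inter> ?B) = Z - h"
    using measure_Diff_borel_fin[OF borel_fin_cball \<Omega>, of 0 R] R by (simp add: h_def measure_cball_R3 Z Int_commute)
  have N: "vol (\<Omega> - ?B) = Q + h"
    using measure_Diff_borel_fin[OF \<Omega> borel_fin_cball, of 0 R] by (simp add: \<Omega>B V)
  have "p = vol (\<Omega> \<inter> ?T) - vol (\<Omega> \<inter> ?B)"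
  proof -
    have "borel_fin (\<Omega> \<inter> ?T)" by (rule borel_fin_subset[OF \<Omega>]) auto
    moreover have "\<Omega> \<inter> ?T \<inter> ?B = \<Omega> \<inter> ?B" using R by auto
    ultimately show ?thesis using measure_Diff_borel_fin[of "\<Omega> \<inter> ?T" ?B] borel_fin_cball by (simp add: p_def)
  qed
  then have N': "vol (\<Omega> - ?T) = Q + h - p"
    using measure_Diff_borel_fin[OF \<Omega> borel_fin_cball, of 0 "100 * R"] by (simp add: \<Omega>B V)
  have "(Q / 2)\<^sup>2 \<le> (Q + h - p)\<^sup>2" using p h0 Q1 by (intro power_mono) auto
  also have "\<dots> \<le> 1080 * (4 + h) * (Q + h)"
    using outer_volume_bound[OF min _ Z order_refl R] R unfolding N N' h_def[symmetric] by simp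
  also have "\<dots> \<le> 1080 * (4 + Q / 17280) * (2 * Q)"
    using h h0 Q1 by (intro mult_mono) auto
  finally have "Q * Q \<le> 69120 * Q" by (simp add: power2_eq_square algebra_simps)
  with Q Q1 show False by simp
qed

theorem theorem1:
  shows "\<exists>M>0. \<forall>Z\<ge>0. \<forall>V. V \<ge> Z + M * max (Z powr (2/3)) 1 \<longrightarrow>
           \<not> (\<exists>\<Omega>. is_minimizer Z V \<Omega>)"
proof (intro exI[of _ "2 * 10^9 :: real"] conjI allI impI notI)
  show "(0::real) < 2 * 10^9" by simp
  fix Z V :: real
  assume Z: "0 \<le> Z" and V: "Z + 2 * 10^9 * max (Z powr (2/3)) 1 \<le> V" and "\<exists>\<Omega>. is_minimizer Z V \<Omega>"
  then obtain \<Omega> where \<Omega>: "is_minimizer Z V \<Omega>" by blast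
  have V1: "V - Z \<ge> 2 * 10^9" "V - Z \<ge> 2 * 10^9 * Z powr (2/3)" using V by (auto simp: max_def split: if_splits)
  obtain A where A: "volume_minimal Z A" "vol A = V"
    using minimizer_imp_volume_minimal[OF \<Omega>] V1 Z by auto
  show False
  proof (cases "Z \<le> 1")
    case True
    then show False using no_minimal_small_charge[OF A(1) Z] A(2) V1 Z by simp
  next
    case False
    define R where "R = root 3 (3 * Z / (4 * pi))"
    have R: "R > 0" "Z = 4/3 * pi * R^3" unfolding R_def using False by (simp_all add: real_root_gt_zero)
    \<comment> \<open>Since 4/3 pi >= 1, this yields R^2 <= Z powr (2/3) and turns the assumption on
      V into the one on R that \<open>no_minimal_large_charge\<close> expects.\<close>
    have "R^3 \<le> Z"
    proof -
      have "1 * R^3 \<le> (4/3 * pi) * R^3" using R pi_gt3 by (intro mult_right_mono) auto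
      then show ?thesis by (simp only: R(2)[symmetric] mult_1)
    qed
    then have "(R^3) powr (2/3) \<le> Z powr (2/3)" using R(1) by (intro powr_mono2) auto
    also have "(R^3) powr (2/3) = R\<^sup>2"
    proof -
      have "(R^3) powr (2/3) = (R powr 3) powr (2/3)" using R by (simp add: powr_numeral)
      also have "\<dots> = R powr 2" by (simp add: powr_powr)
      finally show ?thesis using R by (simp add: powr_numeral)
    qed
    finally have "2 * 10^9 * R\<^sup>2 \<le> V - Z" using V1 by simp
    then show False using no_minimal_large_charge[OF A(1) R _ V1(1)] A(2) by simp
  qed
qed

end
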